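(* Let $k,q\in\mathbb{N}$ and let $\mathcal{A}(k;q)=\{\beta>0:\mathfrak{c}^{(\beta)}(k;q)<\infty\}$. Then: (i) $\mathcal{A}(1;q)=(0,\infty)$; (ii) $\mathcal{A}(2;q)=(0,4q^2)$; (iii) for $k\ge 3$, $(0,2]\subset\mathcal{A}(k;q)$ and moreover $[2kq^2,\infty)\cap\mathcal{A}(k;q)=\emptyset$.
   Context: $\mathbb{N}=\{1,2,3,\dots\}$. **Interlacing.** For $M\in\mathbb{N}$ let $\mathsf{W}_+^{(M)}=\{x\in\mathbb{R}^M: x_1\ge x_2\ge\dots\ge x_M\ge 0\}$. For $y\in\mathsf{W}_+^{(M)}$, $x\in\mathsf{W}_+^{(M+1)}$ write $y\prec x$ (interlacing) if $x_1\ge y_1\ge x_2\ge\dots\ge x_M\ge y_M\ge x_{M+1}$. For $x\in\mathsf{W}_+^{(M)}$ with $x_1\le1$ put $\mathfrak{e}_c(x)=(1,x_1,\dots,x_M,0)\in\mathsf{W}_+^{(M+2)}$, and $\mathfrak{e}_c(\emptyset)=(1,0)$. **Weight.** For $\delta>0$ and $y\prec x$ with $y\in\mathsf{W}_+^{(M)}$, $x\in\mathsf{W}_+^{(M+1)}$, $$\phi^{(\delta)}_{M,M+1}(y,x)=\frac{1}{\Gamma(\delta)^M}\prod_{i=1}^{M+1}\prod_{j=1}^M|x_i-y_j|^{\delta-1}\prod_{1\le i<j\le M+1}(x_i-x_j)^{1-\delta}\prod_{1\le i<j\le M}(y_i-y_j)^{1-\delta}.$$ **The set $\mathsf{I}_c(k;q)$.**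 It consists of tuples $\mathsf{X}=(x^{(1)},\dots,x^{(kq-1)},x^{(kq)}=\tilde x^{(kq)},\tilde x^{(kq-1)},\dots,\tilde x^{(1)})$ with $x^{(i)},\tilde x^{(i)}\in\mathsf{W}_+^{(i)}$, all coordinates in $[0,1]$, $$x^{(1)}\prec x^{(2)}\prec\dots\prec x^{(kq)}=\tilde x^{(kq)}\succ\dots\succ\tilde x^{(2)}\succ\tilde x^{(1)},$$ and satisfying the $k-1$ (distinct) sum constraints $\sum_{i=1}^{2jq}x_i^{(2jq)}=jq$ and $\sum_{i=1}^{2jq}\tilde x_i^{(2jq)}=jq$ for $j=1,\dots,\lfloor k/2\rfloor$. It has $(kq)^2-(k-1)$ free coordinates (the common row $x^{(kq)}=\tilde x^{(kq)}$ is counted once, and each sum constraint is used to eliminate one coordinate of its row); $d\mathsf{X}$ denotes Lebesgue measure in these free coordinates. **The coefficient.** For $\beta>0$, with the convention $\tilde x^{(0)}=\emptyset$, $$\mathfrak{c}^{(\beta)}(k;q)=\int_{\mathsf{I}_c(k;q)}\prod_{M=1}^{kq-1}\phi^{(2/\beta)}_{M,M+1}(x^{(M)},x^{(M+1)})\prod_{M=0}^{kq-1}\phi^{(2/\beta)}_{M+1,M+2}\big(\tilde x^{(M+1)},\mathfrak{e}_c(\tilde x^{(M)})\big)\,d\mathsf{X}\in[0,\infty].$$ *)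

theory Defs
  imports "HOL-Analysis.Analysis"
begin

text \<open>A vector of length \<open>M\<close> is a function \<open>nat \<Rightarrow> real\<close> of which only the values at
  \<open>1, \<dots>, M\<close> matter.\<close>

definition W_plus :: "nat \<Rightarrow> (nat \<Rightarrow> real) \<Rightarrow> bool" where
  "W_plus M x \<longleftrightarrow> (\<forall>i\<in>{1..<M}. x i \<ge> x (i + 1)) \<and> (\<forall>i\<in>{1..M}. x i \<ge> 0)"

definition interlaces :: "nat \<Rightarrow> (nat \<Rightarrow> real) \<Rightarrow> (nat \<Rightarrow> real) \<Rightarrow> bool" where
  "interlaces M y x \<longleftrightarrow> W_plus M y \<and> W_plus (M + 1) x \<and>
     (\<forall>i\<in>{1..M}. x i \<ge> y i \<and> y i \<ge> x (i + 1))"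

text \<open>\<open>ext_c M x = (1, x\<^sub>1, \<dots>, x\<^sub>M, 0)\<close>, of length \<open>M + 2\<close>; for \<open>M = 0\<close> this is \<open>(1, 0)\<close>
  whatever \<open>x\<close> is.\<close>

definition ext_c :: "nat \<Rightarrow> (nat \<Rightarrow> real) \<Rightarrow> nat \<Rightarrow> real" where
  "ext_c M x = (\<lambda>i. if i = 1 then 1 else if i \<le> M + 1 then x (i - 1) else 0)"

text \<open>The weight \<open>\<phi>\<close> between levels \<open>M\<close> and \<open>M + 1\<close>. Since \<open>0 powr a = 0\<close>, it takes the value
  \<open>0\<close> as soon as a factor has base \<open>0\<close>. In the integral below such
  coincidences form a null set.\<close>

definition phi :: "real \<Rightarrow> nat \<Rightarrow> (nat \<Rightarrow> real) \<Rightarrow> (nat \<Rightarrow> real) \<Rightarrow> real" where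
  "phi \<delta> M y x =
     1 / Gamma \<delta> ^ M
     * (\<Prod>i=1..M+1. \<Prod>j=1..M. \<bar>x i - y j\<bar> powr (\<delta> - 1))
     * (\<Prod>(i, j)\<in>{(i, j). 1 \<le> i \<and> i < j \<and> j \<le> M + 1}. (x i - x j) powr (1 - \<delta>))
     * (\<Prod>(i, j)\<in>{(i, j). 1 \<le> i \<and> i < j \<and> j \<le> M}. (y i - y j) powr (1 - \<delta>))"

text \<open>With \<open>N = k q\<close>, write \<open>x i\<close> and \<open>y i\<close> for the plain and the tilded vector of length \<open>i\<close>.
  A tuple \<open>(x 1, \<dots>, x N = y N, \<dots>, y 1)\<close> is stored as a function of pairs (row, position), the
  rows being numbered \<open>1, \<dots>, 2N - 1\<close> from left to right. Thus row \<open>i \<le> N\<close> is \<open>x i\<close>, row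
  \<open>2N - i\<close> is \<open>y i\<close>, and the common middle row \<open>N\<close> occurs once.\<close>

definition row_len :: "nat \<Rightarrow> nat \<Rightarrow> nat \<Rightarrow> nat" where
  "row_len k q r = min r (2 * k * q - r)"

definition coords :: "nat \<Rightarrow> nat \<Rightarrow> (nat \<times> nat) set" where
  "coords k q = (SIGMA r:{1..2 * k * q - 1}. {1..row_len k q r})"

definition xrow :: "(nat \<times> nat \<Rightarrow> real) \<Rightarrow> nat \<Rightarrow> nat \<Rightarrow> real" where
  "xrow X i = (\<lambda>l. X (i, l))"

definition txrow :: "nat \<Rightarrow> nat \<Rightarrow> (nat \<times> nat \<Rightarrow> real) \<Rightarrow> nat \<Rightarrow> nat \<Rightarrow> real" where
  "txrow k q X i = (\<lambda>l. X (2 * k * q - i, l))"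

definition I_c :: "nat \<Rightarrow> nat \<Rightarrow> (nat \<times> nat \<Rightarrow> real) set" where
  "I_c k q = {X \<in> coords k q \<rightarrow>\<^sub>E {0..1}.
     (\<forall>i\<in>{1..k * q}. W_plus i (xrow X i) \<and> W_plus i (txrow k q X i)) \<and>
     (\<forall>i\<in>{1..<k * q}. interlaces i (xrow X i) (xrow X (i + 1))) \<and>
     (\<forall>i\<in>{1..<k * q}. interlaces i (txrow k q X i) (txrow k q X (i + 1))) \<and>
     (\<forall>j\<in>{1..k div 2}. (\<Sum>i=1..2 * j * q. xrow X (2 * j * q) i) = real (j * q) \<and>
                       (\<Sum>i=1..2 * j * q. txrow k q X (2 * j * q) i) = real (j * q))}"

text \<open>Rows carrying a sum constraint. If \<open>k\<close> is even, \<open>j = k div 2\<close> gives the middle row in both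
  sets. There are \<open>k - 1\<close> such rows.\<close>

definition constrained_rows :: "nat \<Rightarrow> nat \<Rightarrow> nat set" where
  "constrained_rows k q =
     (\<lambda>j. 2 * j * q) ` {1..k div 2} \<union> (\<lambda>j. 2 * k * q - 2 * j * q) ` {1..k div 2}"

text \<open>In each constrained row the last coordinate is eliminated. Eliminating another one instead
  gives the same measure, the change of variables being affine with determinant of modulus \<open>1\<close>.\<close>

definition eliminated :: "nat \<Rightarrow> nat \<Rightarrow> (nat \<times> nat) set" where
  "eliminated k q = (\<lambda>r. (r, row_len k q r)) ` constrained_rows k q"

definition free_coords :: "nat \<Rightarrow> nat \<Rightarrow> (nat \<times> nat) set" where
  "free_coords k q = coords k q - eliminated k q"

text \<open>The tuple determined by its free coordinates. A constrained row of length \<open>n\<close> has sum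
  \<open>n / 2\<close>.\<close>

definition fill_in :: "nat \<Rightarrow> nat \<Rightarrow> (nat \<times> nat \<Rightarrow> real) \<Rightarrow> nat \<times> nat \<Rightarrow> real" where
  "fill_in k q \<omega> = (\<lambda>(r, l)\<in>coords k q.
     if (r, l) \<in> eliminated k q
     then real (row_len k q r) / 2 - (\<Sum>m=1..<row_len k q r. \<omega> (r, m))
     else \<omega> (r, l))"

definition integrand :: "real \<Rightarrow> nat \<Rightarrow> nat \<Rightarrow> (nat \<times> nat \<Rightarrow> real) \<Rightarrow> real" where
  "integrand \<beta> k q X =
     (\<Prod>M=1..k * q - 1. phi (2 / \<beta>) M (xrow X M) (xrow X (M + 1)))
     * (\<Prod>M=0..k * q - 1. phi (2 / \<beta>) (M + 1) (txrow k q X (M + 1)) (ext_c M (txrow k q X M)))"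

definition c_coeff :: "real \<Rightarrow> nat \<Rightarrow> nat \<Rightarrow> ennreal" where
  "c_coeff \<beta> k q =
     (\<integral>\<^sup>+ \<omega>. ennreal (integrand \<beta> k q (fill_in k q \<omega>)) * indicator (I_c k q) (fill_in k q \<omega>)
        \<partial>(\<Pi>\<^sub>M p\<in>free_coords k q. (lborel :: real measure)))"

definition A_set :: "nat \<Rightarrow> nat \<Rightarrow> real set" where
  "A_set k q = {\<beta>. \<beta> > 0 \<and> c_coeff \<beta> k q < \<infinity>}"

end

theory Submission
  imports Defs
begin

text \<open>Put \<open>\<delta> = 2 / \<beta>\<close> and \<open>N = k * q\<close>. The weights of the tilded half differ from those of the plain half
  only by interactions with the endpoints \<open>0\<close> and \<open>1\<close>, and these cancel between successive rows. So the integrand is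
  the product of \<open>phi\<close> over both halves, times \<open>(x i * (1 - x i)) powr (\<delta> - 1)\<close> for the entries of
  the middle row (\<open>phi_ext_c\<close>, \<open>integrand_eq\<close>). Interlacing allows to write \<open>phi\<close> as a product of
  powers, with exponent \<open>\<delta> - 1\<close>, of quotients of nested distances, each at most \<open>1\<close> (\<open>phi_paired\<close>). For
  \<open>\<beta> \<le> 2\<close> the exponent is nonnegative, the integrand is bounded, and so is the domain.

  For \<open>\<beta> \<ge> 2\<close> convergence rests on a pointwise form of the Dixon-Anderson integral: \<open>phi\<close> times the power \<open>\<delta>\<close> of the
  Vandermonde product of the shorter row is at most a constant times the same power for the longer row and
  one beta density for each entry of the shorter row (\<open>phi_vandermonde_le\<close>). The Vandermonde powers
  telescope. Each beta density has a bounded integral over its own coordinate, whatever the row above it is,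
  so both halves can be integrated away coordinate by coordinate (\<open>nn_integral_prod_le\<close>). The middle row is left, with
  the weight of the Selberg integral, the power \<open>2 * \<delta>\<close> of its Vandermonde product times the endpoint factors.
  For \<open>k = 1\<close> this is bounded by a product of beta densities. For \<open>k = 2\<close> the row has \<open>2 * q\<close>
  entries with sum \<open>q\<close>, and on this hyperplane the only obstruction is the corner where \<open>q\<close> entries equal \<open>1\<close> and
  \<open>q\<close> entries equal \<open>0\<close>. With the distance \<open>U\<close> of entry \<open>q\<close> to \<open>1\<close> as scale, the other variables
  integrate to constants and the density \<open>U powr (2 * \<delta> * q\<^sup>2 - 2)\<close> is left (\<open>prod_clusters_le\<close>), which is
  integrable for \<open>\<beta> < 4 * q\<^sup>2\<close>.

  Divergence for \<open>k \<ge> 2\<close> and \<open>\<beta> \<ge> 2 * k * q\<^sup>2\<close> comes from configurations in which all constrained rows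
  have half of their entries near \<open>1\<close> and half near \<open>0\<close>, while the other rows have as few entries near
  the endpoints as interlacing permits. There are \<open>P = k * (k - 1) * q\<^sup>2\<close> entries within a small \<open>e\<close> of
  an endpoint. Each contributes a factor \<open>e powr (\<delta> - 1)\<close> to the integrand, through \<open>phi\<close> (\<open>phi_ge\<close>) or, in the
  middle row, through the endpoint factors, and each except the
  \<open>k - 1\<close> eliminated ones a factor \<open>e\<close> to the volume, so the scale \<open>e\<close> contributes
  \<open>e\<close> to the power \<open>\<delta> * P - (k - 1)\<close>, which stays away from \<open>0\<close> if \<open>\<delta> * k * q\<^sup>2 \<le> 1\<close>. Infinitely many disjoint scales
  make the integral infinite (\<open>c_coeff_infinite\<close>). For \<open>k = 2\<close> the two thresholds coincide.\<close>

section \<open>Products over pairs of indices\<close>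

definition pairs :: "nat \<Rightarrow> (nat \<times> nat) set" where
  "pairs M = {(i, j). 1 \<le> i \<and> i < j \<and> j \<le> M}"

lemma finite_pairs [simp]: "finite (pairs M)"
  by (rule finite_subset[of _ "{1..M} \<times> {1..M}"]) (auto simp: pairs_def)

lemma prod_pairs_last_column:
  "(\<Prod>p\<in>pairs (Suc M). F p) = (\<Prod>p\<in>pairs M. F p) * (\<Prod>i=1..M. F (i, Suc M))"
proof -
  have "pairs (Suc M) = pairs M \<union> (\<lambda>i. (i, Suc M)) ` {1..M}"
    by (auto simp: pairs_def image_def)
  moreover have "pairs M \<inter> (\<lambda>i. (i, Suc M)) ` {1..M} = {}"
    by (auto simp: pairs_def)
  ultimately show ?thesis
    by (simp add: prod.union_disjoint prod.reindex inj_on_def)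
qed

lemma prod_pairs_diagonal:
  "(\<Prod>p\<in>pairs (Suc M). F p) =
     (\<Prod>i=1..M. F (i, Suc i)) * (\<Prod>(i, j)\<in>pairs M. F (i, Suc j))"
proof -
  have "p \<in> (\<lambda>i. (i, Suc i)) ` {1..M} \<union> (\<lambda>(i, j). (i, Suc j)) ` pairs M"
    if "p \<in> pairs (Suc M)" for p
  proof -
    obtain i j where p: "p = (i, j)" "1 \<le> i" "i < j" "j \<le> Suc M"
      using \<open>p \<in> pairs (Suc M)\<close> by (auto simp: pairs_def)
    then obtain j' where j': "j = Suc j'" by (cases j) auto
    show ?thesis
    proof (cases "i = j'")
      case False
      then have "(i, j') \<in> pairs M" using p j' by (auto simp: pairs_def)
      then show ?thesis using p j' by (force simp: image_def)
    qed (use p j' in auto)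
  qed
  then have "pairs (Suc M) = (\<lambda>i. (i, Suc i)) ` {1..M} \<union> (\<lambda>(i, j). (i, Suc j)) ` pairs M"
    by (auto simp: pairs_def)
  moreover have "(\<lambda>i. (i, Suc i)) ` {1..M} \<inter> (\<lambda>(i, j). (i, Suc j)) ` pairs M = {}"
    by (auto simp: pairs_def)
  moreover have "inj_on (\<lambda>(i, j). (i, Suc j)) (pairs M)" by (auto simp: inj_on_def)
  ultimately show ?thesis
    by (simp add: prod.union_disjoint prod.reindex inj_on_def case_prod_beta)
qed

text \<open>For interlacing rows the pairs \<open>i \<le> j\<close> are those with \<open>x i\<close> above \<open>y j\<close>, the pairs \<open>j < i\<close>
  those with \<open>x i\<close> below. Both halves of the rectangle become triangles of the same size.\<close>

lemma prod_rectangle_pairs: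
  "(\<Prod>i=1..Suc M. \<Prod>j=1..M. f i j) =
     (\<Prod>(i, j)\<in>pairs (Suc M). f i (j - 1)) * (\<Prod>(i, j)\<in>pairs (Suc M). f j i)"
proof -
  let ?R = "{1..Suc M} \<times> {1..M}"
  have "(\<Prod>i=1..Suc M. \<Prod>j=1..M. f i j) = (\<Prod>(i, j)\<in>?R. f i j)"
    by (simp add: prod.cartesian_product)
  also have "?R = {(i, j)\<in>?R. i \<le> j} \<union> {(i, j)\<in>?R. j < i}" by auto
  also have "(\<Prod>(i, j)\<in>\<dots>. f i j) =
      (\<Prod>(i, j)\<in>{(i, j)\<in>?R. i \<le> j}. f i j) * (\<Prod>(i, j)\<in>{(i, j)\<in>?R. j < i}. f i j)"
    by (rule prod.union_disjoint) (auto intro: finite_subset[of _ ?R])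
  also have "(\<Prod>(i, j)\<in>{(i, j)\<in>?R. i \<le> j}. f i j) = (\<Prod>(i, j)\<in>pairs (Suc M). f i (j - 1))"
    by (rule prod.reindex_bij_witness[of _ "\<lambda>(i, j). (i, j - 1)" "\<lambda>(i, j). (i, j + 1)"])
      (auto simp: pairs_def)
  also have "(\<Prod>(i, j)\<in>{(i, j)\<in>?R. j < i}. f i j) = (\<Prod>(i, j)\<in>pairs (Suc M). f j i)"
    by (rule prod.reindex_bij_witness[of _ "\<lambda>(i, j). (j, i)" "\<lambda>(i, j). (j, i)"])
      (auto simp: pairs_def)
  finally show ?thesis .
qed

text \<open>Every difference between the rows is put next to a difference inside a row that contains it:
  \<open>x i - y (j - 1)\<close> lies inside \<open>x i - x j\<close>, and \<open>y i - x j\<close> lies inside \<open>y i - y j\<close>. Only the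
  differences to the lowest entry of \<open>x\<close> remain single. This form serves for both the upper bound
  (\<open>\<delta> \<ge> 1\<close>) and the lower bound (\<open>\<delta> \<le> 1\<close>).\<close>

lemma phi_paired:
  "phi \<delta> M y x = 1 / Gamma \<delta> ^ M
     * (\<Prod>(i, j)\<in>pairs (Suc M). \<bar>x i - y (j - 1)\<bar> powr (\<delta> - 1) * (x i - x j) powr (1 - \<delta>))
     * (\<Prod>(i, j)\<in>pairs M. \<bar>x j - y i\<bar> powr (\<delta> - 1) * (y i - y j) powr (1 - \<delta>))
     * (\<Prod>i=1..M. \<bar>x (Suc M) - y i\<bar> powr (\<delta> - 1))"
proof -
  have "phi \<delta> M y x = 1 / Gamma \<delta> ^ M
     * (\<Prod>i=1..Suc M. \<Prod>j=1..M. \<bar>x i - y j\<bar> powr (\<delta> - 1))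
     * (\<Prod>(i, j)\<in>pairs (Suc M). (x i - x j) powr (1 - \<delta>))
     * (\<Prod>(i, j)\<in>pairs M. (y i - y j) powr (1 - \<delta>))"
    by (simp add: phi_def pairs_def)
  then show ?thesis
    unfolding prod_rectangle_pairs
    by (subst (asm) (2) prod_pairs_last_column) (simp add: case_prod_beta prod.distrib mult_ac)
qed

text \<open>The arrangement adapted to integrating over \<open>y\<close>: the nearest neighbours of each \<open>y i\<close> are
  split off, because they carry its singularities; the rest is a product of cross ratios.\<close>

lemma phi_adjacent:
  "phi \<delta> M y x = 1 / Gamma \<delta> ^ M
     * (\<Prod>i=1..M. \<bar>x i - y i\<bar> powr (\<delta> - 1) * \<bar>x (Suc i) - y i\<bar> powr (\<delta> - 1)
                     * (x i - x (Suc i)) powr (1 - \<delta>))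
     * (\<Prod>(i, j)\<in>pairs M. \<bar>x i - y j\<bar> powr (\<delta> - 1) * \<bar>x (Suc j) - y i\<bar> powr (\<delta> - 1)
                     * (x i - x (Suc j)) powr (1 - \<delta>) * (y i - y j) powr (1 - \<delta>))"
proof -
  have "phi \<delta> M y x = 1 / Gamma \<delta> ^ M
     * (\<Prod>i=1..Suc M. \<Prod>j=1..M. \<bar>x i - y j\<bar> powr (\<delta> - 1))
     * (\<Prod>(i, j)\<in>pairs (Suc M). (x i - x j) powr (1 - \<delta>))
     * (\<Prod>(i, j)\<in>pairs M. (y i - y j) powr (1 - \<delta>))"
    by (simp add: phi_def pairs_def)
  then show ?thesis
    unfolding prod_rectangle_pairs prod_pairs_diagonal
    by (simp add: case_prod_beta prod.distrib mult_ac)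
qed

section \<open>Bounds for the weight between interlacing rows\<close>

lemma phi_nonneg: "\<delta> > 0 \<Longrightarrow> phi \<delta> M y x \<ge> 0"
  unfolding phi_def by (intro mult_nonneg_nonneg prod_nonneg)
    (auto intro!: prod_nonneg simp: Gamma_real_nonneg less_imp_le Gamma_real_pos)

lemma W_plus_antimono:
  assumes "W_plus M x" "1 \<le> i" "i \<le> j" "j \<le> M"
  shows "x j \<le> x i"
  using assms(3,4)
proof (induction j rule: dec_induct)
  case (step n)
  then have "x n \<ge> x (n + 1)" using assms(1,2) by (auto simp: W_plus_def)
  then show ?case using step by simp
qed simp

lemma interlaces_between:
  assumes "interlaces M y x" "1 \<le> j" "j \<le> M"
  shows "1 \<le> i \<Longrightarrow> i \<le> j \<Longrightarrow> y j \<le> x i" and "j < i \<Longrightarrow> i \<le> Suc M \<Longrightarrow> x i \<le> y j"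
proof -
  have W: "W_plus (Suc M) x" and *: "y j \<le> x j" "x (Suc j) \<le> y j"
    using assms by (auto simp: interlaces_def)
  show "y j \<le> x i" if "1 \<le> i" "i \<le> j"
    using W_plus_antimono[OF W that] *(1) assms(3) by simp
  show "x i \<le> y j" if "j < i" "i \<le> Suc M"
    using W_plus_antimono[OF W, of "Suc j" i] *(2) that by simp
qed

lemma powr_ratio_le_1:
  fixes p :: real
  assumes "0 \<le> p" "p \<le> r" "1 \<le> \<delta>"
  shows "p powr (\<delta> - 1) * r powr (1 - \<delta>) \<le> 1"
proof (cases "r = 0")
  case False
  then have "p powr (\<delta> - 1) * r powr (1 - \<delta>) \<le> r powr (\<delta> - 1) * r powr (1 - \<delta>)"
    using assms by (intro mult_right_mono powr_mono2) auto
  also have "\<dots> = 1" using False by (simp flip: powr_add)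
  finally show ?thesis .
qed simp

lemma powr_ratio_ge_1:
  fixes p :: real
  assumes "0 < p" "p \<le> r" "\<delta> \<le> 1"
  shows "p powr (\<delta> - 1) * r powr (1 - \<delta>) \<ge> 1"
proof -
  have "1 = r powr (\<delta> - 1) * r powr (1 - \<delta>)" using assms by (simp flip: powr_add)
  also have "\<dots> \<le> p powr (\<delta> - 1) * r powr (1 - \<delta>)"
    using assms by (intro mult_right_mono powr_mono2') auto
  finally show ?thesis .
qed

text \<open>In the paired form each factor is a power with exponent \<open>\<delta> - 1 \<ge> 0\<close> of a quotient that
  interlacing keeps below \<open>1\<close>.\<close>

lemma phi_le_of_one_le:
  assumes \<delta>: "1 \<le> \<delta>" and il: "interlaces M y x"
    and y1: "\<And>i. i \<in> {1..M} \<Longrightarrow> y i \<le> 1"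
  shows "phi \<delta> M y x \<le> 1 / Gamma \<delta> ^ M"
proof -
  have x0: "0 \<le> x (Suc M)" and Wy: "W_plus M y" using il by (auto simp: interlaces_def W_plus_def)
  have 1: "(\<Prod>(i, j)\<in>pairs (Suc M). \<bar>x i - y (j - 1)\<bar> powr (\<delta> - 1) * (x i - x j) powr (1 - \<delta>)) \<le> 1"
  proof (intro prod_le_1, clarify)
    fix i j assume "(i, j) \<in> pairs (Suc M)"
    then have "1 \<le> i" "i < j" "j \<le> Suc M" by (auto simp: pairs_def)
    then have "y (j - 1) \<le> x i" "x j \<le> y (j - 1)"
      using interlaces_between[OF il, of "j - 1"] by auto
    then show "0 \<le> \<bar>x i - y (j - 1)\<bar> powr (\<delta> - 1) * (x i - x j) powr (1 - \<delta>)
      \<and> \<bar>x i - y (j - 1)\<bar> powr (\<delta> - 1) * (x i - x j) powr (1 - \<delta>) \<le> 1"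
      using \<delta> by (auto intro!: powr_ratio_le_1)
  qed
  have 2: "(\<Prod>(i, j)\<in>pairs M. \<bar>x j - y i\<bar> powr (\<delta> - 1) * (y i - y j) powr (1 - \<delta>)) \<le> 1"
  proof (intro prod_le_1, clarify)
    fix i j assume "(i, j) \<in> pairs M"
    then have "1 \<le> i" "i < j" "j \<le> M" by (auto simp: pairs_def)
    then have "x j \<le> y i" "y j \<le> x j"
      using interlaces_between(2)[OF il, of i j] interlaces_between(1)[OF il, of j j] by auto
    then show "0 \<le> \<bar>x j - y i\<bar> powr (\<delta> - 1) * (y i - y j) powr (1 - \<delta>)
      \<and> \<bar>x j - y i\<bar> powr (\<delta> - 1) * (y i - y j) powr (1 - \<delta>) \<le> 1"
      using \<delta> by (auto intro!: powr_ratio_le_1)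
  qed
  have 3: "(\<Prod>i=1..M. \<bar>x (Suc M) - y i\<bar> powr (\<delta> - 1)) \<le> 1"
  proof (intro prod_le_1 conjI)
    fix i assume "i \<in> {1..M}"
    then have "\<bar>x (Suc M) - y i\<bar> \<le> 1"
      using interlaces_between(2)[OF il, of i "Suc M"] x0 y1[of i] by auto
    then show "\<bar>x (Suc M) - y i\<bar> powr (\<delta> - 1) \<le> 1"
      using \<delta> powr_mono2[of "\<delta> - 1" "\<bar>x (Suc M) - y i\<bar>" 1] by simp
  qed simp
  have nn: "0 \<le> (\<Prod>(i, j)\<in>pairs (Suc M). \<bar>x i - y (j - 1)\<bar> powr (\<delta> - 1) * (x i - x j) powr (1 - \<delta>))"
    "0 \<le> (\<Prod>(i, j)\<in>pairs M. \<bar>x j - y i\<bar> powr (\<delta> - 1) * (y i - y j) powr (1 - \<delta>))"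
    "0 \<le> (\<Prod>i=1..M. \<bar>x (Suc M) - y i\<bar> powr (\<delta> - 1))"
    by (auto intro!: prod_nonneg)
  have "phi \<delta> M y x \<le> 1 / Gamma \<delta> ^ M * 1 * 1 * 1"
    unfolding phi_paired using \<delta> nn 1 2 3
    by (intro mult_mono mult_nonneg_nonneg order_refl) (auto simp: Gamma_real_pos less_imp_le)
  then show ?thesis by simp
qed

definition vandermonde :: "nat \<Rightarrow> (nat \<Rightarrow> real) \<Rightarrow> real" where
  "vandermonde M x = (\<Prod>(i, j)\<in>pairs M. x i - x j)"

lemma vandermonde_powr:
  assumes "W_plus M x"
  shows "vandermonde M x powr d = (\<Prod>(i, j)\<in>pairs M. (x i - x j) powr d)"
  unfolding vandermonde_def case_prod_beta using W_plus_antimono[OF assms]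
  by (subst prod_powr_distrib) (auto simp: pairs_def)

text \<open>The beta density on the interval from \<open>s\<close> to \<open>p\<close>, with the power of \<open>p - s\<close> that makes its
  integral over that interval independent of \<open>p\<close> and \<open>s\<close>.\<close>

definition beta_kernel :: "real \<Rightarrow> real \<Rightarrow> real \<Rightarrow> real \<Rightarrow> real" where
  "beta_kernel \<delta> p s y =
     (p - s) powr (1 - 2 * \<delta>) * (p - y) powr (\<delta> - 1) * (y - s) powr (\<delta> - 1)"

text \<open>Four points on a line satisfy \<open>(a - c) (b - d) = (a - d) (b - c) + (a - b) (c - d)\<close>, so the
  product of the crossing distances dominates the product of the nested ones.\<close>

lemma crossing_ratio_le:
  fixes a b c d :: real
  assumes "a \<ge> b" "b \<ge> c" "c \<ge> d" "0 < \<delta>" "\<delta> \<le> 1"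
  shows "(a - c) powr (\<delta> - 1) * (b - d) powr (\<delta> - 1) * (a - d) powr (1 - \<delta>) * (b - c) powr (1 - \<delta>) \<le> 1"
proof (cases "b = c")
  case False
  have "(a - d) * (b - c) \<le> (a - c) * (b - d)"
  proof -
    have "(a - c) * (b - d) - (a - d) * (b - c) = (a - b) * (c - d)" by (simp add: algebra_simps)
    moreover have "(a - b) * (c - d) \<ge> 0" using assms by simp
    ultimately show ?thesis by linarith
  qed
  moreover have pos: "0 < (a - d) * (b - c)" using False assms by (intro mult_pos_pos) auto
  ultimately have "((a - c) * (b - d)) powr (\<delta> - 1) \<le> ((a - d) * (b - c)) powr (\<delta> - 1)"
    using assms by (intro powr_mono2') auto
  then have "((a - c) * (b - d)) powr (\<delta> - 1) * ((a - d) * (b - c)) powr (1 - \<delta>)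
    \<le> ((a - d) * (b - c)) powr (\<delta> - 1) * ((a - d) * (b - c)) powr (1 - \<delta>)"
    by (intro mult_right_mono) auto
  also have "\<dots> = 1" using pos by (auto simp flip: powr_add)
  finally show ?thesis using assms by (simp add: powr_mult mult_ac)
qed simp

text \<open>A pointwise substitute for the Dixon-Anderson integral. The latter says that integrating
  \<open>phi\<close> against the power \<open>\<delta>\<close> of the Vandermonde product of \<open>y\<close> gives a multiple of the same power for
  \<open>x\<close>; here the integrand itself is bounded by that power times independent beta densities, one for
  each \<open>y i\<close> on its own interval. The cross ratios are discarded by the previous lemma, and
  \<open>y i - y j\<close> is enlarged to \<open>x i - x (j + 1)\<close>.\<close>

lemma phi_vandermonde_le:
  assumes \<delta>: "0 < \<delta>" "\<delta> \<le> 1" and il: "interlaces M y x"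
  shows "phi \<delta> M y x * vandermonde M y powr \<delta> \<le>
    1 / Gamma \<delta> ^ M * vandermonde (Suc M) x powr \<delta> * (\<Prod>i=1..M. beta_kernel \<delta> (x i) (x (Suc i)) (y i))"
proof -
  let ?A = "\<lambda>i. \<bar>x i - y i\<bar> powr (\<delta> - 1) * \<bar>x (Suc i) - y i\<bar> powr (\<delta> - 1)
                     * (x i - x (Suc i)) powr (1 - \<delta>)"
  let ?B = "\<lambda>(i, j). \<bar>x i - y j\<bar> powr (\<delta> - 1) * \<bar>x (Suc j) - y i\<bar> powr (\<delta> - 1)
                     * (x i - x (Suc j)) powr (1 - \<delta>) * (y i - y j) powr (1 - \<delta>)"
  have Wy: "W_plus M y" and Wx: "W_plus (Suc M) x" using il by (auto simp: interlaces_def)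
  have yy: "vandermonde M y powr \<delta> = (\<Prod>(i, j)\<in>pairs M. (y i - y j) powr \<delta>)"
    by (rule vandermonde_powr[OF Wy])
  have xx: "vandermonde (Suc M) x powr \<delta> =
    (\<Prod>i=1..M. (x i - x (Suc i)) powr \<delta>) * (\<Prod>(i, j)\<in>pairs M. (x i - x (Suc j)) powr \<delta>)"
    unfolding vandermonde_powr[OF Wx] prod_pairs_diagonal by simp
  have B: "?B (i, j) * (y i - y j) powr \<delta> \<le> (x i - x (Suc j)) powr \<delta>" if "(i, j) \<in> pairs M" for i j
  proof -
    have ij: "1 \<le> i" "i < j" "j \<le> M" using that by (auto simp: pairs_def)
    have o: "y i \<le> x i" "y j \<le> y i" "x (Suc j) \<le> y j"
      using interlaces_between[OF il, of i] interlaces_between[OF il, of j] W_plus_antimono[OF Wy, of i j] ij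
      by auto
    have "\<bar>x i - y j\<bar> = x i - y j" "\<bar>x (Suc j) - y i\<bar> = y i - x (Suc j)"
      using o by auto
    then have "?B (i, j) \<le> 1" using crossing_ratio_le[OF o \<delta>] by simp
    moreover have "(y i - y j) powr \<delta> \<le> (x i - x (Suc j)) powr \<delta>"
      using o \<delta> by (intro powr_mono2) auto
    ultimately show ?thesis
      using mult_mono[of "?B (i, j)" 1 "(y i - y j) powr \<delta>" "(x i - x (Suc j)) powr \<delta>"] by simp
  qed
  have A: "?A i = (x i - x (Suc i)) powr \<delta> * beta_kernel \<delta> (x i) (x (Suc i)) (y i)" if "i \<in> {1..M}" for i
  proof -
    have o: "y i \<le> x i" "x (Suc i) \<le> y i"
      using interlaces_between[OF il, of i] that by auto
    have "(x i - x (Suc i)) powr (1 - \<delta>) = (x i - x (Suc i)) powr \<delta> * (x i - x (Suc i)) powr (1 - 2 * \<delta>)"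
      by (simp flip: powr_add)
    moreover have "\<bar>x i - y i\<bar> = x i - y i" "\<bar>x (Suc i) - y i\<bar> = y i - x (Suc i)"
      using o by auto
    ultimately show ?thesis by (simp add: beta_kernel_def)
  qed
  have "phi \<delta> M y x * vandermonde M y powr \<delta> =
    1 / Gamma \<delta> ^ M * (\<Prod>i=1..M. ?A i) * (\<Prod>(i, j)\<in>pairs M. ?B (i, j) * (y i - y j) powr \<delta>)"
    unfolding phi_adjacent yy by (simp add: prod.distrib case_prod_beta mult_ac)
  also have "\<dots> \<le> 1 / Gamma \<delta> ^ M * (\<Prod>i=1..M. ?A i) * (\<Prod>(i, j)\<in>pairs M. (x i - x (Suc j)) powr \<delta>)"
    using B \<delta> by (intro mult_left_mono prod_mono mult_nonneg_nonneg prod_nonneg)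
       (auto simp: Gamma_real_pos less_imp_le)
  also have "(\<Prod>i=1..M. ?A i) =
    (\<Prod>i=1..M. (x i - x (Suc i)) powr \<delta>) * (\<Prod>i=1..M. beta_kernel \<delta> (x i) (x (Suc i)) (y i))"
    unfolding prod.distrib[symmetric] using A by (intro prod.cong) auto
  finally show ?thesis unfolding xx by (simp add: mult_ac)
qed

section \<open>The weight of the tilded half\<close>

lemma prod_pairs_first_row:
  "(\<Prod>p\<in>pairs (Suc M). F p) =
     (\<Prod>j=1..M. F (1, Suc j)) * (\<Prod>(i, j)\<in>pairs M. F (Suc i, Suc j))"
proof -
  have "p \<in> (\<lambda>j. (1, Suc j)) ` {1..M} \<union> (\<lambda>(i, j). (Suc i, Suc j)) ` pairs M"
    if "p \<in> pairs (Suc M)" for p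
  proof -
    obtain i j where p: "p = (i, j)" "1 \<le> i" "i < j" "j \<le> Suc M"
      using \<open>p \<in> pairs (Suc M)\<close> by (auto simp: pairs_def)
    then obtain i' j' where ij': "j = Suc j'" "i = Suc i'" by (cases j; cases i) auto
    show ?thesis
    proof (cases "i = 1")
      case False
      then have "(i', j') \<in> pairs M" using p ij' by (auto simp: pairs_def)
      then show ?thesis using p ij' by (force simp: image_def)
    qed (use p ij' in auto)
  qed
  then have "pairs (Suc M) = (\<lambda>j. (1, Suc j)) ` {1..M} \<union> (\<lambda>(i, j). (Suc i, Suc j)) ` pairs M"
    by (auto simp: pairs_def)
  moreover have "(\<lambda>j. (1, Suc j)) ` {1..M} \<inter> (\<lambda>(i, j). (Suc i, Suc j)) ` pairs M = {}"
    by (auto simp: pairs_def)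
  moreover have "inj_on (\<lambda>(i, j). (Suc i, Suc j)) (pairs M)" by (auto simp: inj_on_def)
  ultimately show ?thesis
    by (simp add: prod.union_disjoint prod.reindex inj_on_def case_prod_beta)
qed

text \<open>The interaction of a row with the two endpoints \<open>0\<close> and \<open>1\<close>.\<close>

definition edge_weight :: "nat \<Rightarrow> real \<Rightarrow> (nat \<Rightarrow> real) \<Rightarrow> real" where
  "edge_weight M d x = (\<Prod>j=1..M. x j powr d * (1 - x j) powr d)"

lemma edge_weight_nonneg: "0 \<le> edge_weight M d x"
  by (auto simp: edge_weight_def intro!: prod_nonneg)

lemma ext_c_simps:
  "ext_c M z (Suc 0) = 1" "1 \<le> i \<Longrightarrow> i \<le> M \<Longrightarrow> ext_c M z (Suc i) = z i" "ext_c M z (Suc (Suc M)) = 0"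
  by (auto simp: ext_c_def)

lemma prod_first_last:
  fixes g :: "nat \<Rightarrow> 'a :: comm_monoid_mult"
  shows "(\<Prod>i=1..Suc (Suc M). g i) = g 1 * (\<Prod>i=1..M. g (Suc i)) * g (Suc (Suc M))"
proof -
  have "(\<Prod>i=1..Suc (Suc M). g i) = (\<Prod>i=1..Suc M. g i) * g (Suc (Suc M))" by simp
  also have "(\<Prod>i=1..Suc M. g i) = g 1 * (\<Prod>i=Suc 1..Suc M. g i)"
    by (subst prod.atLeast_Suc_atMost) auto
  also have "(\<Prod>i=Suc 1..Suc M. g i) = (\<Prod>i=1..M. g (Suc i))"
    by (rule prod.atLeast_Suc_atMost_Suc_shift[unfolded comp_def])
  finally show ?thesis .
qed

text \<open>The extended row adds the points \<open>1\<close> and \<open>0\<close>. Their distances to \<open>y\<close> and to the other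
  entries of the extended row are collected in two endpoint factors. What is left is the weight with the rows exchanged, because
  it treats the differences inside both of its rows alike.\<close>

lemma phi_ext_c:
  assumes y: "\<And>j. j \<in> {1..Suc M} \<Longrightarrow> 0 \<le> y j \<and> y j \<le> 1"
  shows "phi \<delta> (Suc M) y (ext_c M z) =
    1 / Gamma \<delta> * phi \<delta> M z y * edge_weight (Suc M) (\<delta> - 1) y * edge_weight M (1 - \<delta>) z"
proof -
  let ?e = "ext_c M z"
  have ph: "phi \<delta> (Suc M) y ?e = 1 / Gamma \<delta> ^ Suc M
     * (\<Prod>i=1..Suc (Suc M). \<Prod>j=1..Suc M. \<bar>?e i - y j\<bar> powr (\<delta> - 1))
     * (\<Prod>(i, j)\<in>pairs (Suc (Suc M)). (?e i - ?e j) powr (1 - \<delta>))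
     * (\<Prod>(i, j)\<in>pairs (Suc M). (y i - y j) powr (1 - \<delta>))"
    by (simp add: phi_def pairs_def)
  have pz: "phi \<delta> M z y = 1 / Gamma \<delta> ^ M
     * (\<Prod>i=1..Suc M. \<Prod>j=1..M. \<bar>y i - z j\<bar> powr (\<delta> - 1))
     * (\<Prod>(i, j)\<in>pairs (Suc M). (y i - y j) powr (1 - \<delta>))
     * (\<Prod>(i, j)\<in>pairs M. (z i - z j) powr (1 - \<delta>))"
    by (simp add: phi_def pairs_def)
  have "(\<Prod>i=1..Suc (Suc M). \<Prod>j=1..Suc M. \<bar>?e i - y j\<bar> powr (\<delta> - 1))
    = (\<Prod>j=1..Suc M. \<bar>1 - y j\<bar> powr (\<delta> - 1)) * (\<Prod>i=1..M. \<Prod>j=1..Suc M. \<bar>z i - y j\<bar> powr (\<delta> - 1))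
      * (\<Prod>j=1..Suc M. \<bar>y j\<bar> powr (\<delta> - 1))"
    unfolding prod_first_last by (simp add: ext_c_simps del: prod.cl_ivl_Suc)
  also have "(\<Prod>i=1..M. \<Prod>j=1..Suc M. \<bar>z i - y j\<bar> powr (\<delta> - 1)) =
      (\<Prod>i=1..Suc M. \<Prod>j=1..M. \<bar>y i - z j\<bar> powr (\<delta> - 1))"
    by (subst prod.swap) (simp add: abs_minus_commute del: prod.cl_ivl_Suc)
  also have "(\<Prod>j=1..Suc M. \<bar>1 - y j\<bar> powr (\<delta> - 1)) = (\<Prod>j=1..Suc M. (1 - y j) powr (\<delta> - 1))"
    using y by (intro prod.cong) auto
  also have "(\<Prod>j=1..Suc M. \<bar>y j\<bar> powr (\<delta> - 1)) = (\<Prod>j=1..Suc M. y j powr (\<delta> - 1))"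
    using y by (intro prod.cong) auto
  finally have 1: "(\<Prod>i=1..Suc (Suc M). \<Prod>j=1..Suc M. \<bar>?e i - y j\<bar> powr (\<delta> - 1)) =
      (\<Prod>i=1..Suc M. \<Prod>j=1..M. \<bar>y i - z j\<bar> powr (\<delta> - 1)) * edge_weight (Suc M) (\<delta> - 1) y"
    unfolding edge_weight_def prod.distrib by (simp only: mult_ac)
  have "(\<Prod>(i, j)\<in>pairs M. (?e (Suc i) - ?e (Suc j)) powr (1 - \<delta>)) =
        (\<Prod>(i, j)\<in>pairs M. (z i - z j) powr (1 - \<delta>))"
    by (rule prod.cong) (auto simp: ext_c_simps pairs_def)
  moreover have "(\<Prod>i=1..Suc M. (?e i - ?e (Suc (Suc M))) powr (1 - \<delta>)) = (\<Prod>i=1..M. z i powr (1 - \<delta>))"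
    by (subst prod.atLeast_Suc_atMost, simp, subst prod.atLeast_Suc_atMost_Suc_shift)
      (simp add: ext_c_simps)
  moreover have "(\<Prod>j=1..M. (?e 1 - ?e (Suc j)) powr (1 - \<delta>)) = (\<Prod>i=1..M. (1 - z i) powr (1 - \<delta>))"
    by (rule prod.cong) (auto simp: ext_c_simps)
  ultimately have 2: "(\<Prod>(i, j)\<in>pairs (Suc (Suc M)). (?e i - ?e j) powr (1 - \<delta>)) =
     (\<Prod>(i, j)\<in>pairs M. (z i - z j) powr (1 - \<delta>)) * edge_weight M (1 - \<delta>) z"
    unfolding prod_pairs_last_column[of _ "Suc M"] prod_pairs_first_row[of _ M] case_prod_conv
      edge_weight_def prod.distrib by (simp only: mult_ac)
  show ?thesis unfolding ph pz 1 2 by (simp add: mult_ac)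
qed

lemma phi_0 [simp]: "phi \<delta> 0 y x = 1"
proof -
  have "pairs (Suc 0) = {}" "pairs 0 = {}" by (auto simp: pairs_def)
  then show ?thesis by (simp add: phi_paired)
qed

text \<open>The endpoint factors of successive tilded rows cancel, so that both halves carry the same weight
  and only the middle row still sees the endpoints. The last product records the cancelled factors: it
  is \<open>1\<close> unless some entry of these rows is \<open>0\<close> or \<open>1\<close>, and then it is \<open>0\<close>, since \<open>0 powr a = 0\<close>.\<close>

lemma integrand_eq:
  assumes N: "k * q \<ge> 1"
    and t: "\<And>M j. 1 \<le> j \<Longrightarrow> j \<le> M \<Longrightarrow> M \<le> k * q \<Longrightarrow>
              0 \<le> txrow k q X M j \<and> txrow k q X M j \<le> 1"
  shows "integrand \<beta> k q X = (1 / Gamma (2 / \<beta>)) ^ (k * q)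
    * (\<Prod>M=1..<k * q. phi (2 / \<beta>) M (xrow X M) (xrow X (Suc M)))
    * (\<Prod>M=1..<k * q. phi (2 / \<beta>) M (txrow k q X M) (txrow k q X (Suc M)))
    * edge_weight (k * q) (2 / \<beta> - 1) (txrow k q X (k * q))
    * (\<Prod>M=1..<k * q. edge_weight M (2 / \<beta> - 1) (txrow k q X M) * edge_weight M (1 - 2 / \<beta>) (txrow k q X M))"
proof -
  define \<delta> where "\<delta> = 2 / \<beta>"
  define y where "y = txrow k q X"
  obtain n where n: "k * q = Suc n" using N by (cases "k * q") auto
  have set: "{1..k * q - 1} = {1..<k * q}" "{0..k * q - 1} = {..<k * q}" unfolding n by auto
  have split: "(\<Prod>M<Suc n. g M) = g 0 * (\<Prod>M=1..<Suc n. g M)" for g :: "nat \<Rightarrow> real"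
    by (simp add: prod.atLeast_Suc_lessThan lessThan_atLeast0)
  have shift: "(\<Prod>M<Suc n. g (Suc M)) = (\<Prod>M=1..<Suc n. g M) * g (Suc n)" for g :: "nat \<Rightarrow> real"
  proof -
    have "(\<Prod>M<Suc n. g (Suc M)) = (\<Prod>M=1..<Suc (Suc n). g M)"
      by (rule prod.reindex_bij_witness[of _ "\<lambda>i. i - 1" Suc]) auto
    then show ?thesis by (simp del: prod.op_ivl_Suc add: prod.atLeastLessThan_Suc)
  qed
  have "(\<Prod>M=0..k * q - 1. phi \<delta> (M + 1) (y (M + 1)) (ext_c M (y M))) =
    (\<Prod>M<Suc n. 1 / Gamma \<delta> * phi \<delta> M (y M) (y (Suc M)) * edge_weight (Suc M) (\<delta> - 1) (y (Suc M))
                  * edge_weight M (1 - \<delta>) (y M))"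
    unfolding set unfolding n
  proof (rule prod.cong, simp)
    fix M assume M: "M \<in> {..<Suc n}"
    show "phi \<delta> (M + 1) (y (M + 1)) (ext_c M (y M)) = 
      1 / Gamma \<delta> * phi \<delta> M (y M) (y (Suc M)) * edge_weight (Suc M) (\<delta> - 1) (y (Suc M)) * edge_weight M (1 - \<delta>) (y M)"
      using phi_ext_c[of M "y (Suc M)" \<delta> "y M"] t M n unfolding y_def by auto
  qed
  also have "\<dots> = (1 / Gamma \<delta>) ^ Suc n * (\<Prod>M=1..<Suc n. phi \<delta> M (y M) (y (Suc M)))
      * edge_weight (Suc n) (\<delta> - 1) (y (Suc n))
      * (\<Prod>M=1..<Suc n. edge_weight M (\<delta> - 1) (y M) * edge_weight M (1 - \<delta>) (y M))"
    unfolding prod.distrib shift[of "\<lambda>M. edge_weight M (\<delta> - 1) (y M)"]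
      split[of "\<lambda>M. edge_weight M (1 - \<delta>) (y M)"] split[of "\<lambda>M. phi \<delta> M (y M) (y (Suc M))"]
    by (simp add: edge_weight_def[of 0] del: prod.op_ivl_Suc)
  finally show ?thesis
    unfolding integrand_def \<delta>_def[symmetric] y_def[symmetric] n[symmetric] unfolding set
    by (simp add: mult_ac)
qed

lemma edge_weight_mult_inverse: "edge_weight M d x * edge_weight M (- d) x \<in> {0, 1}"
proof (cases "\<exists>j\<in>{1..M}. x j = 0 \<or> x j = 1")
  case True
  then have "edge_weight M d x = 0" unfolding edge_weight_def by auto
  then show ?thesis by simp
next
  case False
  then show ?thesis
    unfolding edge_weight_def prod.distrib[symmetric] by (simp add: powr_minus field_simps)
qed

section \<open>A lower bound for clustered rows\<close>

lemma prod_ge_power_subset: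
  fixes f :: "'a \<Rightarrow> real"
  assumes "finite S" "T \<subseteq> S" "\<And>s. s \<in> S \<Longrightarrow> 1 \<le> f s" "\<And>s. s \<in> T \<Longrightarrow> c \<le> f s" "0 \<le> c"
  shows "c ^ card T \<le> (\<Prod>s\<in>S. f s)"
proof -
  have "c ^ card T * 1 \<le> (\<Prod>s\<in>T. f s) * (\<Prod>s\<in>S - T. f s)"
    using assms prod_mono[of T "\<lambda>_. c" f]
    by (intro mult_mono prod_ge_1) (auto intro!: prod_nonneg intro: order_trans[OF zero_le_one])
  also have "\<dots> = (\<Prod>s\<in>S. f s)"
    using prod.subset_diff[OF assms(2,1), of f] by (simp add: mult.commute)
  finally show ?thesis by simp
qed

lemma le_mult_of_ge_1:
  fixes c :: real
  shows "0 \<le> c \<Longrightarrow> c \<le> u \<Longrightarrow> 1 \<le> v \<Longrightarrow> c \<le> u * v"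
  using mult_mono[of c u 1 v] by simp

lemma powr_ratio_ge:
  fixes p :: real
  assumes "0 < p" "p \<le> e" "1 / 16 \<le> r" "\<delta> \<le> 1"
  shows "(16 * e) powr (\<delta> - 1) \<le> p powr (\<delta> - 1) * r powr (1 - \<delta>)"
proof -
  have "(16 * e) powr (\<delta> - 1) = e powr (\<delta> - 1) * (1 / 16) powr (1 - \<delta>)"
    using assms by (simp add: powr_mult powr_divide powr_diff field_simps)
  also have "\<dots> \<le> p powr (\<delta> - 1) * r powr (1 - \<delta>)"
    using assms by (intro mult_mono powr_mono2 powr_mono2') auto
  finally show ?thesis .
qed

text \<open>If \<open>a\<close> entries of \<open>y\<close> are within \<open>e\<close> of \<open>1\<close> and \<open>b\<close> within \<open>e\<close> of \<open>0\<close>, the weight gains one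
  factor \<open>(16 * e) powr (\<delta> - 1)\<close> from each of them. In the paired form all factors are at least \<open>1\<close>. The
  \<open>b\<close> entries make the single differences \<open>y i - x (M + 1)\<close> small. The \<open>a\<close> entries make small
  numerators over denominators of order \<open>1\<close>, namely for the pairs \<open>(i, a + 1)\<close> that bridge the
  gap after the upper cluster; which of the two triangles holds them depends on whether the next entry of
  \<open>x\<close> still belongs to the cluster.\<close>

lemma phi_ge:
  assumes \<delta>: "0 < \<delta>" "\<delta> \<le> 1" and e: "0 < e" "e \<le> 1 / 16"
    and il: "interlaces M y x"
    and strict: "\<And>i. i \<in> {1..M} \<Longrightarrow> y i < x i \<and> x (Suc i) < y i"
    and le1: "x 1 \<le> 1"
    and ab: "a + b \<le> M" "a < M \<or> a = 0"
    and zeros: "\<And>j. M - b < j \<Longrightarrow> j \<le> M \<Longrightarrow> y j \<le> e"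
    and ones: "\<And>j. 1 \<le> j \<Longrightarrow> j \<le> a \<Longrightarrow> 1 - e \<le> y j"
    and gap: "x (Suc a) \<le> 7 / 8 \<or> 1 - e \<le> x (Suc a) \<and> y (Suc a) \<le> 7 / 8"
  shows "1 / Gamma \<delta> ^ M * ((16 * e) powr (\<delta> - 1)) ^ (a + b) \<le> phi \<delta> M y x"
proof -
  let ?f1 = "\<lambda>(i, j). \<bar>x i - y (j - 1)\<bar> powr (\<delta> - 1) * (x i - x j) powr (1 - \<delta>)"
  let ?f2 = "\<lambda>(i, j). \<bar>x j - y i\<bar> powr (\<delta> - 1) * (y i - y j) powr (1 - \<delta>)"
  let ?f3 = "\<lambda>i. \<bar>x (Suc M) - y i\<bar> powr (\<delta> - 1)"
  let ?c = "(16 * e) powr (\<delta> - 1)"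
  \<comment> \<open>The pairs that bridge the gap after the upper cluster.\<close>
  let ?T = "(\<lambda>i. (i, Suc a)) ` {1..a}"
  have Wx: "W_plus (Suc M) x" and Wy: "W_plus M y" using il by (auto simp: interlaces_def)
  have x0: "0 \<le> x (Suc M)" using Wx by (auto simp: W_plus_def)
  have xle1: "x i \<le> 1" if "1 \<le> i" "i \<le> Suc M" for i
    using W_plus_antimono[OF Wx, of 1 i] that le1 by auto
  have c1: "1 \<le> ?c" using e \<delta> powr_mono2'[of "\<delta> - 1" "16 * e" 1] by simp
  have o1: "y (j - 1) < x i \<and> x j < y (j - 1)" if "(i, j) \<in> pairs (Suc M)" for i j
  proof -
    have ij: "1 \<le> i" "i \<le> j - 1" "j - 1 \<in> {1..M}" "Suc (j - 1) = j" using that by (auto simp: pairs_def)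
    then show ?thesis using strict[of "j - 1"] W_plus_antimono[OF Wx, of i "j - 1"] by auto
  qed
  have o2: "x j < y i \<and> y j < x j" if "(i, j) \<in> pairs M" for i j
  proof -
    have ij: "Suc i \<le> j" "i \<in> {1..M}" "j \<in> {1..M}" using that by (auto simp: pairs_def)
    then show ?thesis using strict[of i] strict[of j] W_plus_antimono[OF Wx, of "Suc i" j] by auto
  qed
  have o3: "x (Suc M) < y i" if "i \<in> {1..M}" for i
    using that strict[of i] W_plus_antimono[OF Wx, of "Suc i" "Suc M"] by auto
  have f1: "1 \<le> ?f1 p" if "p \<in> pairs (Suc M)" for p
    using that o1 \<delta> by (cases p) (auto intro!: powr_ratio_ge_1 simp: less_imp_le)
  have f2: "1 \<le> ?f2 p" if "p \<in> pairs M" for p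
    using that o2 \<delta> by (cases p) (force intro!: powr_ratio_ge_1)
  have f3: "1 \<le> ?f3 i" if "i \<in> {1..M}" for i
  proof -
    have "y i \<le> 1" using strict[of i] xle1[of i] that by fastforce
    then have "\<bar>x (Suc M) - y i\<bar> \<le> 1" "0 < \<bar>x (Suc M) - y i\<bar>" using o3[OF that] x0 by auto
    then show ?thesis using \<delta> powr_mono2'[of "\<delta> - 1" "\<bar>x (Suc M) - y i\<bar>" 1] by simp
  qed
  have p3: "?c ^ card {M - b<..M} \<le> (\<Prod>i=1..M. ?f3 i)"
  proof (rule prod_ge_power_subset)
    fix i assume i: "i \<in> {M - b<..M}"
    then have "\<bar>x (Suc M) - y i\<bar> \<le> e" "0 < \<bar>x (Suc M) - y i\<bar>" using zeros[of i] o3[of i] x0 by auto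
    then show "?c \<le> ?f3 i" using e \<delta> by (intro powr_mono2') auto
  qed (use f3 in auto)
  have p12: "?c ^ a \<le> (\<Prod>p\<in>pairs (Suc M). ?f1 p) * (\<Prod>p\<in>pairs M. ?f2 p)"
  proof (cases "x (Suc a) \<le> 7 / 8")
    case True
    have sub: "?T \<subseteq> pairs (Suc M)" using ab by (auto simp: pairs_def)
    have "?c ^ card ?T \<le> (\<Prod>p\<in>pairs (Suc M). ?f1 p)"
    proof (rule prod_ge_power_subset)
      fix p assume "p \<in> ?T"
      then obtain i where i: "p = (i, Suc a)" "1 \<le> i" "i \<le> a" by auto
      have "(i, Suc a) \<in> pairs (Suc M)" using i ab by (auto simp: pairs_def)
      from o1[OF this] have o: "y a < x i" by simp
      have "1 - e \<le> y a" "1 - e \<le> y i" "y i < x i" "x i \<le> 1"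
        using ones[of a] ones[of i] i ab strict[of i] xle1[of i] by auto
      then show "?c \<le> ?f1 p"
        using True o e \<delta> i by (auto intro!: powr_ratio_ge)
    qed (use f1 sub in auto)
    moreover have "1 \<le> (\<Prod>p\<in>pairs M. ?f2 p)" using f2 by (intro prod_ge_1) auto
    moreover have "card ?T = a" by (simp add: card_image inj_on_def)
    ultimately show ?thesis by (intro le_mult_of_ge_1) auto
  next
    case False
    then have g: "1 - e \<le> x (Suc a)" "y (Suc a) \<le> 7 / 8" using gap by auto
    have sub: "?T \<subseteq> pairs M" using ab by (auto simp: pairs_def)
    have "?c ^ card ?T \<le> (\<Prod>p\<in>pairs M. ?f2 p)"
    proof (rule prod_ge_power_subset)
      fix p assume "p \<in> ?T"
      then obtain i where i: "p = (i, Suc a)" "1 \<le> i" "i \<le> a" by auto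
      have "(i, Suc a) \<in> pairs M" using i ab by (auto simp: pairs_def)
      from o2[OF this] have o: "x (Suc a) < y i" by simp
      have "1 - e \<le> y i" "y i < x i" "x i \<le> 1"
        using ones[of i] i ab strict[of i] xle1[of i] by auto
      then show "?c \<le> ?f2 p"
        using g o e \<delta> i by (auto intro!: powr_ratio_ge)
    qed (use f2 sub in auto)
    moreover have "1 \<le> (\<Prod>p\<in>pairs (Suc M). ?f1 p)" using f1 by (intro prod_ge_1) auto
    moreover have "card ?T = a" by (simp add: card_image inj_on_def)
    ultimately show ?thesis by (subst mult.commute, intro le_mult_of_ge_1) auto
  qed
  have "?c ^ a * ?c ^ b \<le> ((\<Prod>p\<in>pairs (Suc M). ?f1 p) * (\<Prod>p\<in>pairs M. ?f2 p)) * (\<Prod>i=1..M. ?f3 i)"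
    using p3 ab by (intro mult_mono order_trans[OF _ p12]) auto
  then have "1 / Gamma \<delta> ^ M * (?c ^ a * ?c ^ b) \<le> 1 / Gamma \<delta> ^ M * 
     (((\<Prod>p\<in>pairs (Suc M). ?f1 p) * (\<Prod>p\<in>pairs M. ?f2 p)) * (\<Prod>i=1..M. ?f3 i))"
    using \<delta> by (intro mult_left_mono) (auto simp: Gamma_real_pos less_imp_le)
  then show ?thesis unfolding phi_paired power_add by (simp only: mult.assoc)
qed

section \<open>Integrating one coordinate at a time\<close>

text \<open>Removing the coordinates one after the other, lowest rank first: the factor \<open>G p\<close> is integrated over
  coordinate \<open>p\<close> when the only other factors that involve this coordinate are already gone.\<close>

lemma nn_integral_prod_le:
  fixes G :: "'i \<Rightarrow> ('i \<Rightarrow> real) \<Rightarrow> ennreal" and rank :: "'i \<Rightarrow> nat"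
  assumes "finite S"
    and "\<And>p. p \<in> S \<Longrightarrow> G p \<in> borel_measurable (\<Pi>\<^sub>M i\<in>S. lborel)"
    and "\<And>p p' w t. p \<in> S \<Longrightarrow> p' \<in> S \<Longrightarrow> p' \<noteq> p \<Longrightarrow> rank p' \<le> rank p \<Longrightarrow>
           G p (w(p' := t)) = G p w"
    and "\<And>p w. p \<in> S \<Longrightarrow> (\<integral>\<^sup>+ t. G p (w(p := t)) \<partial>lborel) \<le> B p"
  shows "(\<integral>\<^sup>+ w. (\<Prod>p\<in>S. G p w) \<partial>(\<Pi>\<^sub>M i\<in>S. lborel)) \<le> (\<Prod>p\<in>S. B p)"
  using assms
proof (induction "card S" arbitrary: S)
  case 0
  then have [simp]: "S = {}" by simp
  show ?case by (simp add: PiM_empty nn_integral_count_space_finite)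
next
  case (Suc n)
  interpret product_sigma_finite "\<lambda>_::'i. lborel :: real measure" ..
  have "S \<noteq> {}" using Suc.hyps(2) by auto
  \<comment> \<open>A coordinate of least rank enters no factor other than its own.\<close>
  define i where "i = arg_min_on rank S"
  have i: "i \<in> S" "\<And>p. p \<in> S \<Longrightarrow> rank i \<le> rank p"
    using \<open>S \<noteq> {}\<close> Suc.prems(1) arg_min_if_finite[of S rank] arg_min_least[of S _ rank]
    by (auto simp: i_def)
  define T where "T = S - {i}"
  have S: "S = insert i T" "i \<notin> T" "finite T" using i(1) Suc.prems(1) by (auto simp: T_def)
  have G: "G p (w(i := t)) = G p w" if "p \<in> T" for p w t
    using Suc.prems(3)[of p i] that i S by auto
  have measS: "G p \<in> borel_measurable (\<Pi>\<^sub>M i\<in>insert i T. lborel)" if "p \<in> S" for p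
    using Suc.prems(2)[OF that] S by simp
  have measT: "G p \<in> borel_measurable (\<Pi>\<^sub>M i\<in>T. lborel)" if "p \<in> T" for p
  proof -
    have upd: "(\<lambda>w. w(i := 0)) \<in> (\<Pi>\<^sub>M i\<in>T. lborel) \<rightarrow>\<^sub>M (\<Pi>\<^sub>M i\<in>insert i T. (lborel :: real measure))"
      by (rule measurable_fun_upd[where J = T]) auto
    have "(\<lambda>w. G p (w(i := 0))) \<in> borel_measurable (\<Pi>\<^sub>M i\<in>T. lborel)"
      using measurable_compose[OF upd measS[of p]] that S by simp
    then show ?thesis using G[OF that] by simp
  qed
  have "(\<integral>\<^sup>+ w. (\<Prod>p\<in>S. G p w) \<partial>(\<Pi>\<^sub>M i\<in>S. lborel)) =
    (\<integral>\<^sup>+ w. (\<integral>\<^sup>+ t. (\<Prod>p\<in>S. G p (w(i := t))) \<partial>lborel) \<partial>(\<Pi>\<^sub>M i\<in>T. lborel))"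
    unfolding S(1) using measS S
    by (intro product_nn_integral_insert borel_measurable_prod_ennreal) auto
  also have "\<dots> \<le> (\<integral>\<^sup>+ w. B i * (\<Prod>p\<in>T. G p w) \<partial>(\<Pi>\<^sub>M i\<in>T. lborel))"
  proof (rule nn_integral_mono)
    fix w :: "'i \<Rightarrow> real" assume w: "w \<in> space (\<Pi>\<^sub>M i\<in>T. lborel)"
    have "(\<integral>\<^sup>+ t. (\<Prod>p\<in>S. G p (w(i := t))) \<partial>lborel) =
      (\<integral>\<^sup>+ t. G i (w(i := t)) * (\<Prod>p\<in>T. G p w) \<partial>lborel)"
      unfolding S(1) using S G by simp
    also have "\<dots> = (\<integral>\<^sup>+ t. G i (w(i := t)) \<partial>lborel) * (\<Prod>p\<in>T. G p w)"
      by (intro nn_integral_multc measurable_compose[OF measurable_component_update measS] w S i)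
    also have "\<dots> \<le> B i * (\<Prod>p\<in>T. G p w)"
      using Suc.prems(4)[OF i(1)] by (intro mult_right_mono) auto
    finally show "(\<integral>\<^sup>+ t. (\<Prod>p\<in>S. G p (w(i := t))) \<partial>lborel) \<le> B i * (\<Prod>p\<in>T. G p w)" .
  qed
  also have "\<dots> = B i * (\<integral>\<^sup>+ w. (\<Prod>p\<in>T. G p w) \<partial>(\<Pi>\<^sub>M i\<in>T. lborel))"
    using measT by (intro nn_integral_cmult borel_measurable_prod_ennreal) auto
  also have "\<dots> \<le> B i * (\<Prod>p\<in>T. B p)"
    using Suc.prems S measT Suc.hyps by (intro mult_left_mono Suc.hyps(1)) auto
  also have "\<dots> = (\<Prod>p\<in>S. B p)" using S by simp
  finally show ?case .
qed

lemma nn_integral_powr_from_0: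
  assumes "0 < a" "0 \<le> b"
  shows "(\<integral>\<^sup>+ t. ennreal (t powr (a - 1) * indicator {0..b} t) \<partial>lborel) = ennreal (b powr a / a)"
proof -
  have "((\<lambda>t. t powr (a - 1)) has_integral (b powr a / a)) {0..b}"
    using has_integral_powr_from_0[of "a - 1" b] assms by simp
  from nn_integral_has_integral_lebesgue[OF _ this]
  show ?thesis by (simp add: nn_integral_completion mult.commute)
qed

lemma nn_integral_reflect:
  assumes "f \<in> borel_measurable borel"
  shows "(\<integral>\<^sup>+ t. f (c - t) \<partial>lborel) = (\<integral>\<^sup>+ t. f t \<partial>(lborel :: real measure))"
  using nn_integral_real_affine[OF assms, of "-1" c] by simp

lemma nn_integral_scaled_powr_le:
  assumes "0 < a" "0 \<le> c"
  shows "(\<integral>\<^sup>+ t. ennreal (t powr (a - 1) * U powr (- a) * indicator {0..c * U} t) \<partial>lborel)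
    \<le> ennreal (c powr a / a)"
proof (cases "U > 0")
  case True
  have "(\<integral>\<^sup>+ t. ennreal (t powr (a - 1) * U powr (- a) * indicator {0..c * U} t) \<partial>lborel) =
    (\<integral>\<^sup>+ t. ennreal (U powr (- a)) * ennreal (t powr (a - 1) * indicator {0..c * U} t) \<partial>lborel)"
    by (intro nn_integral_cong) (simp add: mult_ac flip: ennreal_mult)
  also have "\<dots> = ennreal (U powr (- a)) * ennreal ((c * U) powr a / a)"
    using assms True by (subst nn_integral_cmult) (simp_all add: nn_integral_powr_from_0)
  also have "\<dots> = ennreal (c powr a / a)"
    using assms True by (simp add: powr_mult powr_minus field_simps flip: ennreal_mult)
  finally show ?thesis by simp
next
  case False
  have "(\<integral>\<^sup>+ t. ennreal (t powr (a - 1) * U powr (- a) * indicator {0..c * U} t) \<partial>lborel) =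
    (\<integral>\<^sup>+ t. 0 \<partial>(lborel :: real measure))"
  proof (rule nn_integral_cong)
    fix t :: real
    show "ennreal (t powr (a - 1) * U powr (- a) * indicator {0..c * U} t) = 0"
      using False assms mult_nonneg_nonpos[of c U] by (auto simp: indicator_def)
  qed
  then show ?thesis by simp
qed

text \<open>At each point of the interval the distance to one of the ends is at least half the length, so one of the two
  singular powers is bounded by a power of the length.\<close>

lemma beta_kernel_integral_le:
  assumes \<delta>: "0 < \<delta>" "\<delta> \<le> 1"
  shows "(\<integral>\<^sup>+ y. ennreal (beta_kernel \<delta> p s y * indicator {s..p} y) \<partial>lborel)
    \<le> ennreal (2 * 2 powr (1 - \<delta>) / \<delta>)"
proof (cases "s < p")
  case True
  define K where "K = (p - s) powr (1 - 2 * \<delta>) * ((p - s) / 2) powr (\<delta> - 1)"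
  let ?g = "\<lambda>t. t powr (\<delta> - 1) * indicator {0..p - s} t"
  have "(\<integral>\<^sup>+ y. ennreal (beta_kernel \<delta> p s y * indicator {s..p} y) \<partial>lborel) \<le>
    (\<integral>\<^sup>+ y. ennreal K * (ennreal (?g (p - y)) + ennreal (?g (y - s))) \<partial>lborel)"
  proof (rule nn_integral_mono)
    fix y :: real
    have "beta_kernel \<delta> p s y * indicator {s..p} y \<le> K * (?g (p - y) + ?g (y - s))"
    proof (cases "s < y \<and> y < p")
      case y: True
      have "(p - y) powr (\<delta> - 1) * (y - s) powr (\<delta> - 1) \<le>
        ((p - s) / 2) powr (\<delta> - 1) * ((p - y) powr (\<delta> - 1) + (y - s) powr (\<delta> - 1))"
      proof (cases "(p - s) / 2 \<le> p - y")
        case c: True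
        then have "(p - y) powr (\<delta> - 1) \<le> ((p - s) / 2) powr (\<delta> - 1)"
          using \<delta> True by (intro powr_mono2') auto
        then show ?thesis by (intro mult_mono) auto
      next
        case c: False
        then have "(p - s) / 2 \<le> y - s" by (simp add: field_simps)
        then have "(y - s) powr (\<delta> - 1) \<le> ((p - s) / 2) powr (\<delta> - 1)"
          using \<delta> True by (intro powr_mono2') auto
        then show ?thesis by (subst mult.commute, intro mult_mono) auto
      qed
      from mult_left_mono[OF this, of "(p - s) powr (1 - 2 * \<delta>)"] show ?thesis
        using y by (simp add: beta_kernel_def K_def indicator_def mult.assoc)
    next
      case False
      then have "beta_kernel \<delta> p s y * indicator {s..p} y = 0"
        by (auto simp: beta_kernel_def indicator_def)
      moreover have "0 \<le> K * (?g (p - y) + ?g (y - s))" by (simp add: K_def indicator_def)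
      ultimately show ?thesis by linarith
    qed
    then show "ennreal (beta_kernel \<delta> p s y * indicator {s..p} y) \<le>
        ennreal K * (ennreal (?g (p - y)) + ennreal (?g (y - s)))"
      by (simp add: K_def flip: ennreal_mult ennreal_plus)
  qed
  also have "\<dots> = ennreal K * ((\<integral>\<^sup>+ y. ennreal (?g (p - y)) \<partial>lborel) + (\<integral>\<^sup>+ y. ennreal (?g (y - s)) \<partial>lborel))"
    by (simp add: nn_integral_cmult nn_integral_add)
  also have "(\<integral>\<^sup>+ y. ennreal (?g (p - y)) \<partial>lborel) = ennreal ((p - s) powr \<delta> / \<delta>)"
    using nn_integral_reflect[of "\<lambda>t. ennreal (?g t)" p] nn_integral_powr_from_0[of \<delta> "p - s"] \<delta> True
    by simp
  also have "(\<integral>\<^sup>+ y. ennreal (?g (y - s)) \<partial>lborel) = ennreal ((p - s) powr \<delta> / \<delta>)"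
    using nn_integral_real_affine[of "\<lambda>t. ennreal (?g t)" 1 "- s"] nn_integral_powr_from_0[of \<delta> "p - s"] \<delta> True
    by simp
  also have "ennreal K * (ennreal ((p - s) powr \<delta> / \<delta>) + ennreal ((p - s) powr \<delta> / \<delta>)) =
    ennreal (K * (2 * (p - s) powr \<delta> / \<delta>))"
    using \<delta> by (simp add: K_def flip: ennreal_mult ennreal_plus)
  also have "K * (2 * (p - s) powr \<delta> / \<delta>) = 2 * 2 powr (1 - \<delta>) / \<delta>"
  proof -
    have "K = (p - s) powr (1 - 2 * \<delta> + (\<delta> - 1)) * 2 powr (1 - \<delta>)"
    proof -
      have "((p - s) / 2) powr (\<delta> - 1) = (p - s) powr (\<delta> - 1) * 2 powr (- (\<delta> - 1))"
        by (simp only: powr_divide powr_minus divide_inverse[symmetric])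
      then show ?thesis by (simp only: K_def powr_add) simp
    qed
    moreover have "(p - s) powr (1 - 2 * \<delta> + (\<delta> - 1)) * (p - s) powr \<delta> = 1"
      using True by (simp flip: powr_add)
    ultimately show ?thesis by (simp add: mult_ac)
  qed
  finally show ?thesis .
next
  case False
  have "(\<integral>\<^sup>+ y. ennreal (beta_kernel \<delta> p s y * indicator {s..p} y) \<partial>lborel) =
    (\<integral>\<^sup>+ y. 0 \<partial>(lborel :: real measure))"
  proof (rule nn_integral_cong)
    fix y :: real
    show "ennreal (beta_kernel \<delta> p s y * indicator {s..p} y) = 0"
      using False by (cases "s = p") (auto simp: indicator_def beta_kernel_def)
  qed
  then show ?thesis by simp
qed

section \<open>The domain of integration\<close>

lemma row_len_simps:
  "M \<le> k * q \<Longrightarrow> row_len k q M = M"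
  "M \<le> k * q \<Longrightarrow> row_len k q (2 * k * q - M) = M"
  unfolding row_len_def by auto

lemma coords_left: "1 \<le> j \<Longrightarrow> j \<le> M \<Longrightarrow> M \<le> k * q \<Longrightarrow> (M, j) \<in> coords k q"
  by (auto simp: coords_def row_len_simps)

lemma coords_right: "1 \<le> j \<Longrightarrow> j \<le> M \<Longrightarrow> M \<le> k * q \<Longrightarrow> (2 * k * q - M, j) \<in> coords k q"
  by (auto simp: coords_def row_len_simps)

lemma finite_coords [simp]: "finite (coords k q)" "finite (free_coords k q)"
  by (auto simp: coords_def free_coords_def)

lemma free_coords_subset: "free_coords k q \<subseteq> coords k q"
  by (auto simp: free_coords_def)

lemma fill_in_free: "p \<in> free_coords k q \<Longrightarrow> fill_in k q w p = w p"
  by (cases p) (auto simp: fill_in_def free_coords_def)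

lemma fill_in_eliminated:
  "(r, l) \<in> coords k q \<Longrightarrow> (r, l) \<in> eliminated k q \<Longrightarrow>
   fill_in k q w (r, l) = real (row_len k q r) / 2 - (\<Sum>m=1..<row_len k q r. w (r, m))"
  by (auto simp: fill_in_def)

lemma before_last_free:
  "(r, l) \<in> coords k q \<Longrightarrow> 1 \<le> m \<Longrightarrow> m < row_len k q r \<Longrightarrow> (r, m) \<in> free_coords k q"
  by (auto simp: free_coords_def coords_def eliminated_def)

lemma measurable_fill_in:
  assumes "p \<in> coords k q"
  shows "(\<lambda>w. fill_in k q w p) \<in> borel_measurable (\<Pi>\<^sub>M i\<in>free_coords k q. lborel)"
proof (cases "p \<in> eliminated k q")
  case True
  obtain r l where p: "p = (r, l)" by (cases p)
  have m: "(\<lambda>w. w (r, m)) \<in> borel_measurable (\<Pi>\<^sub>M i\<in>free_coords k q. (lborel :: real measure))"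
    if "m \<in> {1..<row_len k q r}" for m
  proof -
    have "(r, m) \<in> free_coords k q" using before_last_free[of r l k q m] that assms p by auto
    from measurable_component_singleton[OF this, of "\<lambda>_. lborel"] show ?thesis by simp
  qed
  show ?thesis using True assms m unfolding p
    by (simp add: fill_in_eliminated)
next
  case False
  then have f: "p \<in> free_coords k q" using assms by (simp add: free_coords_def)
  from measurable_component_singleton[OF f, of "\<lambda>_. lborel"] show ?thesis
    using fill_in_free[OF f] by simp
qed

lemma fill_in_upd_other_row:
  "r \<noteq> r' \<Longrightarrow> fill_in k q (w((r', m) := t)) (r, l) = fill_in k q w (r, l)"
  by (auto simp: fill_in_def restrict_def)

lemma I_c_coord:
  assumes "X \<in> I_c k q" "p \<in> coords k q"
  shows "0 \<le> X p \<and> X p \<le> 1"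
proof -
  have "X \<in> coords k q \<rightarrow>\<^sub>E {0..1}" using assms(1) by (simp add: I_c_def)
  from PiE_mem[OF this assms(2)] show ?thesis by simp
qed

lemma I_c_bounds:
  assumes "X \<in> I_c k q" "1 \<le> j" "j \<le> M" "M \<le> k * q"
  shows "0 \<le> xrow X M j \<and> xrow X M j \<le> 1" "0 \<le> txrow k q X M j \<and> txrow k q X M j \<le> 1"
  using I_c_coord[OF assms(1) coords_left[OF assms(2-4)]] I_c_coord[OF assms(1) coords_right[OF assms(2-4)]]
  by (simp_all add: xrow_def txrow_def)

lemma I_c_interlaces:
  assumes "X \<in> I_c k q" "1 \<le> M" "M < k * q"
  shows "interlaces M (xrow X M) (xrow X (Suc M))"
    "interlaces M (txrow k q X M) (txrow k q X (Suc M))"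
  using assms by (auto simp: I_c_def)

lemma txrow_middle: "txrow k q X (k * q) = xrow X (k * q)"
  by (simp add: txrow_def xrow_def)

section \<open>The bounded case\<close>

lemma edge_weight_le_1:
  assumes "0 \<le> d" "\<And>j. 1 \<le> j \<Longrightarrow> j \<le> M \<Longrightarrow> 0 \<le> x j \<and> x j \<le> 1"
  shows "edge_weight M d x \<le> 1"
  unfolding edge_weight_def
proof (intro prod_le_1 conjI)
  fix j assume "j \<in> {1..M}"
  then show "x j powr d * (1 - x j) powr d \<le> 1"
    using assms powr_mono2[of d "x j" 1] powr_mono2[of d "1 - x j" 1] by (intro mult_le_one) auto
qed simp

text \<open>The cancelled endpoint factors of \<open>integrand_eq\<close> are at most \<open>1\<close>.\<close>

lemma integrand_le:
  assumes X: "X \<in> I_c k q" and N: "k * q \<ge> 1" and \<beta>: "0 < \<beta>"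
  shows "integrand \<beta> k q X \<le> (1 / Gamma (2 / \<beta>)) ^ (k * q)
    * (\<Prod>M=1..<k * q. phi (2 / \<beta>) M (xrow X M) (xrow X (Suc M)))
    * (\<Prod>M=1..<k * q. phi (2 / \<beta>) M (txrow k q X M) (txrow k q X (Suc M)))
    * edge_weight (k * q) (2 / \<beta> - 1) (xrow X (k * q))"
    (is "_ \<le> ?R")
proof -
  let ?E = "\<Prod>M=1..<k * q. edge_weight M (2 / \<beta> - 1) (txrow k q X M) * edge_weight M (1 - 2 / \<beta>) (txrow k q X M)"
  have "integrand \<beta> k q X = ?R * ?E"
    using integrand_eq[OF N, of X \<beta>] I_c_bounds(2)[OF X] by (simp add: txrow_middle)
  also have "?E \<le> 1"
  proof (intro prod_le_1)
    fix M
    show "0 \<le> edge_weight M (2 / \<beta> - 1) (txrow k q X M) * edge_weight M (1 - 2 / \<beta>) (txrow k q X M) \<and>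
      edge_weight M (2 / \<beta> - 1) (txrow k q X M) * edge_weight M (1 - 2 / \<beta>) (txrow k q X M) \<le> 1"
      using edge_weight_mult_inverse[of M "2 / \<beta> - 1" "txrow k q X M"] by auto
  qed
  then have "?R * ?E \<le> ?R * 1"
    using \<beta> by (intro mult_left_mono mult_nonneg_nonneg prod_nonneg)
      (auto intro!: phi_nonneg edge_weight_nonneg simp: Gamma_real_pos less_imp_le)
  finally show ?thesis by simp
qed

lemma measurable_indicator_coord:
  "p \<in> S \<Longrightarrow> (\<lambda>w. indicator {0..1::real} (w p) :: ennreal) \<in> borel_measurable (\<Pi>\<^sub>M i\<in>S. lborel)"
  by (rule measurable_compose[OF measurable_component_singleton]) auto

lemma c_coeff_finite_of_le_2:
  assumes N: "k * q \<ge> 1" and \<beta>: "0 < \<beta>" "\<beta> \<le> 2"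
  shows "c_coeff \<beta> k q < \<infinity>"
proof -
  define \<delta> where "\<delta> = 2 / \<beta>"
  have \<delta>: "1 \<le> \<delta>" using \<beta> by (simp add: \<delta>_def)
  define C where "C = (1 / Gamma \<delta>) ^ (k * q) * (\<Prod>M=1..<k * q. 1 / Gamma \<delta> ^ M) * (\<Prod>M=1..<k * q. 1 / Gamma \<delta> ^ M)"
  have G: "0 \<le> 1 / Gamma \<delta> ^ M" for M using \<delta> by (simp add: Gamma_real_pos less_imp_le)
  have le: "integrand \<beta> k q X \<le> C" if X: "X \<in> I_c k q" for X
  proof -
    have "integrand \<beta> k q X \<le> (1 / Gamma \<delta>) ^ (k * q)
      * (\<Prod>M=1..<k * q. phi \<delta> M (xrow X M) (xrow X (Suc M)))
      * (\<Prod>M=1..<k * q. phi \<delta> M (txrow k q X M) (txrow k q X (Suc M)))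
      * edge_weight (k * q) (\<delta> - 1) (xrow X (k * q))"
      unfolding \<delta>_def by (rule integrand_le[OF X N \<beta>(1)])
    also have "\<dots> \<le> C * 1"
      unfolding C_def
    proof (intro mult_mono prod_mono conjI order_refl)
      fix M assume M: "M \<in> {1..<k * q}"
      show "phi \<delta> M (xrow X M) (xrow X (Suc M)) \<le> 1 / Gamma \<delta> ^ M"
        using I_c_bounds(1)[OF X] M by (intro phi_le_of_one_le \<delta> I_c_interlaces[OF X]) auto
      show "phi \<delta> M (txrow k q X M) (txrow k q X (Suc M)) \<le> 1 / Gamma \<delta> ^ M"
        using I_c_bounds(2)[OF X] M by (intro phi_le_of_one_le \<delta> I_c_interlaces[OF X]) auto
    next
      show "edge_weight (k * q) (\<delta> - 1) (xrow X (k * q)) \<le> 1"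
        using I_c_bounds(1)[OF X] \<delta> by (intro edge_weight_le_1) auto
    qed (use \<delta> G in \<open>auto intro!: mult_nonneg_nonneg prod_nonneg phi_nonneg edge_weight_nonneg simp: Gamma_real_pos less_imp_le\<close>)
    finally show ?thesis by simp
  qed
  have "c_coeff \<beta> k q \<le> (\<integral>\<^sup>+ w. ennreal C * (\<Prod>p\<in>free_coords k q. indicator {0..1} (w p))
      \<partial>(\<Pi>\<^sub>M p\<in>free_coords k q. (lborel :: real measure)))"
    unfolding c_coeff_def
  proof (rule nn_integral_mono)
    fix w :: "nat \<times> nat \<Rightarrow> real"
    show "ennreal (integrand \<beta> k q (fill_in k q w)) * indicator (I_c k q) (fill_in k q w) \<le>
      ennreal C * (\<Prod>p\<in>free_coords k q. indicator {0..1} (w p))"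
    proof (cases "fill_in k q w \<in> I_c k q")
      case True
      have "w p \<in> {0..1}" if "p \<in> free_coords k q" for p
        using I_c_coord[OF True, of p] that fill_in_free[OF that, of w] free_coords_subset by auto
      then show ?thesis using le[OF True] True by (simp add: ennreal_leI)
    qed simp
  qed
  also have "\<dots> = ennreal C * (\<integral>\<^sup>+ w. (\<Prod>p\<in>free_coords k q. indicator {0..1} (w p))
      \<partial>(\<Pi>\<^sub>M p\<in>free_coords k q. (lborel :: real measure)))"
    by (intro nn_integral_cmult borel_measurable_prod_ennreal measurable_indicator_coord)
  also have "\<dots> \<le> ennreal C * (\<Prod>p\<in>free_coords k q. 1)"
    by (intro mult_left_mono nn_integral_prod_le[where rank = "\<lambda>_. 0"] measurable_indicator_coord) auto
  also have "\<dots> < \<infinity>" by simp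
  finally show ?thesis .
qed

lemma beta_kernel_nonneg [simp]: "0 \<le> beta_kernel \<delta> p s y"
  by (simp add: beta_kernel_def)

section \<open>Reduction of convergence to the middle row\<close>

text \<open>The constant that the Gamma factors of one half contribute.\<close>

definition gamma_prod :: "real \<Rightarrow> nat \<Rightarrow> real" where
  "gamma_prod \<delta> m = (\<Prod>M=1..<m. 1 / Gamma \<delta> ^ M)"

text \<open>Repeated use of \<open>phi_vandermonde_le\<close>: the Vandermonde powers telescope up to the last row.\<close>

lemma prod_phi_le:
  assumes \<delta>: "0 < \<delta>" "\<delta> \<le> 1" and m: "1 \<le> m"
    and il: "\<And>M. 1 \<le> M \<Longrightarrow> M < m \<Longrightarrow> interlaces M (x M) (x (Suc M))"
  shows "(\<Prod>M=1..<m. phi \<delta> M (x M) (x (Suc M))) \<le> gamma_prod \<delta> m * vandermonde m (x m) powr \<delta>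
    * (\<Prod>M=1..<m. \<Prod>i=1..M. beta_kernel \<delta> (x (Suc M) i) (x (Suc M) (Suc i)) (x M i))"
  using m il
proof (induction m rule: dec_induct)
  case base
  have "pairs (Suc 0) = {}" by (auto simp: pairs_def)
  then show ?case by (simp add: gamma_prod_def vandermonde_def)
next
  case (step m)
  let ?K = "\<lambda>M. \<Prod>i=1..M. beta_kernel \<delta> (x (Suc M) i) (x (Suc M) (Suc i)) (x M i)"
  have K0: "0 \<le> ?K M" for M by (intro prod_nonneg) auto
  have g0: "0 \<le> gamma_prod \<delta> m" using \<delta>
    by (auto simp: gamma_prod_def Gamma_real_pos less_imp_le intro!: prod_nonneg)
  have "(\<Prod>M=1..<Suc m. phi \<delta> M (x M) (x (Suc M))) =
      (\<Prod>M=1..<m. phi \<delta> M (x M) (x (Suc M))) * phi \<delta> m (x m) (x (Suc m))"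
    using step.hyps by (simp add: prod.atLeastLessThan_Suc)
  also have "\<dots> \<le> (gamma_prod \<delta> m * vandermonde m (x m) powr \<delta> * (\<Prod>M=1..<m. ?K M)) * phi \<delta> m (x m) (x (Suc m))"
    using step \<delta> by (intro mult_right_mono phi_nonneg) auto
  also have "\<dots> = (gamma_prod \<delta> m * (\<Prod>M=1..<m. ?K M)) * (phi \<delta> m (x m) (x (Suc m)) * vandermonde m (x m) powr \<delta>)"
    by (simp add: mult_ac)
  also have "\<dots> \<le> (gamma_prod \<delta> m * (\<Prod>M=1..<m. ?K M)) *
      (1 / Gamma \<delta> ^ m * vandermonde (Suc m) (x (Suc m)) powr \<delta> * ?K m)"
    using step \<delta> K0 g0 by (intro mult_left_mono phi_vandermonde_le mult_nonneg_nonneg prod_nonneg) auto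
  also have "\<dots> = gamma_prod \<delta> (Suc m) * vandermonde (Suc m) (x (Suc m)) powr \<delta> * (\<Prod>M=1..<Suc m. ?K M)"
    using step.hyps by (simp add: gamma_prod_def prod.atLeastLessThan_Suc mult_ac)
  finally show ?case .
qed

text \<open>The neighbouring row towards the middle, which has one more entry.\<close>

definition outer_row :: "nat \<Rightarrow> nat \<Rightarrow> nat \<Rightarrow> nat" where
  "outer_row k q r = (if r < k * q then r + 1 else r - 1)"

definition coord_kernel :: "real \<Rightarrow> nat \<Rightarrow> nat \<Rightarrow> (nat \<times> nat \<Rightarrow> real) \<Rightarrow> nat \<times> nat \<Rightarrow> real" where
  "coord_kernel \<delta> k q X = (\<lambda>(r, l).
     beta_kernel \<delta> (X (outer_row k q r, l)) (X (outer_row k q r, l + 1)) (X (r, l)))"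

lemma prod_coords_off_middle:
  fixes F :: "nat \<times> nat \<Rightarrow> real"
  shows "(\<Prod>p\<in>{p\<in>coords k q. fst p \<noteq> k * q}. F p) =
    (\<Prod>M=1..<k * q. \<Prod>i=1..M. F (M, i)) * (\<Prod>M=1..<k * q. \<Prod>i=1..M. F (2 * k * q - M, i))"
proof -
  let ?L = "SIGMA M:{1..<k * q}. {1..M}"
  let ?h = "\<lambda>(M, i). (2 * k * q - M, i :: nat)"
  have sub: "{p\<in>coords k q. fst p \<noteq> k * q} \<subseteq> ?L \<union> ?h ` ?L"
  proof
    fix p assume p: "p \<in> {p\<in>coords k q. fst p \<noteq> k * q}"
    obtain r l where rl: "p = (r, l)" by (cases p)
    have r: "1 \<le> r" "r \<le> 2 * k * q - 1" "r \<noteq> k * q" "1 \<le> l" "l \<le> min r (2 * k * q - r)"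
      using p rl by (auto simp: coords_def row_len_def)
    show "p \<in> ?L \<union> ?h ` ?L"
    proof (cases "r < k * q")
      case False
      then have "(2 * k * q - r, l) \<in> ?L" "?h (2 * k * q - r, l) = p" using r rl by auto
      then show ?thesis by (metis UnI2 imageI)
    qed (use r rl in auto)
  qed
  have "(M, i) \<in> coords k q \<and> M \<noteq> k * q" if "M \<in> {1..<k * q}" "i \<in> {1..M}" for M i
    using coords_left[of i M k q] that by simp
  moreover have "(2 * k * q - M, i) \<in> coords k q \<and> 2 * k * q - M \<noteq> k * q"
    if "M \<in> {1..<k * q}" "i \<in> {1..M}" for M i
    using coords_right[of i M k q] that by auto
  ultimately have eq: "{p\<in>coords k q. fst p \<noteq> k * q} = ?L \<union> ?h ` ?L"
    by (intro antisym[OF sub]) auto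
  have "?L \<inter> ?h ` ?L = {}" by auto
  moreover have "inj_on ?h ?L" by (auto simp: inj_on_def)
  ultimately have "(\<Prod>p\<in>{p\<in>coords k q. fst p \<noteq> k * q}. F p) = (\<Prod>p\<in>?L. F p) * (\<Prod>p\<in>?L. F (?h p))"
    unfolding eq by (subst prod.union_disjoint) (auto simp: prod.reindex)
  then show ?thesis by (simp add: prod.Sigma[symmetric] case_prod_beta)
     (simp add: prod.Sigma case_prod_beta)
qed

lemma integrand_le_kernels:
  assumes X: "X \<in> I_c k q" and N: "k * q \<ge> 1" and \<beta>: "2 \<le> \<beta>"
  defines "\<delta> \<equiv> 2 / \<beta>"
  shows "integrand \<beta> k q X \<le> (1 / Gamma \<delta>) ^ (k * q) * (gamma_prod \<delta> (k * q))\<^sup>2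
    * (vandermonde (k * q) (xrow X (k * q)) powr (2 * \<delta>) * edge_weight (k * q) (\<delta> - 1) (xrow X (k * q)))
    * (\<Prod>p\<in>{p\<in>coords k q. fst p \<noteq> k * q}. coord_kernel \<delta> k q X p)"
proof -
  let ?N = "k * q"
  have \<delta>: "0 < \<delta>" "\<delta> \<le> 1" using \<beta> by (auto simp: \<delta>_def)
  let ?K1 = "\<Prod>M=1..<?N. \<Prod>i=1..M. coord_kernel \<delta> k q X (M, i)"
  let ?K2 = "\<Prod>M=1..<?N. \<Prod>i=1..M. coord_kernel \<delta> k q X (2 * k * q - M, i)"
  let ?V = "vandermonde ?N (xrow X ?N) powr \<delta>"
  have kernel_nonneg: "0 \<le> coord_kernel \<delta> k q X p" for p by (cases p) (simp add: coord_kernel_def)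
  have g0: "0 \<le> gamma_prod \<delta> ?N" using \<delta>
    by (auto simp: gamma_prod_def Gamma_real_pos less_imp_le intro!: prod_nonneg)
  have "(\<Prod>M=1..<?N. phi \<delta> M (xrow X M) (xrow X (Suc M))) \<le> gamma_prod \<delta> ?N * ?V *
     (\<Prod>M=1..<?N. \<Prod>i=1..M. beta_kernel \<delta> (xrow X (Suc M) i) (xrow X (Suc M) (Suc i)) (xrow X M i))"
    using I_c_interlaces(1)[OF X] by (intro prod_phi_le \<delta> N) auto
  also have "(\<Prod>M=1..<?N. \<Prod>i=1..M. beta_kernel \<delta> (xrow X (Suc M) i) (xrow X (Suc M) (Suc i)) (xrow X M i)) = ?K1"
    by (intro prod.cong) (auto simp: coord_kernel_def outer_row_def xrow_def)
  finally have 1: "(\<Prod>M=1..<?N. phi \<delta> M (xrow X M) (xrow X (Suc M))) \<le> gamma_prod \<delta> ?N * ?V * ?K1" .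
  have "(\<Prod>M=1..<?N. phi \<delta> M (txrow k q X M) (txrow k q X (Suc M))) \<le> gamma_prod \<delta> ?N * vandermonde ?N (txrow k q X ?N) powr \<delta> *
     (\<Prod>M=1..<?N. \<Prod>i=1..M. beta_kernel \<delta> (txrow k q X (Suc M) i) (txrow k q X (Suc M) (Suc i)) (txrow k q X M i))"
    using I_c_interlaces(2)[OF X] by (intro prod_phi_le \<delta> N) auto
  also have "(\<Prod>M=1..<?N. \<Prod>i=1..M. beta_kernel \<delta> (txrow k q X (Suc M) i) (txrow k q X (Suc M) (Suc i)) (txrow k q X M i)) = ?K2"
  proof (intro prod.cong refl)
    fix M i assume "M \<in> {1..<?N}"
    then have "\<not> 2 * k * q - M < ?N" "2 * k * q - M - 1 = 2 * k * q - Suc M" by auto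
    then show "beta_kernel \<delta> (txrow k q X (Suc M) i) (txrow k q X (Suc M) (Suc i)) (txrow k q X M i) =
      coord_kernel \<delta> k q X (2 * k * q - M, i)"
      by (simp add: coord_kernel_def outer_row_def txrow_def)
  qed
  finally have 2: "(\<Prod>M=1..<?N. phi \<delta> M (txrow k q X M) (txrow k q X (Suc M))) \<le> gamma_prod \<delta> ?N * ?V * ?K2"
    by (simp add: txrow_middle)
  have "integrand \<beta> k q X \<le> (1 / Gamma \<delta>) ^ ?N
    * (\<Prod>M=1..<?N. phi \<delta> M (xrow X M) (xrow X (Suc M)))
    * (\<Prod>M=1..<?N. phi \<delta> M (txrow k q X M) (txrow k q X (Suc M)))
    * edge_weight ?N (\<delta> - 1) (xrow X ?N)"
    unfolding \<delta>_def using integrand_le[OF X N] \<beta> by simp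
  also have "\<dots> \<le> (1 / Gamma \<delta>) ^ ?N * (gamma_prod \<delta> ?N * ?V * ?K1) * (gamma_prod \<delta> ?N * ?V * ?K2) * edge_weight ?N (\<delta> - 1) (xrow X ?N)"
    using 1 2 \<delta> g0 kernel_nonneg
    by (intro mult_mono mult_nonneg_nonneg prod_nonneg ballI phi_nonneg)
      (auto simp: Gamma_real_pos less_imp_le edge_weight_nonneg)
  also have "\<dots> = (1 / Gamma \<delta>) ^ ?N * (gamma_prod \<delta> ?N)\<^sup>2 * ((?V * ?V) * edge_weight ?N (\<delta> - 1) (xrow X ?N)) * (?K1 * ?K2)"
    by (simp add: power2_eq_square mult_ac)
  also have "?V * ?V = vandermonde ?N (xrow X ?N) powr (2 * \<delta>)" by (simp flip: powr_add)
  finally show ?thesis unfolding prod_coords_off_middle .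
qed

lemma prod_less_infinity:
  fixes f :: "'a \<Rightarrow> ennreal"
  shows "finite A \<Longrightarrow> (\<And>i. i \<in> A \<Longrightarrow> f i < \<infinity>) \<Longrightarrow> prod f A < \<infinity>"
  by (induction A rule: finite_induct) (auto simp: ennreal_mult_less_top)

lemma measurable_beta_kernel:
  fixes a b y :: "'a \<Rightarrow> real"
  assumes [measurable]: "a \<in> borel_measurable M" "b \<in> borel_measurable M" "y \<in> borel_measurable M"
  shows "(\<lambda>w. ennreal (beta_kernel \<delta> (a w) (b w) (y w) * (if b w \<le> y w \<and> y w \<le> a w then 1 else 0)))
    \<in> borel_measurable M"
  unfolding beta_kernel_def by measurable

text \<open>When no row other than the middle one is constrained, each coordinate off the middle row is confined
  between two entries of the next row towards the middle and comes with its own beta density, so all of these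
  integrate to constants. It remains to dominate the weight of the middle row by a product of
  factors \<open>H l\<close> that can be integrated one at a time; \<open>mrank\<close> prescribes in which order.\<close>

lemma c_coeff_finite_from_middle_row:
  fixes H :: "nat \<Rightarrow> (nat \<times> nat \<Rightarrow> real) \<Rightarrow> ennreal" and mrank :: "nat \<Rightarrow> nat"
  assumes N: "k * q \<ge> 1" and cr: "constrained_rows k q \<subseteq> {k * q}" and \<beta>: "2 \<le> \<beta>"
  defines "\<delta> \<equiv> 2 / \<beta>"
  defines "mid \<equiv> {l. (k * q, l) \<in> free_coords k q}"
  assumes mrank: "\<And>l. l \<in> mid \<Longrightarrow> k * q \<le> mrank l"
    and meas: "\<And>l. l \<in> mid \<Longrightarrow> H l \<in> borel_measurable (\<Pi>\<^sub>M p\<in>free_coords k q. lborel)"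
    and middle_only: "\<And>l r m w t. l \<in> mid \<Longrightarrow> r \<noteq> k * q \<Longrightarrow> H l (w((r, m) := t)) = H l w"
    and indep: "\<And>l l' w t. l \<in> mid \<Longrightarrow> l' \<in> mid \<Longrightarrow> l' \<noteq> l \<Longrightarrow> mrank l' \<le> mrank l \<Longrightarrow>
                  H l (w((k * q, l') := t)) = H l w"
    and bound: "\<And>l w. l \<in> mid \<Longrightarrow> (\<integral>\<^sup>+ t. H l (w((k * q, l) := t)) \<partial>lborel) \<le> B l"
    and fin: "\<And>l. l \<in> mid \<Longrightarrow> B l < \<infinity>"
    and dom: "\<And>w. fill_in k q w \<in> I_c k q \<Longrightarrow>
        ennreal (vandermonde (k * q) (xrow (fill_in k q w) (k * q)) powr (2 * \<delta>)
                 * edge_weight (k * q) (\<delta> - 1) (xrow (fill_in k q w) (k * q)))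
        \<le> ennreal C * (\<Prod>l\<in>mid. H l w)"
  shows "c_coeff \<beta> k q < \<infinity>"
proof -
  let ?N = "k * q" and ?F = "free_coords k q"
  let ?P = "\<Pi>\<^sub>M p\<in>?F. (lborel :: real measure)"
  have \<delta>: "0 < \<delta>" "\<delta> \<le> 1" using \<beta> by (auto simp: \<delta>_def)
  define lo where "lo = {p\<in>coords k q. fst p \<noteq> ?N}"
  define hi where "hi = Pair ?N ` mid"
  define K where "K w p = coord_kernel \<delta> k q (fill_in k q w) p *
    indicator {fill_in k q w (outer_row k q (fst p), snd p + 1)..fill_in k q w (outer_row k q (fst p), snd p)} (w p)"
    for w p
  define G where "G p w = (if fst p = ?N then H (snd p) w else ennreal (K w p))" for p w
  define rank where "rank p = (if fst p = ?N then mrank (snd p) else row_len k q (fst p))" for p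
  define D where "D = (1 / Gamma \<delta>) ^ (k * q) * (gamma_prod \<delta> (k * q))\<^sup>2"
  have lo_free: "lo \<subseteq> ?F" using cr by (auto simp: lo_def free_coords_def eliminated_def)
  have F: "?F = lo \<union> hi" "lo \<inter> hi = {}"
    using lo_free free_coords_subset[of k q] by (auto simp: lo_def hi_def mid_def)
  have fin_lo: "finite lo" "finite hi" using F(1) finite_coords(2)[of k q] by (auto dest: finite_subset[rotated])
  have parent: "(outer_row k q r, l) \<in> coords k q" "(outer_row k q r, l + 1) \<in> coords k q"
    "row_len k q (outer_row k q r) = row_len k q r + 1" "row_len k q r < k * q"
    if "(r, l) \<in> lo" for r l
    using that by (auto simp: lo_def coords_def row_len_def outer_row_def split: if_splits)
  have G_free: "fill_in k q w p = w p" if "p \<in> lo" for p w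
    using fill_in_free[of p k q w] lo_free that by blast
  have G_meas: "G p \<in> borel_measurable ?P" if "p \<in> ?F" for p
  proof (cases "fst p = ?N")
    case True
    then have "G p = H (snd p)" by (auto simp: G_def)
    then show ?thesis using meas[of "snd p"] that True by (cases p) (auto simp: mid_def)
  next
    case False
    then have p: "p \<in> lo" using that F by (auto simp: hi_def)
    obtain r l where rl: "p = (r, l)" by (cases p)
    define a where "a w = fill_in k q w (outer_row k q r, l)" for w
    define b where "b w = fill_in k q w (outer_row k q r, l + 1)" for w
    define y where "y w = w p" for w :: "nat \<times> nat \<Rightarrow> real"
    have "a \<in> borel_measurable ?P" "b \<in> borel_measurable ?P"
      unfolding a_def[abs_def] b_def[abs_def] using parent[OF p[unfolded rl]]
      by (auto intro!: measurable_fill_in)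
    have "y \<in> borel_measurable ?P"
      unfolding y_def[abs_def] using measurable_component_singleton[OF \<open>p \<in> ?F\<close>, of "\<lambda>_. lborel :: real measure"]
      by simp
    have "K w p = beta_kernel \<delta> (a w) (b w) (y w) * (if b w \<le> y w \<and> y w \<le> a w then 1 else 0)" for w
    proof -
      have "fill_in k q w (r, l) = w (r, l)" using G_free[OF p, of w] rl by simp
      then show ?thesis
        unfolding K_def a_def b_def y_def coord_kernel_def rl fst_conv snd_conv prod.case indicator_def
          atLeastAtMost_iff of_bool_def by (rule subst) (rule refl)
    qed
    then have "G p = (\<lambda>w. ennreal (beta_kernel \<delta> (a w) (b w) (y w) * (if b w \<le> y w \<and> y w \<le> a w then 1 else 0)))"
      using False unfolding G_def by (intro ext) (simp only: if_False)
    moreover have "(\<lambda>w. ennreal (beta_kernel \<delta> (a w) (b w) (y w) * (if b w \<le> y w \<and> y w \<le> a w then 1 else 0)))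
        \<in> borel_measurable ?P"
      by (rule measurable_beta_kernel) fact+
    ultimately show ?thesis by simp
  qed
  have G_indep: "G p (w(p' := t)) = G p w"
    if p: "p \<in> ?F" "p' \<in> ?F" "p' \<noteq> p" "rank p' \<le> rank p" for p p' w t
  proof (cases "fst p = ?N")
    case True
    obtain l where pl: "p = (?N, l)" "l \<in> mid" using True p(1) by (cases p) (auto simp: mid_def)
    obtain r' l' where p': "p' = (r', l')" by (cases p')
    show ?thesis
    proof (cases "r' = ?N")
      case r': True
      then have "l' \<in> mid" using p p' by (auto simp: mid_def)
      then show ?thesis using indep[OF pl(2), of l'] p p' pl r' by (simp add: G_def rank_def)
    qed (use middle_only[OF pl(2)] p' pl in \<open>simp add: G_def\<close>)
  next
    case False
    then have plo: "p \<in> lo" using p F by (auto simp: hi_def)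
    obtain r l where rl: "p = (r, l)" by (cases p)
    obtain r' l' where p': "p' = (r', l')" by (cases p')
    note par = parent[OF plo[unfolded rl]]
    have r': "r' \<noteq> ?N" "r' \<noteq> outer_row k q r"
    proof -
      show "r' \<noteq> ?N" using p par(4) mrank[of l'] False rl p' by (auto simp: rank_def mid_def)
      then show "r' \<noteq> outer_row k q r" using p(4) par(3) False rl p' by (auto simp: rank_def)
    qed
    then have same: "fill_in k q (w(p' := t)) (outer_row k q r, m) = fill_in k q w (outer_row k q r, m)" for m
      unfolding p' using fill_in_upd_other_row[of "outer_row k q r" r' k q w l' t m] by auto
    have "fill_in k q (w(p' := t)) p = fill_in k q w p" "(w(p' := t)) p = w p"
      using G_free[OF plo] p(3) by auto
    then show ?thesis using False same rl by (simp add: G_def K_def coord_kernel_def)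
  qed
  have G_bound: "(\<integral>\<^sup>+ t. G p (w(p := t)) \<partial>lborel) \<le> (if fst p = ?N then B (snd p) else ennreal (2 * 2 powr (1 - \<delta>) / \<delta>))"
    if p: "p \<in> ?F" for p w
  proof (cases "fst p = ?N")
    case True
    then obtain l where pl: "p = (?N, l)" "l \<in> mid" using p by (cases p) (auto simp: mid_def)
    then show ?thesis using bound[OF pl(2), of w] by (simp add: G_def)
  next
    case False
    then have plo: "p \<in> lo" using p F by (auto simp: hi_def)
    obtain r l where rl: "p = (r, l)" by (cases p)
    let ?a = "fill_in k q w (outer_row k q r, l)" and ?b = "fill_in k q w (outer_row k q r, l + 1)"
    have ne: "outer_row k q r \<noteq> r" using parent(3)[OF plo[unfolded rl]] by auto
    have "G p (w(p := t)) = ennreal (beta_kernel \<delta> ?a ?b t * indicator {?b..?a} t)" for t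
      using False G_free[OF plo, of "w(p := t)"] fill_in_upd_other_row[OF ne, of k q w l t] rl
      by (simp add: G_def K_def coord_kernel_def)
    then show ?thesis using beta_kernel_integral_le[OF \<delta>, of ?a ?b] False by simp
  qed
  have "c_coeff \<beta> k q \<le> (\<integral>\<^sup>+ w. ennreal (D * \<bar>C\<bar>) * (\<Prod>p\<in>?F. G p w) \<partial>?P)"
    unfolding c_coeff_def
  proof (rule nn_integral_mono)
    fix w :: "nat \<times> nat \<Rightarrow> real"
    let ?X = "fill_in k q w"
    let ?M = "vandermonde ?N (xrow ?X ?N) powr (2 * \<delta>) * edge_weight ?N (\<delta> - 1) (xrow ?X ?N)"
    show "ennreal (integrand \<beta> k q ?X) * indicator (I_c k q) ?X \<le> ennreal (D * \<bar>C\<bar>) * (\<Prod>p\<in>?F. G p w)"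
    proof (cases "?X \<in> I_c k q")
      case X: True
      have K: "K w p = coord_kernel \<delta> k q ?X p" if p: "p \<in> lo" for p
      proof -
        obtain r l where rl: "p = (r, l)" by (cases p)
        have c: "1 \<le> l" "l \<le> min r (2 * k * q - r)" "1 \<le> r" "r \<le> 2 * k * q - 1" "r \<noteq> ?N"
          using p rl by (auto simp: lo_def coords_def row_len_def)
        have "?X (outer_row k q r, l + 1) \<le> ?X (r, l) \<and> ?X (r, l) \<le> ?X (outer_row k q r, l)"
        proof (cases "r < ?N")
          case True
          then have "interlaces r (xrow ?X r) (xrow ?X (Suc r))" using I_c_interlaces[OF X] c by auto
          then show ?thesis using True c by (auto simp: interlaces_def xrow_def outer_row_def)
        next
          case False
          let ?M = "2 * k * q - r"
          have M: "2 * k * q - ?M = r" "2 * k * q - Suc ?M = r - 1" "1 \<le> ?M" "?M < ?N" using c False by auto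
          have "interlaces ?M (txrow k q ?X ?M) (txrow k q ?X (Suc ?M))" using I_c_interlaces[OF X] M by auto
          then have "txrow k q ?X ?M l \<le> txrow k q ?X (Suc ?M) l \<and> txrow k q ?X (Suc ?M) (l + 1) \<le> txrow k q ?X ?M l"
            using c by (auto simp: interlaces_def)
          then show ?thesis using False M by (simp add: txrow_def outer_row_def)
        qed
        then show ?thesis using G_free[OF p, of w] rl by (simp add: K_def)
      qed
      have "ennreal (integrand \<beta> k q ?X) \<le> ennreal (D * ?M * (\<Prod>p\<in>lo. coord_kernel \<delta> k q ?X p))"
        using integrand_le_kernels[OF X N \<beta>] by (simp add: D_def lo_def \<delta>_def ennreal_leI)
      also have "\<dots> = ennreal D * ennreal ?M * (\<Prod>p\<in>lo. ennreal (coord_kernel \<delta> k q ?X p))"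
      proof -
        have "0 \<le> coord_kernel \<delta> k q ?X p" for p by (cases p) (simp add: coord_kernel_def)
        moreover have "0 \<le> D" using \<delta> by (simp add: D_def Gamma_real_pos less_imp_le)
        moreover have "0 \<le> ?M" by (simp add: edge_weight_nonneg)
        ultimately show ?thesis by (simp add: ennreal_mult prod_nonneg prod_ennreal)
      qed
      also have "\<dots> \<le> ennreal D * (ennreal \<bar>C\<bar> * (\<Prod>l\<in>mid. H l w)) * (\<Prod>p\<in>lo. ennreal (coord_kernel \<delta> k q ?X p))"
        using dom[OF X] by (intro mult_right_mono mult_left_mono order_trans[OF dom[OF X]]) (auto intro!: ennreal_leI)
      also have "(\<Prod>p\<in>lo. ennreal (coord_kernel \<delta> k q ?X p)) = (\<Prod>p\<in>lo. G p w)"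
        using K by (intro prod.cong) (auto simp: G_def lo_def)
      also have "(\<Prod>l\<in>mid. H l w) = (\<Prod>p\<in>hi. G p w)"
        unfolding hi_def by (subst prod.reindex) (auto simp: inj_on_def G_def)
      also have "ennreal D * (ennreal \<bar>C\<bar> * (\<Prod>p\<in>hi. G p w)) * (\<Prod>p\<in>lo. G p w) = ennreal (D * \<bar>C\<bar>) * (\<Prod>p\<in>?F. G p w)"
        unfolding F(1) using fin_lo F(2) \<delta>
        by (simp add: prod.union_disjoint mult_ac ennreal_mult D_def Gamma_real_pos less_imp_le)
      finally show ?thesis using X by simp
    qed simp
  qed
  also have "\<dots> = ennreal (D * \<bar>C\<bar>) * (\<integral>\<^sup>+ w. (\<Prod>p\<in>?F. G p w) \<partial>?P)"
    by (intro nn_integral_cmult borel_measurable_prod_ennreal G_meas)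
  also have "\<dots> \<le> ennreal (D * \<bar>C\<bar>) * (\<Prod>p\<in>?F. if fst p = ?N then B (snd p) else ennreal (2 * 2 powr (1 - \<delta>) / \<delta>))"
    by (intro mult_left_mono nn_integral_prod_le[where rank = rank] G_meas G_indep G_bound) auto
  also have "\<dots> < \<infinity>"
  proof -
    have "(\<Prod>p\<in>?F. if fst p = ?N then B (snd p) else ennreal (2 * 2 powr (1 - \<delta>) / \<delta>)) < \<infinity>"
      using fin by (intro prod_less_infinity) (auto simp: mid_def)
    then show ?thesis by (simp add: ennreal_mult_less_top)
  qed
  finally show ?thesis .
qed

section \<open>The free middle row\<close>

lemma vandermonde_le_1:
  assumes "W_plus n x" "\<And>j. 1 \<le> j \<Longrightarrow> j \<le> n \<Longrightarrow> 0 \<le> x j \<and> x j \<le> 1"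
  shows "0 \<le> vandermonde n x" "vandermonde n x \<le> 1"
proof -
  have "0 \<le> x i - x j \<and> x i - x j \<le> 1" if "(i, j) \<in> pairs n" for i j
    using W_plus_antimono[OF assms(1), of i j] assms(2)[of i] assms(2)[of j] that
    by (auto simp: pairs_def)
  then show "0 \<le> vandermonde n x" "vandermonde n x \<le> 1"
    unfolding vandermonde_def by (auto intro!: prod_nonneg prod_le_1)
qed

text \<open>The middle row is free, and its weight is at most the product of the beta densities on the unit
  interval.\<close>

lemma c_coeff_finite_k_1:
  assumes k: "k = 1" and q: "q \<ge> 1" and \<beta>: "2 \<le> \<beta>"
  shows "c_coeff \<beta> k q < \<infinity>"
proof -
  define \<delta> where "\<delta> = 2 / \<beta>"
  have \<delta>: "0 < \<delta>" "\<delta> \<le> 1" using \<beta> by (auto simp: \<delta>_def)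
  define mid where "mid = {l. (k * q, l) \<in> free_coords k q}"
  have mid: "mid = {1..k * q}"
    using k q by (auto simp: mid_def free_coords_def coords_def eliminated_def constrained_rows_def row_len_def)
  show ?thesis
  proof (rule c_coeff_finite_from_middle_row[where C = 1 and mrank = "\<lambda>_. k * q"
        and H = "\<lambda>l w. ennreal (beta_kernel \<delta> 1 0 (w (k * q, l)) * indicator {0..1} (w (k * q, l)))"
        and B = "\<lambda>_. ennreal (2 * 2 powr (1 - \<delta>) / \<delta>)"], unfold \<delta>_def[symmetric] mid_def[symmetric])
    fix l assume "l \<in> mid"
    then have l: "(k * q, l) \<in> free_coords k q" by (simp add: mid_def)
    show "(\<lambda>w. ennreal (beta_kernel \<delta> 1 0 (w (k * q, l)) * indicator {0..1} (w (k * q, l))))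
      \<in> borel_measurable (\<Pi>\<^sub>M p\<in>free_coords k q. lborel)"
      by (rule measurable_compose[OF measurable_component_singleton[OF l]])
        (simp add: beta_kernel_def)
  next
    fix w assume X: "fill_in k q w \<in> I_c k q"
    let ?x = "xrow (fill_in k q w) (k * q)"
    have W: "W_plus (k * q) ?x" using X k q by (auto simp: I_c_def)
    have b: "0 \<le> ?x l \<and> ?x l \<le> 1" if "l \<in> {1..k * q}" for l
      using I_c_bounds(1)[OF X, of l "k * q"] that by auto
    have e: "edge_weight (k * q) (\<delta> - 1) ?x = (\<Prod>l\<in>mid. beta_kernel \<delta> 1 0 (w (k * q, l)) * indicator {0..1} (w (k * q, l)))"
      unfolding edge_weight_def mid
    proof (rule prod.cong)
      fix l assume l: "l \<in> {1..k * q}"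
      then have "(k * q, l) \<in> free_coords k q" using mid unfolding mid_def by blast
      then have "?x l = w (k * q, l)" by (simp add: fill_in_free xrow_def)
      then show "?x l powr (\<delta> - 1) * (1 - ?x l) powr (\<delta> - 1) =
        beta_kernel \<delta> 1 0 (w (k * q, l)) * indicator {0..1} (w (k * q, l))"
        using b[OF l] by (simp add: beta_kernel_def)
    qed simp
    have "vandermonde (k * q) ?x powr (2 * \<delta>) \<le> 1"
      using vandermonde_le_1[OF W] b powr_mono2[of "2 * \<delta>" "vandermonde (k * q) ?x" 1] \<delta> by simp
    then have "vandermonde (k * q) ?x powr (2 * \<delta>) * edge_weight (k * q) (\<delta> - 1) ?x \<le> 1 * edge_weight (k * q) (\<delta> - 1) ?x"
      by (intro mult_right_mono edge_weight_nonneg)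
    then show "ennreal (vandermonde (k * q) ?x powr (2 * \<delta>) * edge_weight (k * q) (\<delta> - 1) ?x) \<le> ennreal 1 *
      (\<Prod>l\<in>mid. ennreal (beta_kernel \<delta> 1 0 (w (k * q, l)) * indicator {0..1} (w (k * q, l))))"
      by (subst prod_ennreal) (auto simp: e intro!: ennreal_leI)
  qed (use assms \<delta> beta_kernel_integral_le[OF \<delta>, of 1 0] in \<open>auto simp: constrained_rows_def\<close>)
qed

section \<open>The constrained middle row\<close>

lemma prod_pairs_le_powers:
  fixes u :: "nat \<Rightarrow> real"
  assumes "\<And>i j. 1 \<le> i \<Longrightarrow> i \<le> j \<Longrightarrow> j \<le> q \<Longrightarrow> 0 \<le> u i \<and> u i \<le> u j"
  shows "(\<Prod>(i, j)\<in>pairs q. u j - u i) \<le> (\<Prod>j=1..q. u j ^ (j - 1))"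
  using assms
proof (induction q)
  case 0
  have "pairs 0 = {}" by (auto simp: pairs_def)
  then show ?case by simp
next
  case (Suc q)
  have nn: "0 \<le> u (Suc q)" using Suc.prems[of "Suc q" "Suc q"] by simp
  have "(\<Prod>i=1..q. u (Suc q) - u i) \<le> (\<Prod>i=1..q. u (Suc q))"
    using Suc.prems by (intro prod_mono) fastforce
  moreover have "0 \<le> (\<Prod>(i, j)\<in>pairs q. u j - u i)"
    using Suc.prems by (intro prod_nonneg) (auto simp: pairs_def)
  moreover have "0 \<le> (\<Prod>i=1..q. u (Suc q) - u i)"
    using Suc.prems[of _ "Suc q"] by (intro prod_nonneg) auto
  moreover have "(\<Prod>(i, j)\<in>pairs q. u j - u i) \<le> (\<Prod>j=1..q. u j ^ (j - 1))"
    using Suc by auto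
  ultimately have "(\<Prod>(i, j)\<in>pairs q. u j - u i) * (\<Prod>i=1..q. u (Suc q) - u i) \<le>
      (\<Prod>j=1..q. u j ^ (j - 1)) * (\<Prod>i=1..q. u (Suc q))"
    by (intro mult_mono) auto
  then show ?case using nn by (simp add: prod_pairs_last_column)
qed

text \<open>The upper half of the row is measured from \<open>1\<close>, the lower half from \<open>0\<close>. Differences across
  the halves are bounded by \<open>1\<close>.\<close>

lemma vandermonde_le_two_clusters:
  assumes W: "W_plus (2 * q) x" and b: "\<And>j. 1 \<le> j \<Longrightarrow> j \<le> 2 * q \<Longrightarrow> 0 \<le> x j \<and> x j \<le> 1"
  shows "vandermonde (2 * q) x \<le> (\<Prod>j=1..q. (1 - x j) ^ (j - 1)) * (\<Prod>j=1..q. x (2 * q + 1 - j) ^ (j - 1))"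
proof -
  let ?r = "\<lambda>(i, j). (2 * q + 1 - j, 2 * q + 1 - i)"
  let ?f = "\<lambda>(i, j). x i - x j"
  let ?v = "\<lambda>j. x (2 * q + 1 - j)"
  have r: "0 \<le> ?f p \<and> ?f p \<le> 1" if p: "p \<in> pairs (2 * q)" for p
  proof -
    obtain i j where "p = (i, j)" "1 \<le> i" "i < j" "j \<le> 2 * q" using p by (cases p) (auto simp: pairs_def)
    then show ?thesis using W_plus_antimono[OF W, of i j] b[of i] b[of j] by auto
  qed
  have disj: "pairs q \<inter> ?r ` pairs q = {}" by (auto simp: pairs_def)
  have sub: "pairs q \<union> ?r ` pairs q \<subseteq> pairs (2 * q)" by (auto simp: pairs_def)
  have "vandermonde (2 * q) x = (\<Prod>p\<in>pairs (2 * q) - (pairs q \<union> ?r ` pairs q). ?f p) * (\<Prod>p\<in>pairs q \<union> ?r ` pairs q. ?f p)"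
    unfolding vandermonde_def by (rule prod.subset_diff[OF sub]) simp
  also have "\<dots> \<le> 1 * (\<Prod>p\<in>pairs q \<union> ?r ` pairs q. ?f p)"
    using r sub by (intro mult_right_mono prod_le_1 prod_nonneg) auto
  also have "\<dots> = (\<Prod>p\<in>pairs q. ?f p) * (\<Prod>p\<in>?r ` pairs q. ?f p)"
    using disj by (simp add: prod.union_disjoint)
  also have "(\<Prod>p\<in>?r ` pairs q. ?f p) = (\<Prod>(i, j)\<in>pairs q. ?v j - ?v i)"
    by (subst prod.reindex) (auto simp: inj_on_def pairs_def case_prod_beta intro!: prod.cong)
  also have "(\<Prod>p\<in>pairs q. ?f p) = (\<Prod>(i, j)\<in>pairs q. (1 - x j) - (1 - x i))"
    by (intro prod.cong) auto
  also have "(\<Prod>(i, j)\<in>pairs q. (1 - x j) - (1 - x i)) * (\<Prod>(i, j)\<in>pairs q. ?v j - ?v i) \<le>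
    (\<Prod>j=1..q. (1 - x j) ^ (j - 1)) * (\<Prod>j=1..q. ?v j ^ (j - 1))"
  proof (intro mult_mono)
    show "(\<Prod>(i, j)\<in>pairs q. (1 - x j) - (1 - x i)) \<le> (\<Prod>j=1..q. (1 - x j) ^ (j - 1))"
      using W_plus_antimono[OF W] b by (intro prod_pairs_le_powers[of q "\<lambda>j. 1 - x j"]) auto
    show "(\<Prod>(i, j)\<in>pairs q. ?v j - ?v i) \<le> (\<Prod>j=1..q. ?v j ^ (j - 1))"
      using W_plus_antimono[OF W] b by (intro prod_pairs_le_powers[of q ?v]) auto
    show "0 \<le> (\<Prod>j=1..q. (1 - x j) ^ (j - 1))"
      using b by (intro prod_nonneg) auto
    show "0 \<le> (\<Prod>(i, j)\<in>pairs q. ?v j - ?v i)"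
      using W_plus_antimono[OF W] by (intro prod_nonneg) (auto simp: pairs_def)
  qed
  finally show ?thesis .
qed

text \<open>The exponent of the \<open>j\<close>-th smallest distance to an endpoint, after integration: \<open>\<delta>\<close> from the
  endpoint itself and \<open>2 * \<delta>\<close> from each of the \<open>j - 1\<close> smaller distances.\<close>

definition coord_exponent :: "real \<Rightarrow> nat \<Rightarrow> real" where
  "coord_exponent \<delta> j = \<delta> * (2 * real j - 1)"

lemma sum_coord_exponent: "(\<Sum>j=1..q. coord_exponent \<delta> j) = \<delta> * (real q)\<^sup>2"
  by (induction q) (auto simp: coord_exponent_def power2_eq_square algebra_simps)

text \<open>Write \<open>u\<close> for the distances of the upper half to \<open>1\<close> and \<open>v\<close> for the distances of the lower
  half to \<open>0\<close>. The constraint says that they have the same sum, and this forces both halves to keep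
  a distance \<open>1 / (q + 1)\<close> from the opposite endpoint. So singularities arise only where some
  \<open>u\<close> or \<open>v\<close> is small.\<close>

lemma middle_row_le:
  assumes \<delta>: "0 < \<delta>" "\<delta> \<le> 1" and W: "W_plus (2 * q) x" and q: "1 \<le> q"
    and b: "\<And>j. 1 \<le> j \<Longrightarrow> j \<le> 2 * q \<Longrightarrow> 0 < x j \<and> x j < 1"
    and s: "(\<Sum>j=1..2 * q. x j) = real q"
  defines "u \<equiv> \<lambda>j. 1 - x j" and "v \<equiv> \<lambda>j. x (2 * q + 1 - j)"
  shows "vandermonde (2 * q) x powr (2 * \<delta>) * edge_weight (2 * q) (\<delta> - 1) x \<le>
    (real (q + 1) powr (1 - \<delta>)) ^ (2 * q)
      * (\<Prod>j=1..q. u j powr (coord_exponent \<delta> j - 1)) * (\<Prod>j=1..q. v j powr (coord_exponent \<delta> j - 1))"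
    and "(\<Sum>j=1..q. u j) = (\<Sum>j=1..q. v j)"
proof -
  have sum_flip: "(\<Sum>j=q+1..2 * q. f j) = (\<Sum>j=1..q. f (2 * q + 1 - j))" for f :: "nat \<Rightarrow> real"
    by (rule sum.reindex_bij_witness[of _ "\<lambda>j. 2 * q + 1 - j" "\<lambda>j. 2 * q + 1 - j"]) auto
  have prod_flip: "(\<Prod>j=q+1..2 * q. f j) = (\<Prod>j=1..q. f (2 * q + 1 - j))" for f :: "nat \<Rightarrow> real"
    by (rule prod.reindex_bij_witness[of _ "\<lambda>j. 2 * q + 1 - j" "\<lambda>j. 2 * q + 1 - j"]) auto
  have split: "{1..2 * q} = {1..q} \<union> {q+1..2 * q}" by auto
  have "(\<Sum>j=1..2 * q. x j) = (\<Sum>j=1..q. x j) + (\<Sum>j=1..q. v j)"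
    unfolding split v_def sum_flip[symmetric] by (rule sum.union_disjoint) auto
  then show uv: "(\<Sum>j=1..q. u j) = (\<Sum>j=1..q. v j)"
    using s by (simp add: u_def sum_subtractf)
  have upos: "0 < u j" "u j \<le> u q" "0 < v j" "v j \<le> v q" if "1 \<le> j" "j \<le> q" for j
    using b[of j] b[of "2 * q + 1 - j"] W_plus_antimono[OF W, of j q]
      W_plus_antimono[OF W, of "2 * q + 1 - q" "2 * q + 1 - j"] that by (auto simp: u_def v_def)
  have uq: "u q + v q \<le> 1"
    using W_plus_antimono[OF W, of q "q + 1"] q by (simp add: u_def v_def)
  \<comment> \<open>The largest of one family is at most the sum of the other, whose terms are at most its complement.\<close>
  have half: "b' \<le> 1 - 1 / real (q + 1)"
    if "b' \<le> (\<Sum>j=1..q. f j)" "\<And>j. j \<in> {1..q} \<Longrightarrow> f j \<le> 1 - b'" for b' and f :: "nat \<Rightarrow> real"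
  proof -
    have "(\<Sum>j=1..q. f j) \<le> real q * (1 - b')"
      using sum_bounded_above[of "{1..q}" f "1 - b'"] that by simp
    then have "b' \<le> real q * (1 - b')" using that by linarith
    then show ?thesis by (simp add: field_simps)
  qed
  have "v q \<le> (\<Sum>j=1..q. v j)" using upos q by (intro member_le_sum) (auto simp: less_imp_le)
  then have vq: "v q \<le> 1 - 1 / real (q + 1)" using half[of "v q" u] uv upos(2) uq by fastforce
  have "u q \<le> (\<Sum>j=1..q. u j)" using upos q by (intro member_le_sum) (auto simp: less_imp_le)
  then have uq': "u q \<le> 1 - 1 / real (q + 1)" using half[of "u q" v] uv upos(4) uq by fastforce
  let ?c = "real (q + 1) powr (1 - \<delta>)"
  have cz: "(1 - z) powr (\<delta> - 1) \<le> ?c" if "z \<le> 1 - 1 / real (q + 1)" for z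
  proof -
    have "(1 - z) powr (\<delta> - 1) \<le> (1 / real (q + 1)) powr (\<delta> - 1)"
      using that \<delta> by (intro powr_mono2') auto
    also have "\<dots> = ?c" using powr_minus[of "real (q + 1)" "\<delta> - 1"] by (simp add: powr_divide inverse_eq_divide)
    finally show ?thesis .
  qed
  have "edge_weight (2 * q) (\<delta> - 1) x =
    (\<Prod>j=1..q. (1 - u j) powr (\<delta> - 1) * u j powr (\<delta> - 1)) * (\<Prod>j=1..q. (1 - v j) powr (\<delta> - 1) * v j powr (\<delta> - 1))"
  proof -
    have "edge_weight (2 * q) (\<delta> - 1) x = (\<Prod>j=1..q. x j powr (\<delta> - 1) * (1 - x j) powr (\<delta> - 1))
      * (\<Prod>j=q+1..2 * q. x j powr (\<delta> - 1) * (1 - x j) powr (\<delta> - 1))"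
      unfolding edge_weight_def split by (rule prod.union_disjoint) auto
    then show ?thesis unfolding prod_flip u_def v_def by (simp add: mult.commute)
  qed
  also have "\<dots> \<le> (\<Prod>j=1..q. ?c * u j powr (\<delta> - 1)) * (\<Prod>j=1..q. ?c * v j powr (\<delta> - 1))"
  proof -
    have "u j \<le> 1 - 1 / real (q + 1)" "v j \<le> 1 - 1 / real (q + 1)" if "j \<in> {1..q}" for j
      using that upos[of j] uq' vq by auto
    then show ?thesis
      by (intro mult_mono prod_mono conjI mult_right_mono cz prod_nonneg) auto
  qed
  also have "\<dots> = ?c ^ (2 * q) * (\<Prod>j=1..q. u j powr (\<delta> - 1)) * (\<Prod>j=1..q. v j powr (\<delta> - 1))"
    by (simp add: prod.distrib mult_ac power2_eq_square power_mult power_even_eq flip: mult_2)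
  finally have E: "edge_weight (2 * q) (\<delta> - 1) x \<le> ?c ^ (2 * q) * (\<Prod>j=1..q. u j powr (\<delta> - 1)) * (\<Prod>j=1..q. v j powr (\<delta> - 1))" .
  have V0: "0 \<le> vandermonde (2 * q) x" using vandermonde_le_1[OF W] b by (auto simp: less_imp_le)
  have pw: "(z ^ n) powr (2 * \<delta>) = z powr (2 * \<delta> * real n)" if "0 < z" for z :: real and n
    using that by (simp add: powr_powr mult_ac flip: powr_realpow)
  have "vandermonde (2 * q) x powr (2 * \<delta>) \<le> ((\<Prod>j=1..q. u j ^ (j - 1)) * (\<Prod>j=1..q. v j ^ (j - 1))) powr (2 * \<delta>)"
    using vandermonde_le_two_clusters[OF W] b \<delta> V0 by (intro powr_mono2) (auto simp: u_def v_def less_imp_le)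
  also have "\<dots> = (\<Prod>j=1..q. u j powr (2 * \<delta> * real (j - 1))) * (\<Prod>j=1..q. v j powr (2 * \<delta> * real (j - 1)))"
  proof -
    have "(\<Prod>j=1..q. f j ^ (j - 1)) powr (2 * \<delta>) = (\<Prod>j=1..q. f j powr (2 * \<delta> * real (j - 1)))"
      if "\<And>j. 1 \<le> j \<Longrightarrow> j \<le> q \<Longrightarrow> 0 < f j" for f :: "nat \<Rightarrow> real"
      using that by (subst prod_powr_distrib) (auto intro!: prod.cong pw simp: less_imp_le simp del: of_nat_diff)
    then show ?thesis using upos by (simp add: powr_mult prod_nonneg less_imp_le)
  qed
  finally have V: "vandermonde (2 * q) x powr (2 * \<delta>) \<le>
    (\<Prod>j=1..q. u j powr (2 * \<delta> * real (j - 1))) * (\<Prod>j=1..q. v j powr (2 * \<delta> * real (j - 1)))" .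
  have comb: "(\<Prod>j=1..q. f j powr (2 * \<delta> * real (j - 1))) * (\<Prod>j=1..q. f j powr (\<delta> - 1)) =
      (\<Prod>j=1..q. f j powr (coord_exponent \<delta> j - 1))" for f :: "nat \<Rightarrow> real"
  proof -
    have eq: "2 * \<delta> * real (j - 1) + (\<delta> - 1) = coord_exponent \<delta> j - 1" if "j \<in> {1..q}" for j
      using that by (auto simp: coord_exponent_def of_nat_diff algebra_simps)
    have "f j powr (2 * \<delta> * real (j - 1)) * f j powr (\<delta> - 1) = f j powr (coord_exponent \<delta> j - 1)"
      if "j \<in> {1..q}" for j
      unfolding powr_add[symmetric] eq[OF that] ..
    then show ?thesis unfolding prod.distrib[symmetric] by (rule prod.cong[OF refl])
  qed
  have "vandermonde (2 * q) x powr (2 * \<delta>) * edge_weight (2 * q) (\<delta> - 1) x \<le>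
    ((\<Prod>j=1..q. u j powr (2 * \<delta> * real (j - 1))) * (\<Prod>j=1..q. v j powr (2 * \<delta> * real (j - 1)))) *
    (?c ^ (2 * q) * (\<Prod>j=1..q. u j powr (\<delta> - 1)) * (\<Prod>j=1..q. v j powr (\<delta> - 1)))"
    using V E by (intro mult_mono edge_weight_nonneg mult_nonneg_nonneg prod_nonneg) auto
  also have "\<dots> = ?c ^ (2 * q)
      * ((\<Prod>j=1..q. u j powr (2 * \<delta> * real (j - 1))) * (\<Prod>j=1..q. u j powr (\<delta> - 1)))
      * ((\<Prod>j=1..q. v j powr (2 * \<delta> * real (j - 1))) * (\<Prod>j=1..q. v j powr (\<delta> - 1)))"
    by (simp only: mult_ac)
  finally show "vandermonde (2 * q) x powr (2 * \<delta>) * edge_weight (2 * q) (\<delta> - 1) x \<le> ?c ^ (2 * q)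
      * (\<Prod>j=1..q. u j powr (coord_exponent \<delta> j - 1)) * (\<Prod>j=1..q. v j powr (coord_exponent \<delta> j - 1))"
    unfolding comb .
qed

text \<open>A power density on the interval from \<open>0\<close> to \<open>c * b\<close>, scaled by \<open>b\<close> so that its integral does not
  depend on \<open>b\<close>.\<close>

definition cut_powr :: "real \<Rightarrow> real \<Rightarrow> real \<Rightarrow> real \<Rightarrow> real" where
  "cut_powr a c b z = z powr (a - 1) * b powr (- a) * indicator {0..c * b} z"

lemma cut_powr_nonneg [simp]: "0 \<le> cut_powr a c b z"
  by (simp add: cut_powr_def)

lemma cut_powr_eq: "0 \<le> z \<Longrightarrow> z \<le> c * b \<Longrightarrow> cut_powr a c b z = z powr (a - 1) * b powr (- a)"
  by (simp add: cut_powr_def)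

lemma measurable_cut_powr:
  fixes f g :: "'a \<Rightarrow> real"
  assumes [measurable]: "f \<in> borel_measurable M" "g \<in> borel_measurable M"
  shows "(\<lambda>w. cut_powr a c (f w) (g w)) \<in> borel_measurable M"
proof -
  have eq: "cut_powr a c (f w) (g w) =
      g w powr (a - 1) * f w powr (- a) * (if 0 \<le> g w \<and> g w \<le> c * f w then 1 else 0)" for w
    by (simp add: cut_powr_def indicator_def)
  show ?thesis unfolding eq by measurable
qed

text \<open>Here \<open>u q\<close> serves as the scale: every other distance is at most \<open>real q\<close> times it, and
  \<open>v q\<close> is comparable to it because the two sums agree. Collecting the powers of the scale gives
  twice the sum of all exponents minus \<open>2\<close>, that is \<open>2 * \<delta> * q\<^sup>2 - 2\<close>. The last factor is special:
  \<open>v 1\<close> is the eliminated entry, hence a function of the others, and its singularity is charged to the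
  variable \<open>v q\<close>, of which it is a reflection when \<open>v 1 + v q\<close> is held fixed.\<close>

lemma prod_clusters_le:
  assumes \<delta>: "0 < \<delta>" and q: "2 \<le> q"
    and pos: "\<And>j. 1 \<le> j \<Longrightarrow> j \<le> q \<Longrightarrow> 0 < u j \<and> u j \<le> u q \<and> 0 < v j \<and> v j \<le> v q"
    and uv: "(\<Sum>j=1..q. u j) = (\<Sum>j=1..q. v j)" and U1: "u q \<le> 1"
  shows "(\<Prod>j=1..q. u j powr (coord_exponent \<delta> j - 1)) * (\<Prod>j=1..q. v j powr (coord_exponent \<delta> j - 1)) \<le>
    real q powr \<bar>coord_exponent \<delta> q - 1\<bar> * real q powr \<delta>
      * (cut_powr (2 * \<delta> * (real q)\<^sup>2 - 1) 1 1 (u q)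
      * (\<Prod>j=1..<q. cut_powr (coord_exponent \<delta> j) 1 (u q) (u j))
      * (\<Prod>j=2..<q. cut_powr (coord_exponent \<delta> j) q (u q) (v j))
      * cut_powr \<delta> 1 (v 1 + v q) (v 1))"
proof -
  define U where "U = u q"
  have U: "0 < U" "U \<le> 1" using pos[of q] q U1 by (auto simp: U_def)
  have su: "(\<Sum>j=1..q. u j) \<le> real q * U"
    using sum_bounded_above[of "{1..q}" u U] pos by (simp add: U_def)
  have vle: "v j \<le> real q * U" if "1 \<le> j" "j \<le> q" for j
  proof -
    have "v j \<le> (\<Sum>j=1..q. v j)" using pos that by (intro member_le_sum) (auto simp: less_imp_le)
    then show ?thesis using su uv by simp
  qed
  have S: "v 1 + v q \<le> real q * U"
  proof -
    have "(\<Sum>j\<in>{1, q}. v j) \<le> (\<Sum>j=1..q. v j)" using pos q by (intro sum_mono2) (auto simp: less_imp_le)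
    then show ?thesis using su uv q by simp
  qed
  have vq: "U \<le> real q * v q"
  proof -
    have "U \<le> (\<Sum>j=1..q. u j)" using pos q unfolding U_def by (intro member_le_sum) (auto simp: less_imp_le)
    also have "\<dots> \<le> real q * v q" using sum_bounded_above[of "{1..q}" v "v q"] pos uv by simp
    finally show ?thesis .
  qed
  have vq_powr: "v q powr (coord_exponent \<delta> q - 1) \<le> real q powr \<bar>coord_exponent \<delta> q - 1\<bar> * U powr (coord_exponent \<delta> q - 1)"
  proof (cases "0 \<le> coord_exponent \<delta> q - 1")
    case True
    then have "v q powr (coord_exponent \<delta> q - 1) \<le> (real q * U) powr (coord_exponent \<delta> q - 1)"
      using vle[of q] pos[of q] q by (intro powr_mono2) auto
    then show ?thesis using True U by (simp add: powr_mult)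
  next
    case False
    then have "v q powr (coord_exponent \<delta> q - 1) \<le> (U / real q) powr (coord_exponent \<delta> q - 1)"
      using vq pos[of q] q U by (intro powr_mono2') (auto simp: field_simps)
    also have "\<dots> = real q powr - (coord_exponent \<delta> q - 1) * U powr (coord_exponent \<delta> q - 1)"
      unfolding powr_divide powr_minus by (simp add: divide_inverse mult.commute)
    finally show ?thesis using False by simp
  qed
  have S_powr: "(v 1 + v q) powr \<delta> \<le> real q powr \<delta> * U powr \<delta>"
    using powr_mono2[OF _ _ S, of \<delta>] \<delta> pos[of 1] pos[of q] q U by (simp add: powr_mult)
  have c1: "u j powr (coord_exponent \<delta> j - 1) = cut_powr (coord_exponent \<delta> j) 1 U (u j) * U powr coord_exponent \<delta> j" if "j \<in> {1..<q}" for j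
    using pos[of j] that U by (subst cut_powr_eq) (auto simp: U_def mult.assoc simp flip: powr_add)
  have c2: "v j powr (coord_exponent \<delta> j - 1) = cut_powr (coord_exponent \<delta> j) q U (v j) * U powr coord_exponent \<delta> j" if "j \<in> {2..<q}" for j
    using pos[of j] vle[of j] that U by (subst cut_powr_eq) (auto simp: mult.assoc simp flip: powr_add)
  have c3: "v 1 powr (\<delta> - 1) = cut_powr \<delta> 1 (v 1 + v q) (v 1) * (v 1 + v q) powr \<delta>"
    using pos[of 1] pos[of q] q by (subst cut_powr_eq) (auto simp: mult.assoc simp flip: powr_add)
  have c4: "U powr (2 * \<delta> * (real q)\<^sup>2 - 2) = cut_powr (2 * \<delta> * (real q)\<^sup>2 - 1) 1 1 U"
    using U by (subst cut_powr_eq) auto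
  let ?A = "\<Prod>j=1..<q. cut_powr (coord_exponent \<delta> j) 1 U (u j)" and ?B = "\<Prod>j=2..<q. cut_powr (coord_exponent \<delta> j) q U (v j)"
  let ?P1 = "\<Prod>j=1..<q. U powr coord_exponent \<delta> j" and ?P2 = "\<Prod>j=2..<q. U powr coord_exponent \<delta> j"
  let ?T = "cut_powr \<delta> 1 (v 1 + v q) (v 1)"
  have AB: "0 \<le> ?A" "0 \<le> ?B" "0 \<le> ?P1" "0 \<le> ?P2" by (auto intro!: prod_nonneg)
  have s1: "{1..q} = insert q {1..<q}" and s2: "{1..<q} = insert 1 {2..<q}" using q by auto
  have u: "(\<Prod>j=1..q. u j powr (coord_exponent \<delta> j - 1)) = U powr (coord_exponent \<delta> q - 1) * (?A * ?P1)"
    unfolding s1 using c1 by (simp add: U_def flip: prod.distrib)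
  have "(\<Prod>j=1..q. v j powr (coord_exponent \<delta> j - 1)) = v q powr (coord_exponent \<delta> q - 1) * (v 1 powr (\<delta> - 1) * (?B * ?P2))"
    unfolding s1 s2 using c2 q by (simp add: coord_exponent_def[of _ "Suc 0"] flip: prod.distrib)
  also have "\<dots> = v q powr (coord_exponent \<delta> q - 1) * ((v 1 + v q) powr \<delta> * (?T * (?B * ?P2)))"
    unfolding c3 by simp
  also have "\<dots> \<le> (real q powr \<bar>coord_exponent \<delta> q - 1\<bar> * U powr (coord_exponent \<delta> q - 1)) *
      ((real q powr \<delta> * U powr \<delta>) * (?T * (?B * ?P2)))"
    using vq_powr S_powr AB by (intro mult_mono mult_nonneg_nonneg order_refl) auto
  finally have v: "(\<Prod>j=1..q. v j powr (coord_exponent \<delta> j - 1)) \<le> (real q powr \<bar>coord_exponent \<delta> q - 1\<bar> * U powr (coord_exponent \<delta> q - 1)) *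
      ((real q powr \<delta> * U powr \<delta>) * (?T * (?B * ?P2)))" .
  have P12: "?P1 = U powr \<delta> * ?P2" unfolding s2 by (simp add: coord_exponent_def[of _ "Suc 0"])
  have "?P1 * U powr coord_exponent \<delta> q = (\<Prod>j=1..q. U powr coord_exponent \<delta> j)" unfolding s1 by simp
  also have "\<dots> = U powr (\<delta> * (real q)\<^sup>2)"
    unfolding sum_coord_exponent[symmetric] using U by (intro powr_sum[symmetric]) auto
  finally have P1: "?P1 * U powr coord_exponent \<delta> q = U powr (\<delta> * (real q)\<^sup>2)" .
  have m1: "U powr (coord_exponent \<delta> q - 1) = U powr coord_exponent \<delta> q * U powr (- 1)"
    by (simp only: powr_add[symmetric] diff_conv_add_uminus)
  have "(\<Prod>j=1..q. u j powr (coord_exponent \<delta> j - 1)) * (\<Prod>j=1..q. v j powr (coord_exponent \<delta> j - 1)) \<le>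
    (U powr (coord_exponent \<delta> q - 1) * (?A * ?P1)) * ((real q powr \<bar>coord_exponent \<delta> q - 1\<bar> * U powr (coord_exponent \<delta> q - 1)) *
      ((real q powr \<delta> * U powr \<delta>) * (?T * (?B * ?P2))))"
    unfolding u using AB by (intro mult_left_mono v mult_nonneg_nonneg) auto
  also have "\<dots> = real q powr \<bar>coord_exponent \<delta> q - 1\<bar> * real q powr \<delta> * (((?P1 * U powr coord_exponent \<delta> q) * (?P1 * U powr coord_exponent \<delta> q)
      * (U powr (- 1) * U powr (- 1))) * ?A * ?B * ?T)"
    unfolding m1 P12 by (simp only: mult_ac)
  also have "(?P1 * U powr coord_exponent \<delta> q) * (?P1 * U powr coord_exponent \<delta> q) * (U powr (- 1) * U powr (- 1)) = U powr (2 * \<delta> * (real q)\<^sup>2 - 2)"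
    unfolding P1 powr_add[symmetric] by (rule arg_cong[where f = "\<lambda>e. U powr e"]) simp
  finally show ?thesis unfolding c4 by (simp add: U_def)
qed

text \<open>The scale \<open>U = 1 - x q\<close> is integrated last, and its density \<open>U powr (2 * \<delta> * q\<^sup>2 - 2)\<close> is
  integrable at \<open>0\<close> exactly when \<open>\<beta> < 4 * q\<^sup>2\<close>. The entry \<open>q + 1\<close> is integrated first, because only
  its factor involves the eliminated entry.\<close>

lemma c_coeff_finite_k_2:
  assumes k: "k = 2" and q: "q \<ge> 1" and \<beta>: "2 \<le> \<beta>" "\<beta> < 4 * (real q)\<^sup>2"
  shows "c_coeff \<beta> k q < \<infinity>"
proof -
  define \<delta> where "\<delta> = 2 / \<beta>"
  have \<delta>: "0 < \<delta>" "\<delta> \<le> 1" using \<beta> by (auto simp: \<delta>_def)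
  have crit: "0 < 2 * \<delta> * (real q)\<^sup>2 - 1" using \<beta> by (simp add: \<delta>_def field_simps)
  have ex: "0 < coord_exponent \<delta> j" if "1 \<le> j" for j using that \<delta> by (auto simp: coord_exponent_def)
  define N where "N = k * q"
  have N: "N = 2 * q" "N \<ge> 1" using k q by (auto simp: N_def)
  have rows: "constrained_rows k q = {N}" using k N by (auto simp: constrained_rows_def)
  have len: "row_len k q N = N" by (simp add: row_len_simps N_def)
  define mid where "mid = {l. (N, l) \<in> free_coords k q}"
  have mid: "mid = {1..<N}"
  proof -
    have "eliminated k q = {(N, N)}" by (simp add: eliminated_def rows len)
    moreover have "(N, l) \<in> coords k q \<longleftrightarrow> l \<in> {1..N}" for l
    proof -
      have "2 * k * q - 1 = 2 * N - 1" by (simp add: N_def)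
      then have "N \<in> {1..2 * k * q - 1}" using N(2) by simp
      then show ?thesis by (simp add: coords_def len)
    qed
    ultimately have mem: "l \<in> mid \<longleftrightarrow> l \<in> {1..N} \<and> l \<noteq> N" for l
      by (simp add: mid_def free_coords_def)
    show ?thesis by (rule set_eqI) (simp only: mem atLeastAtMost_iff atLeastLessThan_iff less_le conj_assoc)
  qed
  define S where "S w = real q - (\<Sum>m\<in>{1..<N} - {q + 1}. w (N, m))" for w :: "nat \<times> nat \<Rightarrow> real"
  define U where "U w = 1 - w (N, q)" for w :: "nat \<times> nat \<Rightarrow> real"
  define h where "h l w =
    (if l = q then cut_powr (2 * \<delta> * (real q)\<^sup>2 - 1) 1 1 (U w)
     else if l < q then cut_powr (coord_exponent \<delta> l) 1 (U w) (1 - w (N, l))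
     else if l = q + 1 then cut_powr \<delta> 1 (S w) (S w - w (N, l))
     else cut_powr (coord_exponent \<delta> (N + 1 - l)) (real q) (U w) (w (N, l)))" for l w
  \<comment> \<open>The entry \<open>q + 1\<close> comes first and the scale, entry \<open>q\<close>, last.\<close>
  define mrank where "mrank l = (if l = q then N + 2 else if l = q + 1 then N else N + 1)" for l
  define B where "B l =
    (if l = q then ennreal (1 powr (2 * \<delta> * (real q)\<^sup>2 - 1) / (2 * \<delta> * (real q)\<^sup>2 - 1))
     else if l < q then ennreal (1 powr coord_exponent \<delta> l / coord_exponent \<delta> l)
     else if l = q + 1 then ennreal (1 powr \<delta> / \<delta>)
     else ennreal (real q powr coord_exponent \<delta> (N + 1 - l) / coord_exponent \<delta> (N + 1 - l)))" for l
  define C where "C = (real (q + 1) powr (1 - \<delta>)) ^ (2 * q) * (real q powr \<bar>coord_exponent \<delta> q - 1\<bar> * real q powr \<delta>)"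
  have cut: "(\<integral>\<^sup>+ t. ennreal (cut_powr a c b (z - t)) \<partial>lborel) \<le> ennreal (c powr a / a)"
    "(\<integral>\<^sup>+ t. ennreal (cut_powr a c b t) \<partial>lborel) \<le> ennreal (c powr a / a)"
    if "0 < a" "0 \<le> c" for a b c z
  proof -
    show *: "(\<integral>\<^sup>+ t. ennreal (cut_powr a c b t) \<partial>lborel) \<le> ennreal (c powr a / a)"
      using nn_integral_scaled_powr_le[OF that, of b] by (simp add: cut_powr_def)
    have "(\<integral>\<^sup>+ t. ennreal (cut_powr a c b (z - t)) \<partial>lborel) = (\<integral>\<^sup>+ t. ennreal (cut_powr a c b t) \<partial>lborel)"
      by (rule nn_integral_reflect[of "\<lambda>t. ennreal (cut_powr a c b t)"]) (simp add: cut_powr_def)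
    then show "(\<integral>\<^sup>+ t. ennreal (cut_powr a c b (z - t)) \<partial>lborel) \<le> ennreal (c powr a / a)"
      using * by simp
  qed
  show ?thesis
  proof (rule c_coeff_finite_from_middle_row[where C = C and mrank = mrank and B = B
        and H = "\<lambda>l w. ennreal (h l w)"],
      unfold \<delta>_def[symmetric] N_def[symmetric], unfold mid_def[symmetric])
    fix l assume l: "l \<in> mid"
    have wm: "(\<lambda>w. w (N, m)) \<in> borel_measurable (\<Pi>\<^sub>M p\<in>free_coords k q. lborel)"
      if "m \<in> mid" for m
      using measurable_component_singleton[of "(N, m)" "free_coords k q" "\<lambda>_. lborel :: real measure"] that
      by (simp add: mid_def)
    have "q \<in> mid" using mid N q by auto
    note wq = wm[OF this]
    have U_meas: "U \<in> borel_measurable (\<Pi>\<^sub>M p\<in>free_coords k q. lborel)"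
      unfolding U_def[abs_def] by (intro borel_measurable_diff borel_measurable_const wq)
    have S_meas: "S \<in> borel_measurable (\<Pi>\<^sub>M p\<in>free_coords k q. lborel)"
      unfolding S_def[abs_def] using mid
      by (intro borel_measurable_diff borel_measurable_const borel_measurable_sum wm) auto
    show "(\<lambda>w. ennreal (h l w)) \<in> borel_measurable (\<Pi>\<^sub>M p\<in>free_coords k q. lborel)"
      unfolding h_def using wm[OF l]
      by (cases "l = q"; cases "l < q"; cases "l = q + 1")
        (auto intro!: measurable_cut_powr U_meas S_meas borel_measurable_diff borel_measurable_const)
    show "N \<le> mrank l" by (simp add: mrank_def)
    show "B l < \<infinity>" by (simp add: B_def)
    show "ennreal (h l (w((r, m) := t))) = ennreal (h l w)" if "r \<noteq> N" for r m w t
      using that by (simp add: h_def U_def S_def)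
    show "ennreal (h l (w((N, l') := t))) = ennreal (h l w)"
      if "l' \<in> mid" "l' \<noteq> l" "mrank l' \<le> mrank l" for l' w t
      using that by (auto simp: h_def U_def S_def mrank_def split: if_splits)
    show "(\<integral>\<^sup>+ t. ennreal (h l (w((N, l) := t))) \<partial>lborel) \<le> B l" for w
    proof -
      consider "l = q" | "l < q" | "l = q + 1" | "l > q + 1" by linarith
      then show ?thesis
      proof cases
        case 1
        then show ?thesis using cut(1)[OF crit, of 1 1 1] by (simp add: h_def B_def U_def)
      next
        case 2
        then show ?thesis using cut(1)[OF ex[of l], of 1 "U w" 1] l mid by (simp add: h_def B_def U_def)
      next
        case 3
        have "S (w((N, l) := t)) = S w" for t
          unfolding S_def using 3 by (intro arg_cong2[where f = "(-)"] sum.cong) auto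
        then show ?thesis using cut(1)[OF \<delta>(1), of 1 "S w" "S w"] 3 by (simp add: h_def B_def)
      next
        case 4
        then show ?thesis using cut(2)[OF ex[of "N + 1 - l"], of "real q" "U w"] l mid
          by (simp add: h_def B_def U_def)
      qed
    qed
  next
    fix w assume X: "fill_in k q w \<in> I_c k q"
    let ?x = "xrow (fill_in k q w) N"
    have W: "W_plus (2 * q) ?x" using X N by (auto simp: I_c_def N_def[symmetric])
    have b: "0 \<le> ?x l \<and> ?x l \<le> 1" if "1 \<le> l" "l \<le> 2 * q" for l
      using I_c_bounds(1)[OF X, of l N] that N N_def by auto
    have xw: "?x l = w (N, l)" if "l \<in> {1..<N}" for l
      using that mid fill_in_free[of "(N, l)" k q w] unfolding mid_def xrow_def by blast
    have "(\<Sum>i=1..2 * 1 * q. xrow (fill_in k q w) (2 * 1 * q) i) = real (1 * q)"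
      using X k unfolding I_c_def by (simp del: mult_1 mult_1_right)
    then have s: "(\<Sum>j=1..2 * q. ?x j) = real q" using N by simp
    have h0: "0 \<le> h l w" for l by (simp add: h_def)
    have prod_h: "(\<Prod>l\<in>mid. ennreal (h l w)) = ennreal (\<Prod>l=1..<2 * q. h l w)"
      using h0 mid N by (simp add: prod_ennreal)
    have "vandermonde (2 * q) ?x powr (2 * \<delta>) * edge_weight (2 * q) (\<delta> - 1) ?x \<le> C * (\<Prod>l=1..<2 * q. h l w)"
    proof (cases "\<exists>j\<in>{1..2 * q}. ?x j = 0 \<or> ?x j = 1")
      case True
      then have "edge_weight (2 * q) (\<delta> - 1) ?x = 0" unfolding edge_weight_def by auto
      moreover have "0 \<le> C * (\<Prod>l=1..<2 * q. h l w)" unfolding C_def using h0 by (intro mult_nonneg_nonneg prod_nonneg) auto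
      ultimately show ?thesis by simp
    next
      case False
      then have b': "0 < ?x j \<and> ?x j < 1" if "1 \<le> j" "j \<le> 2 * q" for j
        using b[OF that] that by (auto simp: less_le)
      define u where "u j = 1 - ?x j" for j
      define v where "v j = ?x (2 * q + 1 - j)" for j
      note row = middle_row_le[OF \<delta> W q b' s, folded u_def v_def]
      have pos: "0 < u j \<and> u j \<le> u q \<and> 0 < v j \<and> v j \<le> v q" if "1 \<le> j" "j \<le> q" for j
        using b'[of j] b'[of "2 * q + 1 - j"] W_plus_antimono[OF W, of j q]
          W_plus_antimono[OF W, of "2 * q + 1 - q" "2 * q + 1 - j"] that by (auto simp: u_def v_def)
      have uw: "u j = 1 - w (N, j)" if "1 \<le> j" "j \<le> q" for j using xw[of j] that N q by (auto simp: u_def)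
      have Uq: "U w = u q" using uw q by (simp add: U_def)
      have U1: "u q \<le> 1" using b'[of q] q by (simp add: u_def)
      have "(\<Prod>j=1..q. u j powr (coord_exponent \<delta> j - 1)) * (\<Prod>j=1..q. v j powr (coord_exponent \<delta> j - 1)) \<le>
        real q powr \<bar>coord_exponent \<delta> q - 1\<bar> * real q powr \<delta> * (\<Prod>l=1..<2 * q. h l w)"
      proof (cases "q = 1")
        case q1: True
        have "u 1 = v 1" using row(2) q1 by simp
        moreover have "{1..<2 * q} = {1}" using q1 by auto
        moreover have "h 1 w = u 1 powr (2 * \<delta> - 2)"
          using q1 Uq U1 pos[of 1] by (simp add: h_def cut_powr_eq)
        ultimately show ?thesis using q1 by (simp add: coord_exponent_def flip: powr_add)
      next
        case False
        then have q2: "2 \<le> q" using q by simp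
        have vw: "v j = w (N, 2 * q + 1 - j)" if "2 \<le> j" "j \<le> q" for j
        proof -
          have "2 * q + 1 - j \<in> {1..<N}" using that N by auto
          from xw[OF this] show ?thesis by (simp add: v_def)
        qed
        have x1: "v 1 = ?x N" "v q = ?x (q + 1)" using N by (auto simp: v_def)
        have "(\<Sum>j=1..2 * q. ?x j) = ?x (q + 1) + ?x N + (\<Sum>j\<in>{1..<N} - {q + 1}. ?x j)"
        proof -
          have "{1..2 * q} = insert (q + 1) (insert N ({1..<N} - {q + 1}))" using N q2 by auto
          then show ?thesis using N q2 by simp
        qed
        also have "(\<Sum>j\<in>{1..<N} - {q + 1}. ?x j) = (\<Sum>j\<in>{1..<N} - {q + 1}. w (N, j))"
          using xw by (intro sum.cong) auto
        finally have Sw: "S w = v 1 + v q" using s x1 by (simp add: S_def)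
        have set: "{1..<2 * q} = {1..<q} \<union> {q, q + 1} \<union> {q + 2..<2 * q}" using q2 by auto
        have "(\<Prod>l=1..<2 * q. h l w) = (\<Prod>l=1..<q. h l w) * (h q w * h (q + 1) w) * (\<Prod>l=q+2..<2 * q. h l w)"
          unfolding set by (subst prod.union_disjoint; (subst prod.union_disjoint)?) auto
        also have "(\<Prod>l=q+2..<2 * q. h l w) = (\<Prod>j=2..<q. h (2 * q + 1 - j) w)"
          by (rule prod.reindex_bij_witness[of _ "\<lambda>j. 2 * q + 1 - j" "\<lambda>j. 2 * q + 1 - j"]) auto
        also have "\<dots> = (\<Prod>j=2..<q. cut_powr (coord_exponent \<delta> j) q (u q) (v j))"
          using N Uq vw by (intro prod.cong) (auto simp: h_def)
        also have "(\<Prod>l=1..<q. h l w) = (\<Prod>j=1..<q. cut_powr (coord_exponent \<delta> j) 1 (u q) (u j))"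
          using Uq uw by (intro prod.cong) (auto simp: h_def)
        also have "h q w = cut_powr (2 * \<delta> * (real q)\<^sup>2 - 1) 1 1 (u q)" by (simp add: h_def Uq)
        also have "h (q + 1) w = cut_powr \<delta> 1 (v 1 + v q) (v 1)"
          using vw[of q] q2 by (simp add: h_def Sw)
        finally show ?thesis
          using prod_clusters_le[OF \<delta>(1) q2 pos row(2) U1] by (simp only: mult_ac)
      qed
      then have A: "(real (q + 1) powr (1 - \<delta>)) ^ (2 * q)
        * ((\<Prod>j=1..q. u j powr (coord_exponent \<delta> j - 1)) * (\<Prod>j=1..q. v j powr (coord_exponent \<delta> j - 1))) \<le>
        (real (q + 1) powr (1 - \<delta>)) ^ (2 * q) * (real q powr \<bar>coord_exponent \<delta> q - 1\<bar> * real q powr \<delta> * (\<Prod>l=1..<2 * q. h l w))"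
        by (intro mult_left_mono) auto
      show ?thesis
        unfolding C_def using order_trans[OF row(1)[unfolded mult.assoc] A] by (simp only: mult.assoc)
    qed
    then show "ennreal (vandermonde N ?x powr (2 * \<delta>) * edge_weight N (\<delta> - 1) ?x) \<le> ennreal C * (\<Prod>l\<in>mid. ennreal (h l w))"
      unfolding prod_h using h0 N by (simp add: C_def prod_nonneg ennreal_leI flip: ennreal_mult)
  qed (use N \<beta> rows in auto)
qed

section \<open>Configurations pinned to the endpoints\<close>

text \<open>The number of entries of row \<open>m\<close> that are put near \<open>1\<close>, equal to the number put near \<open>0\<close>. On the
  constrained rows, of length \<open>2 * j * q\<close>, it is half the length, so that all entries can be
  near the endpoints without violating the sum constraint. Between them it stays at \<open>j * q\<close> for \<open>q\<close> rows and then grows by one in each row,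
  which is as late as interlacing permits. The recursion encodes this staircase.\<close>

fun pin_count :: "nat \<Rightarrow> nat \<Rightarrow> nat" where
  "pin_count q m = (if q = 0 \<or> m < q then 0 else (m - q) - pin_count q (m - q))"

declare pin_count.simps [simp del]

lemma pin_count_less: "m < q \<Longrightarrow> pin_count q m = 0"
  by (simp add: pin_count.simps)

lemma pin_count_le: "pin_count q m \<le> m"
  by (subst pin_count.simps) auto

lemma pin_count_add: "1 \<le> q \<Longrightarrow> pin_count q (m + q) + pin_count q m = m"
  by (subst pin_count.simps) (simp add: pin_count_le)

lemma pin_count_step: "1 \<le> q \<Longrightarrow> pin_count q m \<le> pin_count q (Suc m) \<and> pin_count q (Suc m) \<le> Suc (pin_count q m)"
proof (induction m rule: less_induct)
  case (less m)
  show ?case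
  proof (cases "m < q")
    case True
    then have "pin_count q m = 0" by (rule pin_count_less)
    moreover have "pin_count q (Suc m) = 0"
      using pin_count_less[of "Suc m" q] pin_count_add[of q 0] less.prems True by (cases "Suc m = q") auto
    ultimately show ?thesis by simp
  next
    case False
    then obtain n where n: "m = n + q" by (metis add.commute le_Suc_ex not_less)
    then have "n < m" using less.prems by simp
    from less.IH[OF this less.prems] show ?thesis
      using pin_count_add[of q n] pin_count_add[of q "Suc n"] less.prems n by auto
  qed
qed

lemma pin_count_mono: "1 \<le> q \<Longrightarrow> m \<le> n \<Longrightarrow> pin_count q m \<le> pin_count q n"
  by (rule lift_Suc_mono_le[of "pin_count q"]) (simp_all add: pin_count_step)

lemma pin_count_double: "1 \<le> q \<Longrightarrow> 2 * pin_count q m \<le> m"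
  using pin_count_add[of q m] pin_count_mono[of q m "m + q"] by simp

lemma pin_count_even: "1 \<le> q \<Longrightarrow> pin_count q (2 * j * q) = j * q"
proof (induction j)
  case 0
  then show ?case by (simp add: pin_count_less)
next
  case (Suc j)
  have "pin_count q (2 * j * q + q) + j * q = 2 * j * q" using pin_count_add[of q "2 * j * q"] Suc by simp
  moreover have "pin_count q (2 * j * q + q + q) + pin_count q (2 * j * q + q) = 2 * j * q + q"
    using Suc.prems by (rule pin_count_add)
  moreover have "2 * Suc j * q = 2 * j * q + q + q" by simp
  ultimately show ?case by simp
qed

text \<open>Shifting by \<open>q\<close> turns the sum into its complement in a triangular number, which gives a
  recursion for the total count of both halves.\<close>

lemma pin_count_total:
  assumes q: "1 \<le> q"
  shows "2 * (2 * (\<Sum>m<k * q. pin_count q m) + pin_count q (k * q)) = k * (k - 1) * q\<^sup>2"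
proof -
  define T where "T k = 2 * (\<Sum>m<k * q. pin_count q m) + pin_count q (k * q)" for k
  have combine: "a + b = c \<Longrightarrow> 2 * x + a + (2 * y + b) = 2 * (x + y) + c" for a b c x y :: nat
    by simp
  have step: "T (Suc k) + T k = k\<^sup>2 * q\<^sup>2" for k
  proof -
    have gauss: "2 * (\<Sum>m<n. m) + n = n * n" for n :: nat by (induction n) auto
    have "(\<Sum>m<Suc k * q. pin_count q m) = (\<Sum>m<q. pin_count q m) + (\<Sum>m=q..<k * q + q. pin_count q m)"
      by (simp add: lessThan_atLeast0 sum.atLeastLessThan_concat add.commute)
    also have "(\<Sum>m<q. pin_count q m) = 0" by (simp add: pin_count_less)
    also have "(\<Sum>m=q..<k * q + q. pin_count q m) = (\<Sum>m<k * q. pin_count q (m + q))"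
      using sum.shift_bounds_nat_ivl[of "pin_count q" 0 q "k * q"] by (simp add: lessThan_atLeast0)
    finally have "(\<Sum>m<Suc k * q. pin_count q m) + (\<Sum>m<k * q. pin_count q m) = (\<Sum>m<k * q. pin_count q (m + q) + pin_count q m)"
      by (simp add: sum.distrib)
    also have "\<dots> = (\<Sum>m<k * q. m)" using pin_count_add[OF q] by simp
    finally have F: "(\<Sum>m<Suc k * q. pin_count q m) + (\<Sum>m<k * q. pin_count q m) = (\<Sum>m<k * q. m)" .
    have "pin_count q (Suc k * q) + pin_count q (k * q) = k * q" using pin_count_add[OF q, of "k * q"] by (simp add: add.commute)
    then have "T (Suc k) + T k = 2 * ((\<Sum>m<Suc k * q. pin_count q m) + (\<Sum>m<k * q. pin_count q m)) + k * q"
      unfolding T_def by (rule combine)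
    also have "\<dots> = k * q * (k * q)" unfolding F by (rule gauss)
    finally show ?thesis by (simp add: power2_eq_square mult_ac)
  qed
  have "2 * T k = k * (k - 1) * q\<^sup>2"
  proof (induction k)
    case 0
    then show ?case using q by (simp add: T_def pin_count_less)
  next
    case (Suc k)
    have "2 * T (Suc k) + k * (k - 1) * q\<^sup>2 = 2 * (k\<^sup>2 * q\<^sup>2)" using step[of k] Suc by simp
    moreover have "Suc k * (Suc k - 1) * q\<^sup>2 + k * (k - 1) * q\<^sup>2 = 2 * (k\<^sup>2 * q\<^sup>2)"
      by (cases k) (simp_all add: power2_eq_square algebra_simps)
    ultimately show ?case by linarith
  qed
  then show ?thesis by (simp add: T_def)
qed

text \<open>\<open>2\<close> near \<open>1\<close>, \<open>1\<close> in the bulk, \<open>0\<close> near \<open>0\<close>. The code increases with the value, so that order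
  relations between entries split into the code and the height.\<close>

definition cluster :: "nat \<Rightarrow> nat \<Rightarrow> nat \<Rightarrow> nat" where
  "cluster q M l = (if l \<le> pin_count q M then 2 else if l \<le> M - pin_count q M then 1 else 0)"

lemma cluster_interlaces:
  assumes "1 \<le> q"
  shows "cluster q M l \<le> cluster q (Suc M) l" "cluster q (Suc M) (Suc l) \<le> cluster q M l"
  using pin_count_step[OF assms, of M] pin_count_le[of q M] by (auto simp: cluster_def)

lemma cluster_antimono: "1 \<le> q \<Longrightarrow> l \<le> l' \<Longrightarrow> cluster q M l' \<le> cluster q M l"
  using pin_count_double[of q M] by (auto simp: cluster_def)

lemma cluster_cases:
  obtains "cluster q M l = 0" | "cluster q M l = 1" | "cluster q M l = 2"
proof -
  have "cluster q M l = 0 \<or> cluster q M l = 1 \<or> cluster q M l = 2" by (simp add: cluster_def)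
  then show thesis using that by blast
qed

text \<open>Within a cluster the entry \<open>l\<close> of row \<open>M\<close> is placed linearly at height \<open>s = M + 1 - 2 * l\<close>.
  Neighbours in adjacent rows then differ by one unit of height, which gives strict interlacing with room to
  spare, and the reflection \<open>l \<mapsto> M + 1 - l\<close> maps \<open>s\<close> to \<open>- s\<close>, which gives the row sum \<open>M / 2\<close>. The two
  extreme clusters live at scale \<open>e\<close>.\<close>

definition center :: "nat \<Rightarrow> real \<Rightarrow> real \<Rightarrow> nat \<Rightarrow> nat \<Rightarrow> real" where
  "center q \<kappa> e M l =
     (let s = real M + 1 - 2 * real l in
      if cluster q M l = 2 then 1 - e / 2 + e * \<kappa> * s / 2
      else if cluster q M l = 1 then 1 / 2 + \<kappa> * s / 4
      else e / 2 + e * \<kappa> * s / 2)"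

lemma center_sum:
  assumes "1 \<le> q"
  shows "(\<Sum>l=1..M. center q \<kappa> e M l) = real M / 2"
proof -
  have "center q \<kappa> e M l + center q \<kappa> e M (M + 1 - l) = 1" if "l \<in> {1..M}" for l
  proof -
    have l: "real (M + 1 - l) = real M + 1 - real l" using that by (auto simp: of_nat_diff)
    have c: "cluster q M (M + 1 - l) = 2 - cluster q M l"
      using that pin_count_double[OF assms, of M] by (auto simp: cluster_def)
    show ?thesis unfolding center_def c l Let_def
      by (cases rule: cluster_cases[of q M l]) (simp_all add: field_simps)
  qed
  then have "(\<Sum>l=1..M. center q \<kappa> e M l + center q \<kappa> e M (M + 1 - l)) = real M"
    by (subst sum.cong[OF refl, of _ _ "\<lambda>_. 1"]) auto
  moreover have "(\<Sum>l=1..M. center q \<kappa> e M (M + 1 - l)) = (\<Sum>l=1..M. center q \<kappa> e M l)"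
    by (rule sum.reindex_bij_witness[of _ "\<lambda>l. M + 1 - l" "\<lambda>l. M + 1 - l"]) auto
  ultimately show ?thesis by (simp add: sum.distrib)
qed

definition scale_of :: "nat \<Rightarrow> real \<Rightarrow> nat \<Rightarrow> nat \<Rightarrow> real" where
  "scale_of q e M l = (if cluster q M l = 1 then 1 else e)"

text \<open>The choice of \<open>\<kappa>\<close> keeps \<open>\<kappa>\<close> times the height below \<open>1\<close> in absolute value, so that the clusters stay apart.
  Centers one unit of height apart differ by \<open>e * \<kappa> / 2\<close> in the extreme clusters and by \<open>\<kappa> / 4\<close> in the bulk, and
  an error below \<open>\<kappa> / 8\<close> at the respective scale preserves their order.\<close>

locale pinned_config =
  fixes k q :: nat and e \<kappa> :: real and X :: "nat \<times> nat \<Rightarrow> real"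
  assumes q: "1 \<le> q" and k: "1 \<le> k" and e: "0 < e" "e \<le> 1 / 16" and kap: "\<kappa> = 1 / (real (k * q) + 1)"
    and near: "\<And>r l. (r, l) \<in> coords k q \<Longrightarrow>
      \<bar>X (r, l) - center q \<kappa> e (row_len k q r) l\<bar> < \<kappa> / 8 * scale_of q e (row_len k q r) l"
begin

lemma kap_bounds: "0 < \<kappa>" "\<kappa> \<le> 1 / 2"
proof -
  have "1 \<le> k * q" using k q by (simp add: Suc_leI)
  then have "1 \<le> real (k * q)" by (metis of_nat_1 of_nat_le_iff)
  then show "0 < \<kappa>" "\<kappa> \<le> 1 / 2" unfolding kap by (auto simp: field_simps)
qed

lemma coordsD:
  assumes "(r, l) \<in> coords k q"
  shows "1 \<le> l" "l \<le> row_len k q r" "row_len k q r \<le> k * q"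
  using assms by (auto simp: coords_def row_len_def)

lemma slope:
  assumes "(r, l) \<in> coords k q"
  shows "\<bar>\<kappa> * (real (row_len k q r) + 1 - 2 * real l)\<bar> \<le> 1 - 2 * \<kappa>"
proof -
  have "\<bar>real (row_len k q r) + 1 - 2 * real l\<bar> \<le> real (k * q) - 1"
  proof -
    have "1 \<le> real l" "real l \<le> real (row_len k q r)" "real (row_len k q r) \<le> real (k * q)"
      using coordsD(1,2)[OF assms] coordsD(3)[OF assms, THEN of_nat_mono] by simp_all
    then show ?thesis unfolding abs_le_iff by linarith
  qed
  then have "\<kappa> * \<bar>real (row_len k q r) + 1 - 2 * real l\<bar> \<le> \<kappa> * (real (k * q) - 1)"
    using kap_bounds by (intro mult_left_mono) auto
  also have "\<dots> = 1 - 2 * \<kappa>"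
  proof -
    have "\<kappa> * (real (k * q) + 1) = 1" unfolding kap by (simp add: add_nonneg_eq_0_iff)
    then show ?thesis by (simp add: algebra_simps)
  qed
  finally show ?thesis using kap_bounds by (simp add: abs_mult)
qed

lemma cluster_bounds:
  assumes p: "(r, l) \<in> coords k q"
  shows "cluster q (row_len k q r) l = 2 \<Longrightarrow> 1 - e < X (r, l) \<and> X (r, l) < 1 - e * \<kappa> / 2"
    and "cluster q (row_len k q r) l = 1 \<Longrightarrow> 1 / 8 < X (r, l) \<and> X (r, l) < 7 / 8"
    and "cluster q (row_len k q r) l = 0 \<Longrightarrow> 0 < X (r, l) \<and> X (r, l) < e"
proof -
  let ?M = "row_len k q r"
  define s where "s = real ?M + 1 - 2 * real l"
  have sl: "\<bar>\<kappa> * s\<bar> \<le> 1 - 2 * \<kappa>" using slope[OF p] by (simp add: s_def)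
  have "e * (\<kappa> * s) \<le> e * (1 - 2 * \<kappa>)" "e * (- (\<kappa> * s)) \<le> e * (1 - 2 * \<kappa>)"
    using sl e by (intro mult_left_mono; simp add: abs_le_iff)+
  then have esl: "e * \<kappa> * s \<le> e - 2 * (e * \<kappa>)" "- (e * \<kappa> * s) \<le> e - 2 * (e * \<kappa>)"
    by (simp_all add: algebra_simps)
  have ek: "0 < e * \<kappa>" using e kap_bounds by simp
  note n = near[OF p]
  have pd: "2 * pin_count q ?M \<le> ?M" using pin_count_double q by blast
  note ld = coordsD[OF p]
  {
    assume c: "cluster q ?M l = 2"
    then have "l \<le> pin_count q ?M" by (auto simp: cluster_def split: if_splits)
    then have "2 * l \<le> ?M" using pd by simp
    then have "2 * real l \<le> real ?M" by linarith
    then have s1: "1 \<le> s" by (simp add: s_def)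
    have "e * \<kappa> * 1 \<le> e * \<kappa> * s" using s1 ek by (intro mult_left_mono) auto
    moreover have "\<bar>X (r, l) - (1 - e / 2 + e * \<kappa> * s / 2)\<bar> < e * \<kappa> / 8"
      using n c by (simp add: center_def scale_of_def s_def mult_ac)
    ultimately show "1 - e < X (r, l) \<and> X (r, l) < 1 - e * \<kappa> / 2"
      using esl ek e unfolding abs_less_iff by (intro conjI; linarith)
  next
    assume c: "cluster q ?M l = 1"
    then have "\<bar>X (r, l) - (1 / 2 + \<kappa> * s / 4)\<bar> < \<kappa> / 8"
      using n c by (simp add: center_def scale_of_def s_def)
    then show "1 / 8 < X (r, l) \<and> X (r, l) < 7 / 8"
      using sl kap_bounds unfolding abs_less_iff abs_le_iff by (intro conjI; linarith)
  next
    assume c: "cluster q ?M l = 0"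
    then have "?M - pin_count q ?M < l" by (auto simp: cluster_def split: if_splits)
    then have "?M + 2 \<le> 2 * l" using pd by simp
    then have "real ?M + 2 \<le> 2 * real l" by linarith
    then have s1: "s \<le> - 1" by (simp add: s_def)
    have "e * \<kappa> * s \<le> e * \<kappa> * - 1" using s1 ek by (intro mult_left_mono) auto
    moreover have "\<bar>X (r, l) - (e / 2 + e * \<kappa> * s / 2)\<bar> < e * \<kappa> / 8"
      using n c by (simp add: center_def scale_of_def s_def mult_ac)
    ultimately show "0 < X (r, l) \<and> X (r, l) < e"
      using esl ek e unfolding abs_less_iff by (intro conjI; linarith)
  }
qed

lemma in_unit:
  assumes "(r, l) \<in> coords k q"
  shows "0 < X (r, l)" "X (r, l) < 1"
proof -
  have ek: "0 < e * \<kappa>" using e kap_bounds by simp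
  have "0 < X (r, l) \<and> X (r, l) < 1"
  proof (cases rule: cluster_cases[of q "row_len k q r" l])
    case 1
    then show ?thesis using cluster_bounds(3)[OF assms] e by linarith
  next
    case 2
    then show ?thesis using cluster_bounds(2)[OF assms] by linarith
  next
    case 3
    then show ?thesis using cluster_bounds(1)[OF assms] e ek by linarith
  qed
  then show "0 < X (r, l)" "X (r, l) < 1" by auto
qed

text \<open>Entries in the same cluster are ordered by height, entries in different clusters by cluster.\<close>

lemma strict_order:
  assumes p: "(r, l) \<in> coords k q" and p': "(r', l') \<in> coords k q"
    and c: "cluster q (row_len k q r') l' \<le> cluster q (row_len k q r) l"
    and s: "row_len k q r' + 2 * l + 1 \<le> row_len k q r + 2 * l'"
  shows "X (r', l') < X (r, l)"
proof -
  let ?c = "cluster q (row_len k q r) l" and ?c' = "cluster q (row_len k q r') l'"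
  define s where "s = real (row_len k q r) + 1 - 2 * real l"
  define s' where "s' = real (row_len k q r') + 1 - 2 * real l'"
  have ss: "1 \<le> s - s'" using assms(4) unfolding s_def s'_def by linarith
  have ek: "0 < e * \<kappa>" using e kap_bounds by simp
  have "\<kappa> * 1 \<le> \<kappa> * (s - s')" using ss kap_bounds by (intro mult_left_mono) auto
  then have d1: "\<kappa> \<le> \<kappa> * s - \<kappa> * s'" by (simp add: right_diff_distrib)
  have "e * \<kappa> * 1 \<le> e * \<kappa> * (s - s')" using ss ek by (intro mult_left_mono) auto
  then have d2: "e * \<kappa> \<le> e * \<kappa> * s - e * \<kappa> * s'" by (simp add: right_diff_distrib)
  note n = near[OF p] near[OF p']
  show ?thesis
  proof (cases "?c = ?c'")
    case True
    show ?thesis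
    proof (cases rule: cluster_cases[of q "row_len k q r" l])
      case 1
      then have "\<bar>X (r, l) - (e / 2 + e * \<kappa> * s / 2)\<bar> < e * \<kappa> / 8"
        "\<bar>X (r', l') - (e / 2 + e * \<kappa> * s' / 2)\<bar> < e * \<kappa> / 8"
        using n True by (simp_all add: center_def scale_of_def s_def s'_def mult_ac)
      then show ?thesis using d2 ek unfolding abs_less_iff by linarith
    next
      case 2
      then have "\<bar>X (r, l) - (1 / 2 + \<kappa> * s / 4)\<bar> < \<kappa> / 8"
        "\<bar>X (r', l') - (1 / 2 + \<kappa> * s' / 4)\<bar> < \<kappa> / 8"
        using n True by (simp_all add: center_def scale_of_def s_def s'_def)
      then show ?thesis using d1 unfolding abs_less_iff by linarith
    next
      case 3
      then have "\<bar>X (r, l) - (1 - e / 2 + e * \<kappa> * s / 2)\<bar> < e * \<kappa> / 8"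
        "\<bar>X (r', l') - (1 - e / 2 + e * \<kappa> * s' / 2)\<bar> < e * \<kappa> / 8"
        using n True by (simp_all add: center_def scale_of_def s_def s'_def mult_ac)
      then show ?thesis using d2 ek unfolding abs_less_iff by linarith
    qed
  next
    case False
    then show ?thesis
      using c cluster_bounds[OF p] cluster_bounds[OF p'] e
      by (cases rule: cluster_cases[of q "row_len k q r" l]; cases rule: cluster_cases[of q "row_len k q r'" l'])
        (auto simp: less_imp_le; linarith)+
  qed
qed

lemma consecutive_rows:
  assumes len: "row_len k q r' = Suc (row_len k q r)"
    and mem: "\<And>l. l \<in> {1..row_len k q r} \<Longrightarrow> (r, l) \<in> coords k q"
      "\<And>l. l \<in> {1..row_len k q r'} \<Longrightarrow> (r', l) \<in> coords k q"
    and l: "l \<in> {1..row_len k q r}"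
  shows "X (r, l) < X (r', l)" "X (r', Suc l) < X (r, l)"
  using strict_order[of r' l r l] strict_order[of r l r' "Suc l"] mem[of l] mem(2)[of "Suc l"] len l
    cluster_interlaces[OF q, of "row_len k q r" l] by auto

lemma row_W_plus:
  assumes mem: "\<And>l. l \<in> {1..row_len k q r} \<Longrightarrow> (r, l) \<in> coords k q"
  shows "W_plus (row_len k q r) (\<lambda>l. X (r, l))"
  unfolding W_plus_def
proof (intro conjI ballI)
  fix l assume "l \<in> {1..<row_len k q r}"
  then show "X (r, l + 1) \<le> X (r, l)"
    using strict_order[of r l r "l + 1"] mem[of l] mem[of "l + 1"] cluster_antimono[OF q, of l "l + 1"] by (auto simp: less_imp_le)
next
  fix l assume "l \<in> {1..row_len k q r}"
  then show "0 \<le> X (r, l)" using in_unit(1)[of r l] mem by (simp add: less_imp_le)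
qed

lemma consecutive_rows_interlace:
  assumes len: "row_len k q r' = Suc (row_len k q r)"
    and mem: "\<And>l. l \<in> {1..row_len k q r} \<Longrightarrow> (r, l) \<in> coords k q"
      "\<And>l. l \<in> {1..row_len k q r'} \<Longrightarrow> (r', l) \<in> coords k q"
  shows "interlaces (row_len k q r) (\<lambda>l. X (r, l)) (\<lambda>l. X (r', l))"
  using row_W_plus[OF mem(1)] row_W_plus[OF mem(2)] consecutive_rows[OF len mem] len
  unfolding interlaces_def by (auto simp: less_imp_le)

text \<open>The counts of adjacent rows differ by at most one, which is what \<open>phi_ge\<close> requires.\<close>

lemma phi_ge_rows:
  assumes \<delta>: "0 < \<delta>" "\<delta> \<le> 1"
    and len: "row_len k q r' = Suc (row_len k q r)" "1 \<le> row_len k q r"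
    and mem: "\<And>l. l \<in> {1..row_len k q r} \<Longrightarrow> (r, l) \<in> coords k q"
      "\<And>l. l \<in> {1..row_len k q r'} \<Longrightarrow> (r', l) \<in> coords k q"
  shows "1 / Gamma \<delta> ^ row_len k q r * ((16 * e) powr (\<delta> - 1)) ^ (2 * pin_count q (row_len k q r))
    \<le> phi \<delta> (row_len k q r) (\<lambda>l. X (r, l)) (\<lambda>l. X (r', l))"
proof -
  let ?M = "row_len k q r"
  let ?a = "pin_count q ?M"
  have a: "2 * ?a \<le> ?M" using pin_count_double[OF q] .
  have gap: "X (r', Suc ?a) \<le> 7 / 8 \<or> 1 - e \<le> X (r', Suc ?a) \<and> X (r, Suc ?a) \<le> 7 / 8"
  proof (cases "pin_count q (Suc ?M) = Suc ?a")
    case True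
    have "Suc ?a \<le> ?M" using a len by linarith
    then have "(r', Suc ?a) \<in> coords k q" "(r, Suc ?a) \<in> coords k q"
      using mem(2)[of "Suc ?a"] mem(1)[of "Suc ?a"] len by auto
    moreover have "cluster q (row_len k q r') (Suc ?a) = 2" "cluster q ?M (Suc ?a) \<noteq> 2"
      using True len by (auto simp: cluster_def)
    ultimately show ?thesis
      using cluster_bounds[of r' "Suc ?a"] cluster_bounds[of r "Suc ?a"] e
      by (cases rule: cluster_cases[of q ?M "Suc ?a"]) (auto simp: less_imp_le)
  next
    case False
    then have "pin_count q (Suc ?M) = ?a" using pin_count_step[OF q, of ?M] by simp
    then have "cluster q (row_len k q r') (Suc ?a) \<noteq> 2" using len by (auto simp: cluster_def)
    moreover have "(r', Suc ?a) \<in> coords k q" using mem(2)[of "Suc ?a"] len a by auto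
    ultimately show ?thesis
      using cluster_bounds[of r' "Suc ?a"] e
      by (cases rule: cluster_cases[of q "row_len k q r'" "Suc ?a"]) (auto simp: less_imp_le)
  qed
  have "1 / Gamma \<delta> ^ ?M * ((16 * e) powr (\<delta> - 1)) ^ (?a + ?a) \<le> phi \<delta> ?M (\<lambda>l. X (r, l)) (\<lambda>l. X (r', l))"
  proof (rule phi_ge[OF \<delta> e])
    show "interlaces ?M (\<lambda>l. X (r, l)) (\<lambda>l. X (r', l))"
      by (rule consecutive_rows_interlace[OF len(1) mem])
    show "X (r, i) < X (r', i) \<and> X (r', Suc i) < X (r, i)" if "i \<in> {1..?M}" for i
      using consecutive_rows[OF len(1) mem that] by simp
    show "X (r', 1) \<le> 1" using in_unit(2)[of r' 1] mem(2)[of 1] len by simp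
    show "?a + ?a \<le> ?M" "?a < ?M \<or> ?a = 0" using a by auto
    show "X (r, j) \<le> e" if "?M - ?a < j" "j \<le> ?M" for j
    proof -
      have "cluster q ?M j = 0" using that a by (auto simp: cluster_def)
      then show ?thesis using cluster_bounds(3)[of r j] mem(1)[of j] that by auto
    qed
    show "1 - e \<le> X (r, j)" if "1 \<le> j" "j \<le> ?a" for j
    proof -
      have "cluster q ?M j = 2" using that by (auto simp: cluster_def)
      then show ?thesis using cluster_bounds(1)[of r j] mem(1)[of j] that a by auto
    qed
  qed (rule gap)
  then show ?thesis by (simp add: mult_2)
qed

lemma edge_weight_ge_row:
  assumes \<delta>: "0 < \<delta>" "\<delta> \<le> 1"
    and mem: "\<And>l. l \<in> {1..row_len k q r} \<Longrightarrow> (r, l) \<in> coords k q"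
  shows "((16 * e) powr (\<delta> - 1)) ^ (2 * pin_count q (row_len k q r)) \<le> edge_weight (row_len k q r) (\<delta> - 1) (\<lambda>l. X (r, l))"
proof -
  let ?M = "row_len k q r"
  let ?a = "pin_count q ?M"
  have a: "2 * ?a \<le> ?M" using pin_count_double[OF q] .
  have ge1: "1 \<le> z powr (\<delta> - 1)" if "0 < z" "z < 1" for z :: real
    using powr_mono2'[of "\<delta> - 1" z 1] that \<delta> by simp
  have gee: "(16 * e) powr (\<delta> - 1) \<le> z powr (\<delta> - 1)" if "0 < z" "z < e" for z :: real
    using powr_mono2'[of "\<delta> - 1" z "16 * e"] that \<delta> e by simp
  have "((16 * e) powr (\<delta> - 1)) ^ card ({1..?a} \<union> {?M - ?a<..?M}) \<le> edge_weight ?M (\<delta> - 1) (\<lambda>l. X (r, l))"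
    unfolding edge_weight_def
  proof (rule prod_ge_power_subset)
    fix l assume "l \<in> {1..?M}"
    from in_unit[OF mem[OF this]]
    show "1 \<le> X (r, l) powr (\<delta> - 1) * (1 - X (r, l)) powr (\<delta> - 1)"
      using mult_mono[OF ge1[of "X (r, l)"] ge1[of "1 - X (r, l)"]] by simp
  next
    fix l assume l: "l \<in> {1..?a} \<union> {?M - ?a<..?M}"
    then have lM: "(r, l) \<in> coords k q" using a by (intro mem) auto
    note u = in_unit[OF lM]
    show "(16 * e) powr (\<delta> - 1) \<le> X (r, l) powr (\<delta> - 1) * (1 - X (r, l)) powr (\<delta> - 1)"
    proof (cases "l \<le> ?a")
      case True
      then have "cluster q ?M l = 2" by (simp add: cluster_def)
      then have "1 - X (r, l) < e" using cluster_bounds(1)[OF lM] by simp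
      then show ?thesis
        using mult_mono[OF ge1[of "X (r, l)"] gee[of "1 - X (r, l)"]] u by simp
    next
      case False
      then have "cluster q ?M l = 0" using l a by (auto simp: cluster_def)
      then have "X (r, l) < e" using cluster_bounds(3)[OF lM] by simp
      then show ?thesis
        using mult_mono[OF gee[of "X (r, l)"] ge1[of "1 - X (r, l)"]] u by simp
    qed
  qed (use a in auto)
  moreover have "card ({1..?a} \<union> {?M - ?a<..?M}) = 2 * ?a"
    using a by (subst card_Un_disjoint) auto
  ultimately show ?thesis by simp
qed

end

section \<open>Counting pinned coordinates\<close>

lemma constrained_rows_eq:
  assumes "1 \<le> k"
  shows "constrained_rows k q = (\<lambda>j. 2 * j * q) ` {1..k - 1}"
proof -
  have flip: "2 * k * q - 2 * j * q = 2 * (k - j) * q" for j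
    by (simp add: diff_mult_distrib diff_mult_distrib2)
  have "(\<lambda>j. 2 * k * q - 2 * j * q) ` {1..k div 2} = (\<lambda>j. 2 * j * q) ` (\<lambda>j. k - j) ` {1..k div 2}"
    by (simp add: image_image flip)
  also have "(\<lambda>j. k - j) ` {1..k div 2} = {k - k div 2..k - 1}"
  proof
    show "{k - k div 2..k - 1} \<subseteq> (\<lambda>j. k - j) ` {1..k div 2}"
    proof
      fix i assume "i \<in> {k - k div 2..k - 1}"
      then have "i = k - (k - i)" "k - i \<in> {1..k div 2}" using assms by auto
      then show "i \<in> (\<lambda>j. k - j) ` {1..k div 2}" by (rule image_eqI)
    qed
  qed (use assms in auto)
  finally have "constrained_rows k q = (\<lambda>j. 2 * j * q) ` ({1..k div 2} \<union> {k - k div 2..k - 1})"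
    unfolding constrained_rows_def by (simp add: image_Un)
  also have "{1..k div 2} \<union> {k - k div 2..k - 1} = {1..k - 1}" using assms by auto
  finally show ?thesis .
qed

lemma row_len_constrained:
  assumes "1 \<le> k" "1 \<le> q" "r \<in> constrained_rows k q"
  obtains i where "row_len k q r = 2 * i * q" "1 \<le> i" "r \<in> {1..2 * k * q - 1}"
proof -
  obtain j where j: "r = 2 * j * q" "1 \<le> j" "j \<le> k - 1"
  proof -
    have "r \<in> (\<lambda>j. 2 * j * q) ` {1..k - 1}" using assms by (simp add: constrained_rows_eq)
    then obtain j where "j \<in> {1..k - 1}" "r = 2 * j * q" by blast
    then show thesis using that[of j] by simp
  qed
  then have jk: "j < k" using assms by auto
  have "2 * k * q - 2 * j * q = 2 * (k - j) * q"
    by (simp add: diff_mult_distrib diff_mult_distrib2)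
  then have "row_len k q r = 2 * min j (k - j) * q"
    unfolding row_len_def j(1) by (simp add: min_mult_distrib_right[symmetric] min_def)
  moreover have "1 \<le> min j (k - j)" using j jk by auto
  moreover have "r \<in> {1..2 * k * q - 1}"
  proof -
    have "2 * j * q < 2 * k * q" using jk assms(2) by simp
    moreover have "1 \<le> 2 * j * q" using j assms(2) by (simp add: Suc_leI)
    ultimately show ?thesis unfolding j(1) atLeastAtMost_iff by (intro conjI; linarith)
  qed
  ultimately show thesis by (rule that)
qed

lemma cluster_balanced:
  assumes "2 * pin_count q M = M"
  shows "cluster q M l \<noteq> 1"
  using assms by (auto simp: cluster_def)

lemma cluster_constrained:
  assumes "1 \<le> k" "1 \<le> q" "r \<in> constrained_rows k q"
  shows "cluster q (row_len k q r) l \<noteq> 1"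
proof -
  obtain i where "row_len k q r = 2 * i * q" using row_len_constrained[OF assms] by metis
  then have "2 * pin_count q (row_len k q r) = row_len k q r" using pin_count_even[OF assms(2), of i] by simp
  then show ?thesis by (rule cluster_balanced)
qed

lemma eliminated_subset:
  assumes "1 \<le> k" "1 \<le> q"
  shows "eliminated k q \<subseteq> coords k q"
proof
  fix p assume "p \<in> eliminated k q"
  then obtain r where r: "r \<in> constrained_rows k q" "p = (r, row_len k q r)" by (auto simp: eliminated_def)
  obtain i where i: "row_len k q r = 2 * i * q" "1 \<le> i" "r \<in> {1..2 * k * q - 1}"
    using row_len_constrained[OF assms r(1)] by metis
  have "1 \<le> row_len k q r" using i assms(2) by (simp add: Suc_leI)
  then show "p \<in> coords k q" using i(3) r(2) by (simp add: coords_def)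
qed

lemma card_eliminated:
  assumes "1 \<le> k" "1 \<le> q"
  shows "card (eliminated k q) = k - 1"
  using assms unfolding eliminated_def constrained_rows_eq[OF assms(1)]
  by (subst card_image, simp add: inj_on_def)+ simp

definition pinned :: "nat \<Rightarrow> nat \<Rightarrow> (nat \<times> nat) set" where
  "pinned k q = {(r, l) \<in> coords k q. cluster q (row_len k q r) l \<noteq> 1}"

text \<open>The two halves have the same row lengths, and the middle row occurs once.\<close>

lemma sum_rows:
  fixes f :: "nat \<Rightarrow> nat"
  assumes "1 \<le> k * q"
  shows "(\<Sum>r=1..2 * k * q - 1. f (row_len k q r)) = 2 * (\<Sum>M=1..<k * q. f M) + f (k * q)"
proof -
  let ?N = "k * q"
  have N2: "2 * k * q = 2 * ?N" by simp
  have "{1..2 * k * q - 1} = {1..<?N} \<union> {?N} \<union> {?N<..2 * k * q - 1}" unfolding N2 using assms by auto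
  then have "(\<Sum>r=1..2 * k * q - 1. f (row_len k q r)) =
    (\<Sum>r=1..<?N. f (row_len k q r)) + f (row_len k q ?N) + (\<Sum>r\<in>{?N<..2 * k * q - 1}. f (row_len k q r))"
    by (simp only:, subst sum.union_disjoint, simp, simp, force, subst sum.union_disjoint) auto
  also have "(\<Sum>r=1..<?N. f (row_len k q r)) = (\<Sum>M=1..<?N. f M)"
    by (intro sum.cong) (auto simp: row_len_simps)
  also have "(\<Sum>r\<in>{?N<..2 * k * q - 1}. f (row_len k q r)) = (\<Sum>M=1..<?N. f M)"
    by (rule sum.reindex_bij_witness[of _ "\<lambda>M. 2 * k * q - M" "\<lambda>r. 2 * k * q - r"])
      (auto simp: row_len_def)
  finally show ?thesis by (simp add: row_len_simps)
qed

lemma card_pinned: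
  assumes "1 \<le> k" "1 \<le> q"
  shows "card (pinned k q) = k * (k - 1) * q\<^sup>2"
proof -
  have N: "1 \<le> k * q" using assms by (simp add: Suc_leI)
  have row: "card {l\<in>{1..M}. cluster q M l \<noteq> 1} = 2 * pin_count q M" for M
  proof -
    have d: "2 * pin_count q M \<le> M" using pin_count_double[OF assms(2)] .
    have "{l\<in>{1..M}. cluster q M l \<noteq> 1} = {1..pin_count q M} \<union> {M - pin_count q M<..M}"
      using d by (auto simp: cluster_def)
    then show ?thesis using d by (simp, subst card_Un_disjoint) auto
  qed
  have "pinned k q = (SIGMA r:{1..2 * k * q - 1}. {l\<in>{1..row_len k q r}. cluster q (row_len k q r) l \<noteq> 1})"
    by (auto simp: pinned_def coords_def)
  then have "card (pinned k q) = (\<Sum>r=1..2 * k * q - 1. 2 * pin_count q (row_len k q r))"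
    by (simp add: row[simplified] card_SigmaI)
  also have "\<dots> = 2 * (\<Sum>M=1..<k * q. 2 * pin_count q M) + 2 * pin_count q (k * q)"
    by (rule sum_rows[OF N, of "\<lambda>M. 2 * pin_count q M"])
  also have "\<dots> = 2 * (2 * (\<Sum>m<k * q. pin_count q m) + pin_count q (k * q))"
  proof -
    have "(\<Sum>m<k * q. pin_count q m) = pin_count q 0 + (\<Sum>M=1..<k * q. pin_count q M)"
      using N by (simp add: lessThan_atLeast0 sum.atLeast_Suc_lessThan)
    then show ?thesis using assms by (simp add: pin_count_less sum_distrib_left[symmetric])
  qed
  also have "\<dots> = k * (k - 1) * q\<^sup>2" by (rule pin_count_total[OF assms(2)])
  finally show ?thesis .
qed

text \<open>Constrained rows are pinned entirely, so each constraint removes a pinned coordinate.\<close>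

lemma card_pinned_free:
  assumes "1 \<le> k" "1 \<le> q"
  shows "card (pinned k q \<inter> free_coords k q) + (k - 1) = k * (k - 1) * q\<^sup>2"
proof -
  have sub: "eliminated k q \<subseteq> pinned k q"
    using eliminated_subset[OF assms] cluster_constrained[OF assms]
    by (auto simp: pinned_def eliminated_def)
  have "pinned k q \<inter> free_coords k q = pinned k q - eliminated k q"
    by (auto simp: pinned_def free_coords_def)
  moreover have fin: "finite (pinned k q)" by (rule finite_subset[of _ "coords k q"]) (auto simp: pinned_def)
  ultimately have "card (pinned k q \<inter> free_coords k q) + card (eliminated k q) = card (pinned k q)"
    using sub card_mono[OF fin sub] by (simp add: card_Diff_subset finite_subset[OF sub fin])
  then show ?thesis by (simp add: card_eliminated[OF assms] card_pinned[OF assms])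
qed

section \<open>Boxes of pinned configurations\<close>

text \<open>The free coordinates are allowed an error \<open>\<kappa>\<^sup>2 / 8\<close> instead of \<open>\<kappa> / 8\<close>, because an eliminated coordinate
  adds up the errors of its row, which has fewer than \<open>1 / \<kappa>\<close> entries.\<close>

definition scale_box :: "nat \<Rightarrow> nat \<Rightarrow> real \<Rightarrow> real \<Rightarrow> (nat \<times> nat \<Rightarrow> real) set" where
  "scale_box k q \<kappa> e = (\<Pi>\<^sub>E p\<in>free_coords k q.
     {center q \<kappa> e (row_len k q (fst p)) (snd p) - \<kappa>\<^sup>2 / 8 * scale_of q e (row_len k q (fst p)) (snd p) <..<
      center q \<kappa> e (row_len k q (fst p)) (snd p) + \<kappa>\<^sup>2 / 8 * scale_of q e (row_len k q (fst p)) (snd p)})"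

lemma fill_in_row_sum:
  assumes "1 \<le> k" "1 \<le> q" "r \<in> constrained_rows k q"
  shows "(\<Sum>l=1..row_len k q r. fill_in k q w (r, l)) = real (row_len k q r) / 2"
proof -
  let ?M = "row_len k q r"
  have p: "(r, ?M) \<in> eliminated k q" using assms by (auto simp: eliminated_def)
  then have pc: "(r, ?M) \<in> coords k q" using eliminated_subset[OF assms(1,2)] by auto
  have M: "1 \<le> ?M" using pc by (simp add: coords_def)
  have "fill_in k q w (r, l) = w (r, l)" if "l \<in> {1..<?M}" for l
    using that before_last_free[OF pc, of l] by (auto intro: fill_in_free)
  then have "(\<Sum>l=1..<?M. fill_in k q w (r, l)) = (\<Sum>l=1..<?M. w (r, l))" by (intro sum.cong) auto
  moreover have "{1..?M} = insert ?M {1..<?M}" using M by auto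
  ultimately show ?thesis using fill_in_eliminated[OF pc p] by simp
qed

lemma scale_box_pinned_config:
  assumes "1 \<le> k" "1 \<le> q" "0 < e" "e \<le> 1 / 16" and \<kappa>: "\<kappa> = 1 / (real (k * q) + 1)"
    and w: "w \<in> scale_box k q \<kappa> e"
  shows "pinned_config k q e \<kappa> (fill_in k q w)"
proof
  show "1 \<le> q" "1 \<le> k" "0 < e" "e \<le> 1 / 16" "\<kappa> = 1 / (real (k * q) + 1)" by fact+
  have kpos: "0 < \<kappa>" "\<kappa> \<le> 1" unfolding \<kappa> by (simp_all add: add_nonneg_pos)
  have free: "\<bar>w (r, l) - center q \<kappa> e (row_len k q r) l\<bar> < \<kappa>\<^sup>2 / 8 * scale_of q e (row_len k q r) l"
    if "(r, l) \<in> free_coords k q" for r l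
  proof -
    let ?c = "center q \<kappa> e (row_len k q r) l" and ?d = "\<kappa>\<^sup>2 / 8 * scale_of q e (row_len k q r) l"
    have "w (r, l) \<in> {?c - ?d<..<?c + ?d}" using PiE_mem[OF w[unfolded scale_box_def] that] by simp
    then have "?c - ?d < w (r, l)" "w (r, l) < ?c + ?d" by simp_all
    then show ?thesis unfolding abs_less_iff by (intro conjI; linarith)
  qed
  have u: "0 < scale_of q e M l" for M l using assms(3) by (simp add: scale_of_def)
  fix r l assume p: "(r, l) \<in> coords k q"
  let ?M = "row_len k q r"
  show "\<bar>fill_in k q w (r, l) - center q \<kappa> e ?M l\<bar> < \<kappa> / 8 * scale_of q e ?M l"
  proof (cases "(r, l) \<in> eliminated k q")
    case False
    then have f: "(r, l) \<in> free_coords k q" using p by (simp add: free_coords_def)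
    have "\<kappa>\<^sup>2 / 8 * scale_of q e ?M l \<le> \<kappa> / 8 * scale_of q e ?M l"
      using kpos u[of ?M l] by (intro mult_right_mono) (auto simp: power2_eq_square intro: mult_left_le)
    then show ?thesis using free[OF f] fill_in_free[OF f, of w] by simp
  next
    case True
    then have l: "l = ?M" and r: "r \<in> constrained_rows k q" by (auto simp: eliminated_def)
    have M: "1 \<le> ?M" "?M \<le> k * q" using p by (auto simp: coords_def row_len_def)
    have unit: "scale_of q e ?M m = e" for m
      using cluster_constrained[OF assms(1,2) r] by (simp add: scale_of_def)
    have set: "{1..?M} = insert ?M {1..<?M}" using M by auto
    have "(\<Sum>m=1..?M. center q \<kappa> e ?M m) = real ?M / 2" by (rule center_sum[OF assms(2)])
    then have c: "center q \<kappa> e ?M ?M = real ?M / 2 - (\<Sum>m=1..<?M. center q \<kappa> e ?M m)"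
      unfolding set by simp
    have "fill_in k q w (r, ?M) - center q \<kappa> e ?M ?M = - (\<Sum>m=1..<?M. w (r, m) - center q \<kappa> e ?M m)"
      using fill_in_eliminated[OF p[unfolded l] True[unfolded l], of w] c by (simp add: sum_subtractf)
    then have "\<bar>fill_in k q w (r, ?M) - center q \<kappa> e ?M ?M\<bar> \<le> (\<Sum>m=1..<?M. \<bar>w (r, m) - center q \<kappa> e ?M m\<bar>)"
      by (simp add: sum_abs)
    also have "\<dots> \<le> (\<Sum>m=1..<?M. \<kappa>\<^sup>2 / 8 * e)"
      using free before_last_free[OF p] unit by (intro sum_mono) (fastforce intro: less_imp_le)
    also have "\<dots> = real (?M - 1) * (\<kappa>\<^sup>2 / 8 * e)" by simp
    also have "\<dots> \<le> real (k * q) * (\<kappa>\<^sup>2 / 8 * e)"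
      using M assms(3) by (intro mult_right_mono) (auto simp flip: of_nat_mult)
    also have "\<dots> = (real (k * q) * \<kappa>) * (\<kappa> / 8 * e)" by (simp add: power2_eq_square)
    also have "\<dots> < 1 * (\<kappa> / 8 * e)"
    proof (rule mult_strict_right_mono)
      have "\<kappa> * (real (k * q) + 1) = 1" unfolding \<kappa> by (simp add: add_nonneg_eq_0_iff)
      then show "real (k * q) * \<kappa> < 1" using kpos by (simp add: algebra_simps)
      show "0 < \<kappa> / 8 * e" using kpos assms(3) by simp
    qed
    finally show ?thesis using l unit by simp
  qed
qed

lemma pinned_config_I_c:
  assumes "pinned_config k q e \<kappa> X" and X: "X = fill_in k q w"
  shows "X \<in> I_c k q"
proof -
  interpret pinned_config k q e \<kappa> X by fact
  have "X \<in> coords k q \<rightarrow>\<^sub>E {0..1}"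
    using in_unit unfolding X by (intro PiE_I) (force simp: fill_in_def less_imp_le)+
  moreover have "W_plus i (xrow X i)" "W_plus i (txrow k q X i)" if "i \<in> {1..k * q}" for i
    using that row_W_plus[of i] row_W_plus[of "2 * k * q - i"] coords_left[of _ i k q] coords_right[of _ i k q]
    by (auto simp: row_len_simps xrow_def txrow_def)
  moreover have "interlaces i (xrow X i) (xrow X (i + 1))"
    "interlaces i (txrow k q X i) (txrow k q X (i + 1))" if "i \<in> {1..<k * q}" for i
    using that consecutive_rows_interlace[of "Suc i" i] coords_left[of _ i k q] coords_left[of _ "Suc i" k q]
      consecutive_rows_interlace[of "2 * k * q - Suc i" "2 * k * q - i"]
      coords_right[of _ i k q] coords_right[of _ "Suc i" k q]
    by (auto simp: row_len_simps xrow_def txrow_def)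
  moreover have "(\<Sum>i=1..2 * j * q. xrow X (2 * j * q) i) = real (j * q)"
    "(\<Sum>i=1..2 * j * q. txrow k q X (2 * j * q) i) = real (j * q)" if j: "j \<in> {1..k div 2}" for j
  proof -
    have le: "2 * j * q \<le> k * q"
      using j by (intro mult_right_mono) auto
    have r: "2 * j * q \<in> constrained_rows k q" "2 * k * q - 2 * j * q \<in> constrained_rows k q"
      using j by (auto simp: constrained_rows_def)
    show "(\<Sum>i=1..2 * j * q. xrow X (2 * j * q) i) = real (j * q)"
      using fill_in_row_sum[OF k q r(1), of w] le unfolding X xrow_def by (simp add: row_len_simps)
    show "(\<Sum>i=1..2 * j * q. txrow k q X (2 * j * q) i) = real (j * q)"
      using fill_in_row_sum[OF k q r(2), of w] le unfolding X txrow_def by (simp add: row_len_simps)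
  qed
  ultimately show ?thesis unfolding I_c_def by blast
qed

text \<open>Each row contributes one factor \<open>(16 * e) powr (\<delta> - 1)\<close> for each of its pinned entries: the
  shorter rows through the weight to the next row, the middle row through the endpoints.\<close>

lemma (in pinned_config) integrand_ge:
  assumes \<beta>: "2 \<le> \<beta>" and I: "X \<in> I_c k q"
  defines "\<delta> \<equiv> 2 / \<beta>"
  shows "(1 / Gamma \<delta>) ^ (k * q) * (gamma_prod \<delta> (k * q))\<^sup>2 * ((16 * e) powr (\<delta> - 1)) ^ (k * (k - 1) * q\<^sup>2)
    \<le> integrand \<beta> k q X"
proof -
  let ?N = "k * q" and ?c = "(16 * e) powr (\<delta> - 1)"
  have \<delta>: "0 < \<delta>" "\<delta> \<le> 1" using \<beta> by (auto simp: \<delta>_def)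
  have N: "1 \<le> ?N" using k q by (simp add: Suc_leI)
  have G: "0 \<le> 1 / Gamma \<delta> ^ M" for M using \<delta> by (simp add: Gamma_real_pos less_imp_le)
  let ?S = "\<Sum>M=1..<?N. 2 * pin_count q M"
  have one: "edge_weight M (\<delta> - 1) (txrow k q X M) * edge_weight M (1 - \<delta>) (txrow k q X M) = 1"
    if "M \<in> {1..<?N}" for M
  proof -
    have "0 < txrow k q X M j \<and> txrow k q X M j < 1" if "j \<in> {1..M}" for j
      using in_unit[OF coords_right[of j M k q]] that \<open>M \<in> {1..<?N}\<close> by (simp add: txrow_def)
    then have "0 < edge_weight M d (txrow k q X M)" for d
      unfolding edge_weight_def by (intro prod_pos) (auto intro!: mult_pos_pos simp: less_imp_neq[symmetric])
    then have "edge_weight M (\<delta> - 1) (txrow k q X M) * edge_weight M (1 - \<delta>) (txrow k q X M) \<noteq> 0" by (simp add: less_imp_neq[symmetric])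
    then show ?thesis using edge_weight_mult_inverse[of M "\<delta> - 1" "txrow k q X M"] by simp
  qed
  have p1: "gamma_prod \<delta> ?N * ?c ^ ?S \<le> (\<Prod>M=1..<?N. phi \<delta> M (xrow X M) (xrow X (Suc M)))"
    unfolding gamma_prod_def power_sum prod.distrib[symmetric]
  proof (intro prod_mono conjI)
    fix M assume M: "M \<in> {1..<?N}"
    then show "1 / Gamma \<delta> ^ M * ?c ^ (2 * pin_count q M) \<le> phi \<delta> M (xrow X M) (xrow X (Suc M))"
      using phi_ge_rows[OF \<delta>, of "Suc M" M] coords_left[of _ M k q] coords_left[of _ "Suc M" k q]
      by (simp add: row_len_simps xrow_def)
  qed (use G in \<open>auto intro!: mult_nonneg_nonneg\<close>)
  have p2: "gamma_prod \<delta> ?N * ?c ^ ?S \<le> (\<Prod>M=1..<?N. phi \<delta> M (txrow k q X M) (txrow k q X (Suc M)))"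
    unfolding gamma_prod_def power_sum prod.distrib[symmetric]
  proof (intro prod_mono conjI)
    fix M assume M: "M \<in> {1..<?N}"
    then show "1 / Gamma \<delta> ^ M * ?c ^ (2 * pin_count q M) \<le> phi \<delta> M (txrow k q X M) (txrow k q X (Suc M))"
      using phi_ge_rows[OF \<delta>, of "2 * k * q - Suc M" "2 * k * q - M"]
        coords_right[of _ M k q] coords_right[of _ "Suc M" k q]
      by (simp add: row_len_simps txrow_def)
  qed (use G in \<open>auto intro!: mult_nonneg_nonneg\<close>)
  have p3: "?c ^ (2 * pin_count q ?N) \<le> edge_weight ?N (\<delta> - 1) (txrow k q X ?N)"
    using edge_weight_ge_row[OF \<delta>, of ?N] coords_left[of _ ?N k q]
    by (simp add: row_len_simps txrow_middle xrow_def)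
  have g0: "0 \<le> gamma_prod \<delta> ?N" unfolding gamma_prod_def using G by (intro prod_nonneg) auto
  have exp: "?S + ?S + 2 * pin_count q ?N = k * (k - 1) * q\<^sup>2"
  proof -
    have "(\<Sum>m<?N. pin_count q m) = pin_count q 0 + (\<Sum>M=1..<?N. pin_count q M)"
      using N by (simp add: lessThan_atLeast0 sum.atLeast_Suc_lessThan)
    then show ?thesis
      using pin_count_total[OF q, of k] q by (simp add: pin_count_less sum_distrib_left[symmetric])
  qed
  have "(1 / Gamma \<delta>) ^ ?N * (gamma_prod \<delta> ?N)\<^sup>2 * ?c ^ (k * (k - 1) * q\<^sup>2) =
    (1 / Gamma \<delta>) ^ ?N * (gamma_prod \<delta> ?N * ?c ^ ?S) * (gamma_prod \<delta> ?N * ?c ^ ?S) * ?c ^ (2 * pin_count q ?N)"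
    unfolding exp[symmetric] power_add by (simp add: power2_eq_square)
  also have "\<dots> \<le> (1 / Gamma \<delta>) ^ ?N
    * (\<Prod>M=1..<?N. phi \<delta> M (xrow X M) (xrow X (Suc M)))
    * (\<Prod>M=1..<?N. phi \<delta> M (txrow k q X M) (txrow k q X (Suc M)))
    * edge_weight ?N (\<delta> - 1) (txrow k q X ?N)"
    using p1 p2 p3 g0 \<delta>
    by (intro mult_mono mult_nonneg_nonneg prod_nonneg ballI phi_nonneg order_refl)
      (auto simp: Gamma_real_pos less_imp_le)
  also have "\<dots> = integrand \<beta> k q X"
    using integrand_eq[OF N, of X \<beta>] I_c_bounds(2)[OF I] one unfolding \<delta>_def by simp
  finally show ?thesis .
qed

section \<open>Divergence\<close>

lemma sets_scale_box: "scale_box k q \<kappa> e \<in> sets (\<Pi>\<^sub>M p\<in>free_coords k q. (lborel :: real measure))"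
  unfolding scale_box_def by (rule sets_PiM_I_finite) auto

lemma emeasure_scale_box:
  assumes "0 < e"
  shows "emeasure (\<Pi>\<^sub>M p\<in>free_coords k q. (lborel :: real measure)) (scale_box k q \<kappa> e) =
    ennreal ((\<kappa>\<^sup>2 / 4) ^ card (free_coords k q) * e ^ card (pinned k q \<inter> free_coords k q))"
proof -
  interpret product_sigma_finite "\<lambda>_::nat \<times> nat. lborel :: real measure" ..
  let ?u = "\<lambda>p. scale_of q e (row_len k q (fst p)) (snd p)"
  have u: "0 < ?u p" for p using assms by (simp add: scale_of_def)
  have "emeasure (\<Pi>\<^sub>M p\<in>free_coords k q. (lborel :: real measure)) (scale_box k q \<kappa> e) =
    (\<Prod>p\<in>free_coords k q. ennreal (\<kappa>\<^sup>2 / 4 * ?u p))"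
    unfolding scale_box_def
  proof (subst emeasure_PiM)
    have "emeasure lborel {center q \<kappa> e (row_len k q (fst p)) (snd p) - \<kappa>\<^sup>2 / 8 * ?u p <..<
       center q \<kappa> e (row_len k q (fst p)) (snd p) + \<kappa>\<^sup>2 / 8 * ?u p} = ennreal (\<kappa>\<^sup>2 / 4 * ?u p)" for p
    proof -
      have "0 \<le> \<kappa>\<^sup>2 / 8 * ?u p" using u[of p] by simp
      then show ?thesis by (subst emeasure_lborel_Ioo) (auto simp: field_simps)
    qed
    then show "(\<Prod>p\<in>free_coords k q. emeasure lborel {center q \<kappa> e (row_len k q (fst p)) (snd p) - \<kappa>\<^sup>2 / 8 * ?u p <..<
       center q \<kappa> e (row_len k q (fst p)) (snd p) + \<kappa>\<^sup>2 / 8 * ?u p}) =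
       (\<Prod>p\<in>free_coords k q. ennreal (\<kappa>\<^sup>2 / 4 * ?u p))" by simp
  qed auto
  also have "\<dots> = ennreal (\<Prod>p\<in>free_coords k q. \<kappa>\<^sup>2 / 4 * ?u p)"
    using u by (intro prod_ennreal) (auto simp: less_imp_le)
  also have "(\<Prod>p\<in>free_coords k q. \<kappa>\<^sup>2 / 4 * ?u p) =
      (\<kappa>\<^sup>2 / 4) ^ card (free_coords k q) * (\<Prod>p\<in>free_coords k q. ?u p)"
    by (simp only: prod.distrib prod_constant)
  also have "(\<Prod>p\<in>free_coords k q. ?u p) = (\<Prod>p\<in>free_coords k q. if p \<in> pinned k q then e else 1)"
    using free_coords_subset[of k q]
    by (intro prod.cong) (auto simp: pinned_def scale_of_def)
  also have "\<dots> = (\<Prod>p\<in>free_coords k q \<inter> pinned k q. e)"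
    by (subst prod.inter_restrict) auto
  finally show ?thesis by (simp add: Int_commute)
qed

text \<open>Infinitely many disjoint sets that contribute at least \<open>d\<close> each.\<close>

lemma nn_integral_eq_infinity:
  fixes f :: "'a \<Rightarrow> ennreal" and c :: "nat \<Rightarrow> ennreal" and d :: ennreal
  assumes d: "0 < d" and B: "\<And>n. B n \<in> sets M" and disj: "disjoint_family B"
    and ge: "\<And>n x. x \<in> B n \<Longrightarrow> c n \<le> f x" and big: "\<And>n. d \<le> c n * emeasure M (B n)"
  shows "(\<integral>\<^sup>+ x. f x \<partial>M) = \<infinity>"
proof -
  have "(\<Sum>n. d) \<le> (\<Sum>n. c n * emeasure M (B n))" by (intro suminf_le big) auto
  also have "\<dots> = (\<Sum>n. \<integral>\<^sup>+ x. c n * indicator (B n) x \<partial>M)"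
    using B by (simp add: nn_integral_cmult_indicator)
  also have "\<dots> = (\<integral>\<^sup>+ x. (\<Sum>n. c n * indicator (B n) x) \<partial>M)"
    using B by (intro nn_integral_suminf[symmetric]) auto
  also have "\<dots> \<le> (\<integral>\<^sup>+ x. f x \<partial>M)"
  proof (rule nn_integral_mono)
    fix x
    show "(\<Sum>n. c n * indicator (B n) x) \<le> f x"
    proof (cases "\<exists>n. x \<in> B n")
      case True
      then obtain n where n: "x \<in> B n" by auto
      have "c m * indicator (B m) x = 0" if "m \<noteq> n" for m
        using disj n that by (auto simp: disjoint_family_on_def indicator_def)
      then have "(\<Sum>n. c n * indicator (B n) x) = (\<Sum>m\<in>{n}. c m * indicator (B m) x)"
        by (intro suminf_finite) auto
      then show ?thesis using ge[OF n] n by simp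
    next
      case False
      then show ?thesis by (auto simp: indicator_def)
    qed
  qed
  finally have "(\<Sum>n::nat. d) \<le> (\<integral>\<^sup>+ x. f x \<partial>M)" .
  moreover have "(\<Sum>n::nat. d) = \<infinity>"
    using d unfolding nn_integral_count_space_nat[symmetric]
    by (simp add: ennreal_mult_eq_top_iff)
  ultimately show ?thesis by (simp add: top_unique)
qed

text \<open>The first entry of row \<open>2 * q\<close> reveals the scale up to a constant factor. The row is
  constrained, so its entries are pinned, and it has at least two of them, so that the first is free.\<close>

lemma scale_box_witness:
  assumes "2 \<le> k" "1 \<le> q" "0 < e" "e \<le> 1 / 16" "\<kappa> = 1 / (real (k * q) + 1)" "w \<in> scale_box k q \<kappa> e"
  shows "e * \<kappa> / 2 < 1 - w (2 * q, 1) \<and> 1 - w (2 * q, 1) < e"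
proof -
  interpret pinned_config k q e \<kappa> "fill_in k q w"
    using assms by (intro scale_box_pinned_config) auto
  have le: "2 * q \<le> k * q" using assms(1) by simp
  have c: "(2 * q, 2 * q) \<in> coords k q" "(2 * q, 1) \<in> coords k q"
    using coords_left[of "2 * q" "2 * q" k q] coords_left[of 1 "2 * q" k q] le q by auto
  have f: "(2 * q, 1) \<in> free_coords k q"
    using before_last_free[OF c(1), of 1] q le by (simp add: row_len_simps)
  have "cluster q (2 * q) 1 = 2" using pin_count_even[OF q, of 1] q by (simp add: cluster_def)
  then show ?thesis using cluster_bounds(1)[OF c(2)] fill_in_free[OF f, of w] le by (simp add: row_len_simps)
qed

text \<open>On the box of scale \<open>e\<close> the integrand times the volume is a constant times \<open>e\<close> to the power
  \<open>\<delta> * P - (k - 1)\<close>, where \<open>P = k * (k - 1) * q\<^sup>2\<close> counts the pinned coordinates. This exponent is not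
  positive precisely when \<open>\<delta> * k * q\<^sup>2 \<le> 1\<close>. At equality a single scale contributes only a bounded
  amount, and divergence comes from infinitely many disjoint boxes.\<close>

lemma c_coeff_infinite:
  assumes k: "2 \<le> k" and q: "1 \<le> q" and \<beta>: "2 * real k * (real q)\<^sup>2 \<le> \<beta>"
  shows "c_coeff \<beta> k q = \<infinity>"
proof -
  define \<delta> where "\<delta> = 2 / \<beta>"
  define \<kappa> where "\<kappa> = 1 / (real (k * q) + 1)"
  \<comment> \<open>The ratio \<open>\<kappa> / 2\<close> makes the ranges of the revealing entry disjoint.\<close>
  define e where "e n = (\<kappa> / 2) ^ n / 16" for n :: nat
  define P where "P = k * (k - 1) * q\<^sup>2"
  define A where "A = (1 / Gamma \<delta>) ^ (k * q) * (gamma_prod \<delta> (k * q))\<^sup>2"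
  define c where "c n = A * ((16 * e n) powr (\<delta> - 1)) ^ P" for n
  define D where "D = A * (16 powr (\<delta> - 1)) ^ P * (\<kappa>\<^sup>2 / 4) ^ card (free_coords k q)"
  let ?P = "\<Pi>\<^sub>M p\<in>free_coords k q. (lborel :: real measure)"
  have kq: "1 \<le> real k * (real q)\<^sup>2"
    using k q by (intro mult_ge1_I) auto
  have \<beta>2: "2 \<le> \<beta>" using \<beta> kq by linarith
  have \<delta>: "0 < \<delta>" "\<delta> * (real k * (real q)\<^sup>2) \<le> 1"
    using \<beta> \<beta>2 by (auto simp: \<delta>_def field_simps)
  have kap: "0 < \<kappa>" "\<kappa> \<le> 1" unfolding \<kappa>_def by (simp_all add: add_nonneg_pos)
  have e: "0 < e n" "e n \<le> 1 / 16" for n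
    using kap by (auto simp: e_def intro!: power_le_one)
  have A: "0 < A"
    using \<delta> by (auto simp: A_def gamma_prod_def intro!: mult_pos_pos zero_less_power prod_pos Gamma_real_pos)
  have D: "0 < D" using A kap by (simp add: D_def)
  have "c_coeff \<beta> k q = (\<integral>\<^sup>+ w. ennreal (integrand \<beta> k q (fill_in k q w)) * indicator (I_c k q) (fill_in k q w) \<partial>?P)"
    by (simp add: c_coeff_def)
  also have "\<dots> = \<infinity>"
  proof (rule nn_integral_eq_infinity[where B = "\<lambda>n. scale_box k q \<kappa> (e n)" and c = "\<lambda>n. ennreal (c n)" and d = "ennreal D"])
    show "0 < ennreal D" using D by simp
    show "scale_box k q \<kappa> (e n) \<in> sets ?P" for n by (rule sets_scale_box)
    show "disjoint_family (\<lambda>n. scale_box k q \<kappa> (e n))"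
    proof -
      have "scale_box k q \<kappa> (e m) \<inter> scale_box k q \<kappa> (e n) = {}" if "m < n" for m n
      proof (rule ccontr)
        assume "scale_box k q \<kappa> (e m) \<inter> scale_box k q \<kappa> (e n) \<noteq> {}"
        then obtain w where w: "w \<in> scale_box k q \<kappa> (e m)" "w \<in> scale_box k q \<kappa> (e n)" by auto
        have "e m * \<kappa> / 2 < 1 - w (2 * q, 1)" "1 - w (2 * q, 1) < e n"
          using scale_box_witness[OF k q e \<kappa>_def w(1)] scale_box_witness[OF k q e \<kappa>_def w(2)] by auto
        moreover have "e n \<le> e (Suc m)"
          unfolding e_def using kap that by (intro divide_right_mono power_decreasing) auto
        moreover have "e (Suc m) = e m * \<kappa> / 2" by (simp add: e_def)
        ultimately show False by linarith
      qed
      then show ?thesis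
        unfolding disjoint_family_on_def by (metis Int_commute linorder_neqE_nat)
    qed
  next
    fix n w assume w: "w \<in> scale_box k q \<kappa> (e n)"
    interpret pinned_config k q "e n" \<kappa> "fill_in k q w"
      using scale_box_pinned_config[OF _ q e \<kappa>_def w] k by simp
    have I: "fill_in k q w \<in> I_c k q" by (rule pinned_config_I_c[OF _ refl]) unfold_locales
    then show "ennreal (c n) \<le> ennreal (integrand \<beta> k q (fill_in k q w)) * indicator (I_c k q) (fill_in k q w)"
      using integrand_ge[OF \<beta>2 I] by (simp add: c_def A_def \<delta>_def P_def ennreal_leI)
  next
    fix n
    let ?F = "card (pinned k q \<inter> free_coords k q)"
    have F: "real ?F + (real k - 1) = real P"
      using arg_cong[OF card_pinned_free[of k q], of real] k q by (simp add: P_def of_nat_diff)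
    have Pr: "real P = real k * (real k - 1) * (real q)\<^sup>2" using k by (simp add: P_def of_nat_diff)
    have "\<delta> * real P \<le> real k - 1"
    proof -
      have "\<delta> * real P = (\<delta> * (real k * (real q)\<^sup>2)) * (real k - 1)" by (simp add: Pr)
      also have "\<dots> \<le> 1 * (real k - 1)" using \<delta> k by (intro mult_right_mono) auto
      finally show ?thesis by simp
    qed
    then have exponent: "(\<delta> - 1) * real P + real ?F \<le> 0" using F by (simp add: algebra_simps)
    have "D * 1 \<le> D * e n powr ((\<delta> - 1) * real P + real ?F)"
    proof (rule mult_left_mono)
      show "1 \<le> e n powr ((\<delta> - 1) * real P + real ?F)"
        using powr_mono2'[OF exponent, of "e n" 1] e[of n] by simp
    qed (use D in simp)
    also have "\<dots> = c n * ((\<kappa>\<^sup>2 / 4) ^ card (free_coords k q) * e n ^ ?F)"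
    proof -
      have "((16 * e n) powr (\<delta> - 1)) ^ P = (16 powr (\<delta> - 1)) ^ P * e n powr ((\<delta> - 1) * real P)"
        using e[of n] by (simp add: powr_mult power_mult_distrib powr_power mult.commute)
      moreover have "e n powr real ?F = e n ^ ?F" using e[of n] by (simp add: powr_realpow)
      ultimately show ?thesis by (simp add: c_def D_def powr_add mult_ac)
    qed
    finally have "D \<le> c n * ((\<kappa>\<^sup>2 / 4) ^ card (free_coords k q) * e n ^ ?F)" by simp
    moreover have "0 \<le> c n" using A by (simp add: c_def)
    ultimately show "ennreal D \<le> ennreal (c n) * emeasure ?P (scale_box k q \<kappa> (e n))"
      unfolding emeasure_scale_box[OF e(1)] using e[of n] by (simp add: ennreal_leI flip: ennreal_mult)
  qed
  finally show ?thesis .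
qed

section \<open>The set of admissible parameters\<close>

theorem proposition1p3:
  fixes k q :: nat
  assumes "k \<ge> 1" and "q \<ge> 1"
  shows "(k = 1 \<longrightarrow> A_set k q = {0<..}) \<and>
         (k = 2 \<longrightarrow> A_set k q = {0<..<4 * (real q)^2}) \<and>
         (k \<ge> 3 \<longrightarrow> {0<..2} \<subseteq> A_set k q \<and>
                    {2 * real k * (real q)^2..} \<inter> A_set k q = {})"
proof (intro conjI impI)
  have N: "k * q \<ge> 1" using assms by (simp add: Suc_leI)
  have small: "c_coeff \<beta> k q < \<infinity>" if "0 < \<beta>" "\<beta> \<le> 2" for \<beta>
    using c_coeff_finite_of_le_2[OF N that] .
  show "A_set k q = {0<..}" if "k = 1"
    using small c_coeff_finite_k_1[OF that assms(2)] by (auto simp: A_set_def) (meson linear)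
  show "A_set k q = {0<..<4 * (real q)\<^sup>2}" if k: "k = 2"
  proof -
    have "\<beta> < 4 * (real q)\<^sup>2" if "c_coeff \<beta> k q < \<infinity>" for \<beta>
      using c_coeff_infinite[of k q \<beta>] that k assms(2) by (cases "\<beta> < 4 * (real q)\<^sup>2") auto
    moreover have "c_coeff \<beta> k q < \<infinity>" if "0 < \<beta>" "\<beta> < 4 * (real q)\<^sup>2" for \<beta>
      using small[of \<beta>] c_coeff_finite_k_2[OF k assms(2), of \<beta>] that by (cases "\<beta> \<le> 2") auto
    ultimately show ?thesis by (auto simp: A_set_def)
  qed
  assume k: "3 \<le> k"
  show "{0<..2} \<subseteq> A_set k q" using small by (auto simp: A_set_def)
  show "{2 * real k * (real q)\<^sup>2..} \<inter> A_set k q = {}"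
    using c_coeff_infinite[of k q] k assms(2) by (auto simp: A_set_def)
qed

end
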